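(* Let $\mathfrak w\subseteq\mathfrak g\times\mathfrak g$ be a Lie subalgebra such that $[(h,h),\mathfrak w]\subseteq\mathfrak w$ for all $h\in\mathfrak h$ and $\mathfrak d\oplus\mathfrak w=\mathfrak g\times\mathfrak g$. Then there are a regular partition $\Delta=S_+\sqcup S_-$ and subspaces $\mathfrak s_\pm=\mathfrak t_\pm\oplus\mathfrak r_\pm\subseteq\mathfrak h$, having the properties $\mathfrak h=\mathfrak s_++\mathfrak s_-$ and $\mathfrak t_+\cap\mathfrak t_-=\{0\}$, such that $$\mathfrak w=\Big(\big(\mathfrak t_+\oplus\bigoplus_{\alpha\in S_+}\mathfrak g_\alpha\big)\times\{0\}\Big)\oplus\Big(\{0\}\times\big(\mathfrak t_-\oplus\bigoplus_{\beta\in S_-}\mathfrak g_\beta\big)\Big)\oplus\mathrm{span}_F\{(h,\phi(h))\mid h\in\mathfrak r_+\},\qquad(\ast)$$ where $\phi\colon\mathfrak r_+\to\mathfrak r_-$ is a vector space isomorphism with no non-zero fixed points. The converse direction is also true: every regular partition $\Delta=S_+\sqcup S_-$ together with a datum $(\mathfrak t_\pm,\mathfrak r_\pm,\phi)$ with the properties above defines by $(\ast)$ a subalgebra $\mathfrak w\subseteq\mathfrak g\times\mathfrak g$ with $[(h,h),\mathfrak w]\subseteq\mathfrak w$ for all $h\in\mathfrak h$ and $\mathfrak d\oplus\mathfrak w=\mathfrak g\times\mathfrak g$. In other words, all such subalgebras are described by regular partitions $\Delta=S_+\sqcup S_-$ and the extra datum $(\mathfrak t_\pm,\mathfrak r_\pm,\phi)$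 describing the gluing of the Cartan parts.
   Context: $F$ is an algebraically closed field of characteristic $0$; $\mathfrak g$ is a finite-dimensional simple Lie algebra over $F$ with Cartan subalgebra $\mathfrak h$, root system $\Delta$ and root spaces $\mathfrak g_\alpha$. $\mathfrak d=\{(a,a)\mid a\in\mathfrak g\}$ is the diagonal in $\mathfrak g\times\mathfrak g$. A subset $S\subseteq\Delta$ is closed if $\alpha,\beta\in S$ and $\alpha+\beta\in\Delta$ imply $\alpha+\beta\in S$. A regular partition $\Delta=S_+\sqcup S_-$ is a partition into two closed subsets.
   Formalization: The converse is false as stated (sl_2: S_+=Δ, t_+=r_±=0, t_-=h). Proved: w is a subalgebra iff [g_α,g_-α] lies in t_± when ±α both lie in S_±; d⊕w=g×g iff dim t_+ + dim t_- + dim r_+ = dim h and φ(h)-h in t_+ + t_- forces h=0. *)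

theory Defs
  imports
    "HOL-Computational_Algebra.Polynomial"
    "HOL-Library.Product_Plus"
    "HOL-Library.Set_Algebras"
begin

locale lie_algebra = vector_space scale
  for scale :: "'f::field \<Rightarrow> 'g::ab_group_add \<Rightarrow> 'g" +
  fixes bracket :: "'g \<Rightarrow> 'g \<Rightarrow> 'g"
  assumes bracket_add_left: "bracket (x + y) z = bracket x z + bracket y z"
    and bracket_add_right: "bracket x (y + z) = bracket x y + bracket x z"
    and bracket_scale_left: "bracket (scale c x) y = scale c (bracket x y)"
    and bracket_scale_right: "bracket x (scale c y) = scale c (bracket x y)"
    and bracket_self: "bracket x x = 0"
    and jacobi:
      "bracket x (bracket y z) + bracket y (bracket z x) + bracket z (bracket x y) = 0"
begin

definition lie_subalgebra :: "'g set \<Rightarrow> bool" where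
  "lie_subalgebra A \<longleftrightarrow> subspace A \<and> (\<forall>x\<in>A. \<forall>y\<in>A. bracket x y \<in> A)"

definition lie_ideal :: "'g set \<Rightarrow> bool" where
  "lie_ideal A \<longleftrightarrow> subspace A \<and> (\<forall>x. \<forall>y\<in>A. bracket x y \<in> A)"

primrec lower_central :: "'g set \<Rightarrow> nat \<Rightarrow> 'g set" where
  "lower_central A 0 = A"
| "lower_central A (Suc n) = span {bracket x y | x y. x \<in> A \<and> y \<in> lower_central A n}"

definition nilpotent_subalgebra :: "'g set \<Rightarrow> bool" where
  "nilpotent_subalgebra A \<longleftrightarrow> lie_subalgebra A \<and> (\<exists>n. lower_central A n = {0})"

definition normalizer :: "'g set \<Rightarrow> 'g set" where
  "normalizer A = {x. \<forall>y\<in>A. bracket x y \<in> A}"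

definition cartan_subalgebra :: "'g set \<Rightarrow> bool" where
  "cartan_subalgebra H \<longleftrightarrow> nilpotent_subalgebra H \<and> normalizer H = H"

text \<open>
  Elements of the dual space of \<open>H\<close> are represented by functions on the whole algebra that
  are linear on \<open>H\<close> and vanish outside \<open>H\<close>; each functional on \<open>H\<close> then has exactly one
  representative, and representatives are stable under pointwise addition and negation.
\<close>

definition dual_space :: "'g set \<Rightarrow> ('g \<Rightarrow> 'f) set" where
  "dual_space H = {\<alpha>.
     (\<forall>x\<in>H. \<forall>y\<in>H. \<alpha> (x + y) = \<alpha> x + \<alpha> y) \<and>
     (\<forall>c. \<forall>x\<in>H. \<alpha> (scale c x) = c * \<alpha> x) \<and>
     (\<forall>x. x \<notin> H \<longrightarrow> \<alpha> x = 0)}"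

definition root_space :: "'g set \<Rightarrow> ('g \<Rightarrow> 'f) \<Rightarrow> 'g set" where
  "root_space H \<alpha> = {x. \<forall>h\<in>H. bracket h x = scale (\<alpha> h) x}"

definition roots :: "'g set \<Rightarrow> ('g \<Rightarrow> 'f) set" where
  "roots H = {\<alpha> \<in> dual_space H. \<alpha> \<noteq> (\<lambda>_. 0) \<and> root_space H \<alpha> \<noteq> {0}}"

definition closed_roots :: "'g set \<Rightarrow> ('g \<Rightarrow> 'f) set \<Rightarrow> bool" where
  "closed_roots H S \<longleftrightarrow> S \<subseteq> roots H \<and>
     (\<forall>\<alpha>\<in>S. \<forall>\<beta>\<in>S. (\<lambda>h. \<alpha> h + \<beta> h) \<in> roots H \<longrightarrow> (\<lambda>h. \<alpha> h + \<beta> h) \<in> S)"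

definition regular_partition :: "'g set \<Rightarrow> ('g \<Rightarrow> 'f) set \<Rightarrow> ('g \<Rightarrow> 'f) set \<Rightarrow> bool" where
  "regular_partition H SP SM \<longleftrightarrow>
     SP \<union> SM = roots H \<and> SP \<inter> SM = {} \<and> closed_roots H SP \<and> closed_roots H SM"

text \<open>
  The sum of the root spaces of the roots in \<open>S\<close>. It is automatically direct, since nonzero
  simultaneous eigenvectors with distinct eigenvalue functions are linearly independent.
\<close>

definition root_sum :: "'g set \<Rightarrow> ('g \<Rightarrow> 'f) set \<Rightarrow> 'g set" where
  "root_sum H S = span (\<Union>\<alpha>\<in>S. root_space H \<alpha>)"

definition linear_iso_on :: "'g set \<Rightarrow> 'g set \<Rightarrow> ('g \<Rightarrow> 'g) \<Rightarrow> bool" where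
  "linear_iso_on A B \<phi> \<longleftrightarrow> bij_betw \<phi> A B \<and>
     (\<forall>x\<in>A. \<forall>y\<in>A. \<phi> (x + y) = \<phi> x + \<phi> y) \<and>
     (\<forall>c. \<forall>x\<in>A. \<phi> (scale c x) = scale c (\<phi> x))"

end

definition is_direct_sum :: "'v::ab_group_add set \<Rightarrow> 'v set \<Rightarrow> 'v set \<Rightarrow> bool" where
  "is_direct_sum V A B \<longleftrightarrow> V = A + B \<and> A \<inter> B = {0}"

locale simple_lie_algebra = lie_algebra +
  assumes finite_dim: "\<exists>B. finite B \<and> span B = UNIV"
    and not_abelian: "\<exists>x y. bracket x y \<noteq> 0"
    and ideals_trivial: "lie_ideal A \<Longrightarrow> A = {0} \<or> A = UNIV"

definition prod_scale :: "('f \<Rightarrow> 'g \<Rightarrow> 'g) \<Rightarrow> 'f \<Rightarrow> 'g \<times> 'g \<Rightarrow> 'g \<times> 'g" where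
  "prod_scale scale c p = (scale c (fst p), scale c (snd p))"

definition prod_bracket :: "('g \<Rightarrow> 'g \<Rightarrow> 'g) \<Rightarrow> 'g \<times> 'g \<Rightarrow> 'g \<times> 'g \<Rightarrow> 'g \<times> 'g" where
  "prod_bracket bracket p q = (bracket (fst p) (fst q), bracket (snd p) (snd q))"

definition diagonal :: "('g \<times> 'g) set" where
  "diagonal = range (\<lambda>a. (a, a))"

lemma (in lie_algebra) lie_algebra_prod:
  "lie_algebra (prod_scale scale) (prod_bracket bracket)"
  by unfold_locales
    (auto simp: prod_scale_def prod_bracket_def prod_eq_iff scale_right_distrib
      scale_left_distrib bracket_add_left bracket_add_right bracket_scale_left
      bracket_scale_right bracket_self jacobi)

context lie_algebra
begin

definition diagonally_stable :: "'g set \<Rightarrow> ('g \<times> 'g) set \<Rightarrow> bool" where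
  "diagonally_stable H W \<longleftrightarrow> (\<forall>h\<in>H. \<forall>w\<in>W. prod_bracket bracket (h, h) w \<in> W)"

definition gluing_datum ::
  "'g set \<Rightarrow> 'g set \<Rightarrow> 'g set \<Rightarrow> 'g set \<Rightarrow> 'g set \<Rightarrow> 'g set \<Rightarrow> 'g set \<Rightarrow> ('g \<Rightarrow> 'g) \<Rightarrow> bool"
where
  "gluing_datum H sP sM tP tM rP rM \<phi> \<longleftrightarrow>
     subspace tP \<and> subspace tM \<and> subspace rP \<and> subspace rM \<and>
     is_direct_sum sP tP rP \<and> is_direct_sum sM tM rM \<and>
     sP \<subseteq> H \<and> sM \<subseteq> H \<and> H = sP + sM \<and> tP \<inter> tM = {0} \<and>
     linear_iso_on rP rM \<phi> \<and> (\<forall>h\<in>rP. \<phi> h = h \<longrightarrow> h = 0)"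

text \<open>
  The three summands below always form a direct sum when \<open>H\<close> is a Cartan subalgebra of a
  simple Lie algebra in characteristic 0 over an algebraically closed field, the root sets
  form a regular partition and the remaining arguments form a gluing datum.
\<close>

definition glued_subspace ::
  "'g set \<Rightarrow> ('g \<Rightarrow> 'f) set \<Rightarrow> ('g \<Rightarrow> 'f) set \<Rightarrow> 'g set \<Rightarrow> 'g set \<Rightarrow> 'g set \<Rightarrow> ('g \<Rightarrow> 'g)
    \<Rightarrow> ('g \<times> 'g) set"
where
  "glued_subspace H SP SM tP tM rP \<phi> =
     (tP + root_sum H SP) \<times> {0} + {0} \<times> (tM + root_sum H SM) +
     module.span (prod_scale scale) {(h, \<phi> h) | h. h \<in> rP}"

text \<open>
  A closed set \<open>S\<close> may contain a root together with its negative (their sum is not a root,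
  so closedness imposes nothing). The product of the two root spaces is then a nonzero line
  in \<open>H\<close>, and \<open>glued_subspace\<close> is closed under the bracket only if that line lies in the
  subspace \<open>T\<close> of \<open>H\<close> attached to \<open>S\<close>. For instance \<open>SP = roots H\<close>, \<open>SM = {}\<close>, \<open>tP = {0}\<close>,
  \<open>tM = H\<close>, \<open>rP = rM = {0}\<close> is a regular partition with a gluing datum that violates this.
\<close>

definition contains_coroot_lines :: "'g set \<Rightarrow> ('g \<Rightarrow> 'f) set \<Rightarrow> 'g set \<Rightarrow> bool" where
  "contains_coroot_lines H S T \<longleftrightarrow>
     (\<forall>\<alpha>\<in>S. (\<lambda>h. - \<alpha> h) \<in> S \<longrightarrow>
        (\<forall>x\<in>root_space H \<alpha>. \<forall>y\<in>root_space H (\<lambda>h. - \<alpha> h). bracket x y \<in> T))"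

text \<open>
  The properties of a gluing datum do not force \<open>glued_subspace\<close> to be a complement of the
  diagonal: its dimension may be too small (\<open>tP = tM = {0}\<close> and \<open>H\<close> the direct sum of
  nonzero \<open>rP\<close> and \<open>rM\<close>), and it may meet the diagonal nontrivially
  (\<open>tM = {0}\<close> and \<open>\<phi> h = h + t\<close> for nonzero \<open>h \<in> rP\<close> and \<open>t \<in> tP\<close>). The following excludes exactly these two defects: the dimension is right,
  and \<open>\<phi>\<close> has no nonzero fixed points modulo \<open>tP + tM\<close>.
\<close>

definition cartan_transversal ::
  "'g set \<Rightarrow> 'g set \<Rightarrow> 'g set \<Rightarrow> 'g set \<Rightarrow> ('g \<Rightarrow> 'g) \<Rightarrow> bool"
where
  "cartan_transversal H tP tM rP \<phi> \<longleftrightarrow>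
     dim tP + dim tM + dim rP = dim H \<and>
     (\<forall>h\<in>rP. \<phi> h - h \<in> tP + tM \<longrightarrow> h = 0)"

end

end

theory Submission
  imports Defs
begin

text \<open>
  The root space decomposition is obtained from traces. Generalized weight spaces of the
  nilpotent algebra \<open>H\<close> exist because eigenvalues do, weights are linear because they are
  normalized traces, and \<open>tr [x, y] = 0\<close> on pieces of root strings makes weights rational
  multiples of each other on \<open>[g\<^sub>\<alpha>, g\<^sub>-\<^sub>\<alpha>]\<close>. This gives a nondegenerate Killing form, hence an abelian
  \<open>H\<close>, lines as root spaces and \<open>[g\<^sub>\<alpha>, g\<^sub>\<beta>] = g\<^sub>\<alpha>\<^sub>+\<^sub>\<beta>\<close>.

  A stable complement \<open>W\<close> of the diagonal splits into weight components. Its Cartan component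
  acts on a line \<open>W\<^sub>\<alpha>\<close> through pairs \<open>(h1, h2)\<close> with \<open>h1 - h2\<close> arbitrary, so this line cannot be
  the graph of a nonzero map and is \<open>g\<^sub>\<alpha> \<times> 0\<close> or \<open>0 \<times> g\<^sub>\<alpha>\<close>; on the Cartan part, Goursat's lemma
  yields the gluing. Conversely, \<open>(x, y) \<mapsto> x - y\<close> reduces complementarity to a dimension count in \<open>H\<close>.
\<close>

subsection \<open>Traces on invariant subspaces\<close>

text \<open>The costliest fact of the root theory is that
  \<open>[g\<^sub>\<alpha>, g\<^sub>\<beta>]\<close> is nonzero when \<alpha> + \<beta> is a root. A
  root belongs to one side of the partition when \<open>W\<close> contains its whole line in the
  corresponding factor, so closedness of the two sides is obtained from a bracket that generates the
  line of the sum, not merely from one of the right weight. The field carries no order, so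
  positivity is never argued in it. It is moved to the rationals, as ratios of weights, or to the
  integers, as multiplicities and positions on a string; characteristic 0 allows the transfer.
  Before the Killing form is known to be nondegenerate, \<open>H\<close> is only nilpotent and acts
  through generalized eigenvectors. The trace arguments are therefore set up for generalized weight
  spaces, and true root vectors enter only afterwards. In the converse three properties separate:
  stability under \<open>H\<close> always holds, closure under the bracket depends on coroot lines
  alone, and complementarity depends on the Cartan part alone.\<close>

lemma funpow_first_entry:
  assumes "P ((f ^^ m) x)" "\<not> P x"
  shows "\<exists>l. \<not> P ((f ^^ l) x) \<and> P (f ((f ^^ l) x))"
  using assms by (induction m) auto

text \<open>A separate copy of \<open>vector_space\<close>, because the facts on families and
  generalized eigenspaces are used twice: for the algebra and, through an interpretation, for its
  square.\<close>

locale linear_space = vector_space scale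
  for scale :: "'a::field \<Rightarrow> 'b::ab_group_add \<Rightarrow> 'b"
begin

lemma set_plus_eq_sums: "A + B = {x + y |x y. x \<in> A \<and> y \<in> (B :: 'b set)}"
  by (auto simp: set_plus_def)

lemma subspace_plus: "subspace A \<Longrightarrow> subspace B \<Longrightarrow> subspace (A + B)"
  using subspace_sums[of A B] by (simp add: set_plus_eq_sums)

abbreviation endo :: "('b \<Rightarrow> 'b) \<Rightarrow> bool" where
  "endo T \<equiv> Vector_Spaces.linear scale scale T"

lemma endo_iff:
  "endo T \<longleftrightarrow> (\<forall>x y. T (x + y) = T x + T y) \<and> (\<forall>c x. T (scale c x) = scale c (T x))"
  using vector_space_axioms by (auto simp: Vector_Spaces.linear_iff)

lemma endo_module_hom: "endo T \<Longrightarrow> module_hom scale scale T"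
  by (simp add: Vector_Spaces.linear_def)

lemma endo_add: "endo T \<Longrightarrow> T (x + y) = T x + T y"
  and endo_scale: "endo T \<Longrightarrow> T (scale c x) = scale c (T x)"
  by (simp_all add: endo_iff)

lemma endo_zero: "endo T \<Longrightarrow> T 0 = 0"
  using endo_scale[of T 0 0] by simp

lemma endo_diff: "endo T \<Longrightarrow> T (x - y) = T x - T y"
  using module_hom.diff endo_module_hom by blast

lemma endo_sum: "endo T \<Longrightarrow> T (sum f A) = (\<Sum>a\<in>A. T (f a))"
  using module_hom.sum endo_module_hom by blast

lemma endo_sum_scale:
  "endo T \<Longrightarrow> T (\<Sum>a\<in>A. scale (c a) (f a)) = (\<Sum>a\<in>A. scale (c a) (T (f a)))"
  by (simp add: endo_sum endo_scale)

lemma representation_sum_scale: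
  assumes "independent B" "\<And>a. a \<in> A \<Longrightarrow> f a \<in> span B"
  shows "representation B (\<Sum>a\<in>A. scale (c a) (f a)) b = (\<Sum>a\<in>A. c a * representation B (f a) b)"
proof -
  have "representation B (\<Sum>a\<in>A. scale (c a) (f a))
      = (\<lambda>b. \<Sum>a\<in>A. representation B (scale (c a) (f a)) b)"
    by (rule representation_sum[OF assms(1)]) (rule span_scale[OF assms(2)])
  then show ?thesis
    using assms by (simp add: representation_scale)
qed

text \<open>Matrix multiplication through an intermediate basis \<open>C\<close> that may differ
  from \<open>B\<close>; the trace formula for two bases relies on this freedom.\<close>

lemma representation_compose:
  assumes "independent B" "independent C" "finite C" "endo S" "x \<in> span C" "\<And>c. c \<in> C \<Longrightarrow> S c \<in> span B"
  shows "representation B (S x) b = (\<Sum>c\<in>C. representation C x c * representation B (S c) b)"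
proof -
  have "S x = S (\<Sum>c\<in>C. scale (representation C x c) c)"
    using sum_representation_eq[OF assms(2,5,3) order_refl] by simp
  also have "\<dots> = (\<Sum>c\<in>C. scale (representation C x c) (S c))"
    by (rule endo_sum_scale[OF assms(4)])
  finally show ?thesis using representation_sum_scale[of B C S, OF assms(1,6)] by simp
qed

lemma endo_compose: "endo S \<Longrightarrow> endo T \<Longrightarrow> endo (\<lambda>x. S (T x))"
  by (simp add: endo_iff)

lemma endo_pow: "endo T \<Longrightarrow> endo (T ^^ n)"
  by (induction n) (simp_all add: endo_iff)

lemma endo_homothety: "endo (scale c)"
  by (simp add: endo_iff scale_right_distrib mult.commute)

lemma endo_shift: "endo T \<Longrightarrow> endo (\<lambda>x. T x - scale c x)"
  by (simp add: endo_iff algebra_simps)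

text \<open>Directness of the sum, for an indexed family instead of a set of subspaces, so that zero
  members are allowed; the weight space of the zero functional may be one.\<close>

definition indep_family :: "'i set \<Rightarrow> ('i \<Rightarrow> 'b set) \<Rightarrow> bool" where
  "indep_family A V \<longleftrightarrow>
     (\<forall>x. (\<forall>i\<in>A. x i \<in> V i) \<longrightarrow> (\<Sum>i\<in>A. x i) = 0 \<longrightarrow> (\<forall>i\<in>A. x i = 0))"

lemma span_UN_eq_sums:
  assumes "finite A" "\<And>i. i \<in> A \<Longrightarrow> subspace (V i)"
  shows "span (\<Union>i\<in>A. V i) = {\<Sum>i\<in>A. x i | x. \<forall>i\<in>A. x i \<in> V i}"
  using assms
proof (induction A rule: finite_induct)
  case empty
  then show ?case by simp
next
  case (insert j A)
  have IH: "span (\<Union>i\<in>A. V i) = {\<Sum>i\<in>A. x i | x. \<forall>i\<in>A. x i \<in> V i}"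
    using insert by auto
  have Vj: "span (V j) = V j" using insert by (simp add: span_eq_iff)
  have "span (\<Union>i\<in>insert j A. V i) = {u + v | u v. u \<in> V j \<and> v \<in> span (\<Union>i\<in>A. V i)}"
    using span_Un[of "V j" "\<Union>i\<in>A. V i"] by (simp add: Vj)
  also have "\<dots> = {\<Sum>i\<in>insert j A. x i | x. \<forall>i\<in>insert j A. x i \<in> V i}"
  proof (intro equalityI subsetI)
    fix z assume "z \<in> {u + v | u v. u \<in> V j \<and> v \<in> span (\<Union>i\<in>A. V i)}"
    then obtain u x where u: "z = u + (\<Sum>i\<in>A. x i)" "u \<in> V j" "\<forall>i\<in>A. x i \<in> V i"
      unfolding IH by blast
    let ?x = "x(j := u)"
    have "z = (\<Sum>i\<in>insert j A. ?x i)"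
      using insert u by (simp, intro sum.cong) auto
    moreover have "\<forall>i\<in>insert j A. ?x i \<in> V i" using u by auto
    ultimately show "z \<in> {\<Sum>i\<in>insert j A. x i | x. \<forall>i\<in>insert j A. x i \<in> V i}" by blast
  next
    fix z assume "z \<in> {\<Sum>i\<in>insert j A. x i | x. \<forall>i\<in>insert j A. x i \<in> V i}"
    then obtain x where x: "z = (\<Sum>i\<in>insert j A. x i)" "\<forall>i\<in>insert j A. x i \<in> V i" by blast
    then have "z = x j + (\<Sum>i\<in>A. x i)" using insert by simp
    then show "z \<in> {u + v | u v. u \<in> V j \<and> v \<in> span (\<Union>i\<in>A. V i)}"
      unfolding IH using x by blast
  qed
  finally show ?case .
qed

lemma indep_family_mono:
  assumes "indep_family A V" "B \<subseteq> A" "finite A" "\<And>i. i \<in> A \<Longrightarrow> 0 \<in> V i"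
  shows "indep_family B V"
  unfolding indep_family_def
proof (intro allI impI)
  fix x assume x: "\<forall>i\<in>B. x i \<in> V i" "(\<Sum>i\<in>B. x i) = 0"
  define y where "y i = (if i \<in> B then x i else 0)" for i
  have "(\<Sum>i\<in>A. y i) = (\<Sum>i\<in>B. x i)"
    using assms(2,3) by (intro sum.mono_neutral_cong_right) (auto simp: y_def)
  then have "(\<Sum>i\<in>A. y i) = 0" using x(2) by simp
  moreover have "\<forall>i\<in>A. y i \<in> V i" using assms(4) x(1) by (simp add: y_def)
  ultimately have "\<forall>i\<in>A. y i = 0"
    using assms(1) unfolding indep_family_def by blast
  then show "\<forall>i\<in>B. x i = 0" using assms(2) by (metis subsetD y_def)
qed

lemma indep_family_insert_Int:
  assumes "indep_family (insert j A) V" "finite A" "j \<notin> A" "\<And>i. i \<in> insert j A \<Longrightarrow> subspace (V i)"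
  shows "V j \<inter> span (\<Union>i\<in>A. V i) = {0}"
proof (intro equalityI subsetI)
  fix z assume z: "z \<in> V j \<inter> span (\<Union>i\<in>A. V i)"
  then obtain x where x: "z = (\<Sum>i\<in>A. x i)" "\<forall>i\<in>A. x i \<in> V i"
    using span_UN_eq_sums[of A V] assms by auto
  \<comment> \<open>Moving \<open>z\<close> to the other side turns its two descriptions into one
    vanishing sum.\<close>
  let ?x = "x(j := - z)"
  have "(\<Sum>i\<in>insert j A. ?x i) = - z + (\<Sum>i\<in>A. x i)"
    using assms by (simp, intro sum.cong) auto
  then have "(\<Sum>i\<in>insert j A. ?x i) = 0" using x by simp
  moreover have "\<forall>i\<in>insert j A. ?x i \<in> V i"
    using x z assms(4) subspace_neg by auto
  ultimately have "?x j = 0" using assms(1) unfolding indep_family_def by blast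
  then show "z \<in> {0}" by simp
next
  fix z assume "z \<in> {0 :: 'b}"
  then show "z \<in> V j \<inter> span (\<Union>i\<in>A. V i)"
    using assms(4)[of j] subspace_0 span_zero by auto
qed

end

section \<open>Traces of restrictions to invariant subspaces in finite dimension\<close>

locale fd_linear_space = linear_space scale + finite_dimensional_vector_space scale Basis
  for scale :: "'a::field \<Rightarrow> 'b::ab_group_add \<Rightarrow> 'b" and Basis :: "'b set"
begin

text \<open>Meant for a \<open>T\<close> that preserves \<open>M\<close>; the chosen basis is then
  irrelevant by \<open>trace_on_eq\<close>. \<open>T\<close> stays an operator on the whole space,
  so that \<open>M\<close> can vary without a change of type.\<close>

definition trace_on :: "'b set \<Rightarrow> ('b \<Rightarrow> 'b) \<Rightarrow> 'a" where
  "trace_on M T =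
     (let B = (SOME B. independent B \<and> span B = M) in \<Sum>b\<in>B. representation B (T b) b)"

text \<open>One double sum serves two purposes: with the identity as one of the operators it gives
  independence of the basis, and with \<open>B = C\<close> it gives tr(ST) = tr(TS).\<close>

lemma trace_on_basis_comm:
  assumes B: "independent B" "span B = M" and C: "independent C" "span C = M"
    and S: "endo S" "S ` M \<subseteq> M" and T: "endo T" "T ` M \<subseteq> M"
  shows "(\<Sum>b\<in>B. representation B (S (T b)) b) = (\<Sum>c\<in>C. representation C (T (S c)) c)"
proof -
  have fin: "finite B" "finite C" using B C finiteI_independent by auto
  have subM: "B \<subseteq> M" "C \<subseteq> M" using B C span_superset by auto
  have BC: "representation B (S (T b)) b
      = (\<Sum>c\<in>C. representation C (T b) c * representation B (S c) b)" if "b \<in> B" for b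
    by (rule representation_compose[OF B(1) C(1) fin(2) S(1)]) (use that subM S(2) T(2) B(2) C(2) in blast)+
  have CB: "representation C (T (S c)) c
      = (\<Sum>b\<in>B. representation B (S c) b * representation C (T b) c)" if "c \<in> C" for c
    by (rule representation_compose[OF C(1) B(1) fin(1) T(1)]) (use that subM S(2) T(2) B(2) C(2) in blast)+
  have "(\<Sum>b\<in>B. representation B (S (T b)) b)
      = (\<Sum>b\<in>B. \<Sum>c\<in>C. representation C (T b) c * representation B (S c) b)"
    by (rule sum.cong[OF refl BC])
  also have "\<dots> = (\<Sum>c\<in>C. \<Sum>b\<in>B. representation B (S c) b * representation C (T b) c)"
    by (subst sum.swap) (simp add: mult.commute)
  also have "\<dots> = (\<Sum>c\<in>C. representation C (T (S c)) c)"
    by (rule sum.cong[OF refl CB[symmetric]])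
  finally show ?thesis .
qed

lemma endo_ident: "endo (\<lambda>x. x)"
  by (simp add: endo_iff)

lemma trace_on_eq:
  assumes "independent B" "span B = M" "endo T" "T ` M \<subseteq> M"
  shows "trace_on M T = (\<Sum>b\<in>B. representation B (T b) b)"
proof -
  define C where "C = (SOME B. independent B \<and> span B = M)"
  have C: "independent C \<and> span C = M"
    unfolding C_def by (rule someI[of _ B]) (use assms in simp)
  have "trace_on M T = (\<Sum>b\<in>C. representation C (T b) b)"
    by (simp add: trace_on_def C_def Let_def)
  also have "\<dots> = (\<Sum>b\<in>B. representation B (T b) b)"
    using trace_on_basis_comm[OF _ _ assms(1,2,3,4) endo_ident, of C] C by blast
  finally show ?thesis .
qed

lemma subspace_basis:
  assumes "subspace M"
  shows "\<exists>B. independent B \<and> span B = M \<and> B \<subseteq> M \<and> finite B \<and> card B = dim M"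
  by (rule basis_subspace_exists[OF assms]) blast

lemma trace_on_comm:
  assumes "subspace M" "endo S" "S ` M \<subseteq> M" "endo T" "T ` M \<subseteq> M"
  shows "trace_on M (\<lambda>x. S (T x)) = trace_on M (\<lambda>x. T (S x))"
proof -
  obtain B where B: "independent B" "span B = M" using subspace_basis[OF assms(1)] by blast
  show ?thesis
    using trace_on_basis_comm[OF B B assms(2-5)] assms
      trace_on_eq[OF B, of "\<lambda>x. S (T x)"] trace_on_eq[OF B, of "\<lambda>x. T (S x)"]
    by (simp add: endo_compose image_subset_iff)
qed

lemma trace_on_add:
  assumes "subspace M" "endo S" "S ` M \<subseteq> M" "endo T" "T ` M \<subseteq> M"
  shows "trace_on M (\<lambda>x. S x + T x) = trace_on M S + trace_on M T"
proof -
  obtain B where B: "independent B" "span B = M" "B \<subseteq> M" using subspace_basis[OF assms(1)] by blast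
  have "endo (\<lambda>x. S x + T x)" using assms by (simp add: endo_iff algebra_simps)
  moreover have "(\<lambda>x. S x + T x) ` M \<subseteq> M"
    using assms by (auto intro!: subspace_add)
  moreover have "representation B (S b + T b) b = representation B (S b) b + representation B (T b) b"
    if "b \<in> B" for b
  proof -
    have "S b \<in> span B" "T b \<in> span B" using that assms(3,5) B by blast+
    then show ?thesis using representation_add[OF B(1)] by simp
  qed
  ultimately show ?thesis
    using assms by (simp add: trace_on_eq[OF B(1,2)] sum.distrib)
qed

lemma trace_on_scale:
  assumes "subspace M" "endo T" "T ` M \<subseteq> M"
  shows "trace_on M (\<lambda>x. scale c (T x)) = c * trace_on M T"
proof -
  obtain B where B: "independent B" "span B = M" "B \<subseteq> M" using subspace_basis[OF assms(1)] by blast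
  have "endo (\<lambda>x. scale c (T x))" using assms by (simp add: endo_iff algebra_simps)
  moreover have "(\<lambda>x. scale c (T x)) ` M \<subseteq> M"
    using assms by (auto intro!: subspace_scale)
  moreover have "representation B (scale c (T b)) b = c * representation B (T b) b"
    if "b \<in> B" for b
  proof -
    have "T b \<in> span B" using that assms(3) B by blast
    then show ?thesis using representation_scale[OF B(1)] by simp
  qed
  ultimately show ?thesis
    unfolding trace_on_eq[OF B(1,2) \<open>endo (\<lambda>x. scale c (T x))\<close> \<open>(\<lambda>x. scale c (T x)) ` M \<subseteq> M\<close>]
      trace_on_eq[OF B(1,2) assms(2,3)] sum_distrib_left
    by (intro sum.cong) auto
qed

lemma trace_on_diff:
  assumes "subspace M" "endo S" "S ` M \<subseteq> M" "endo T" "T ` M \<subseteq> M"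
  shows "trace_on M (\<lambda>x. S x - T x) = trace_on M S - trace_on M T"
proof -
  have "endo (\<lambda>x. scale (-1) (T x))" using assms by (simp add: endo_iff algebra_simps)
  moreover have "(\<lambda>x. scale (-1) (T x)) ` M \<subseteq> M"
    using assms by (auto intro!: subspace_neg)
  ultimately have "trace_on M (\<lambda>x. S x + scale (-1) (T x)) = trace_on M S + (-1) * trace_on M T"
    using trace_on_add[OF assms(1-3)] trace_on_scale[OF assms(1,4,5)] by metis
  then show ?thesis by simp
qed

lemma trace_on_homothety:
  assumes "subspace M"
  shows "trace_on M (\<lambda>x. scale c x) = of_nat (dim M) * c"
proof -
  obtain B where B: "independent B" "span B = M" "B \<subseteq> M" "card B = dim M"
    using subspace_basis[OF assms(1)] by blast
  have "endo (scale c)" by (rule endo_homothety)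
  moreover have "scale c ` M \<subseteq> M" using assms by (auto intro!: subspace_scale)
  ultimately have "trace_on M (scale c) = (\<Sum>b\<in>B. representation B (scale c b) b)"
    by (rule trace_on_eq[OF B(1,2)])
  also have "\<dots> = (\<Sum>b\<in>B. c)"
  proof (intro sum.cong refl)
    fix b assume "b \<in> B"
    then show "representation B (scale c b) b = c"
      using representation_scale[OF B(1) span_base] representation_basis[OF B(1)] by simp
  qed
  finally show ?thesis by (simp add: B(4))
qed

lemma trace_on_cong:
  assumes "subspace M" "endo S" "S ` M \<subseteq> M" "endo T" "\<And>x. x \<in> M \<Longrightarrow> S x = T x"
  shows "trace_on M S = trace_on M T"
proof -
  obtain B where B: "independent B" "span B = M" "B \<subseteq> M"
    using subspace_basis[OF assms(1)] by blast
  have TM: "T ` M \<subseteq> M" using assms(3,5) by (metis image_cong)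
  show ?thesis
    unfolding trace_on_eq[OF B(1,2) assms(2,3)] trace_on_eq[OF B(1,2) assms(4) TM]
    using assms(5) B(3) by (intro sum.cong) (auto simp: subset_iff)
qed

lemma trace_on_direct_sum:
  assumes M: "subspace M" "subspace N" "M \<inter> N = {0}"
    and T: "endo T" "T ` M \<subseteq> M" "T ` N \<subseteq> N"
  shows "trace_on (M + N) T = trace_on M T + trace_on N T"
    and "dim (M + N) = dim M + dim N"
proof -
  obtain B where B: "independent B" "span B = M" "B \<subseteq> M" "finite B" "card B = dim M"
    using subspace_basis[OF M(1)] by blast
  obtain C where C: "independent C" "span C = N" "C \<subseteq> N" "finite C" "card C = dim N"
    using subspace_basis[OF M(2)] by blast
  have "0 \<notin> B" using dependent_zero B(1) by blast
  moreover have "B \<inter> C \<subseteq> {0}" unfolding M(3)[symmetric] using B(3) C(3) by (rule Int_mono)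
  ultimately have BC: "B \<inter> C = {}" by auto
  note MN = set_plus_eq_sums[of M N]
  show d: "dim (M + N) = dim M + dim N"
  proof -
    have "dim (M \<inter> N) = 0" unfolding M(3) by simp
    then show ?thesis using dim_sums_Int[OF M(1,2)] unfolding MN by linarith
  qed
  have sp: "span (B \<union> C) = M + N" unfolding span_Un B C MN ..
  \<comment> \<open>A spanning set of cardinality \<open>dim (M + N)\<close> is independent, so no
    linear relation has to be examined.\<close>
  have ind: "independent (B \<union> C)"
    by (rule card_le_dim_spanning[of _ "M + N"])
      (use d sp span_superset[of "B \<union> C"] B(4,5) C(4,5) BC in \<open>simp_all add: card_Un_disjoint\<close>)
  have "T ` (M + N) \<subseteq> M + N"
    using T by (auto simp: set_plus_def endo_add) blast
  then have "trace_on (M + N) T = (\<Sum>b\<in>B \<union> C. representation (B \<union> C) (T b) b)"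
    by (intro trace_on_eq ind sp T)
  also have "\<dots> = (\<Sum>b\<in>B. representation (B \<union> C) (T b) b) + (\<Sum>b\<in>C. representation (B \<union> C) (T b) b)"
    using B C BC by (simp add: sum.union_disjoint)
  also have "(\<Sum>b\<in>B. representation (B \<union> C) (T b) b) = (\<Sum>b\<in>B. representation B (T b) b)"
    by (intro sum.cong refl, subst representation_extend[OF ind, of _ B]) (use B(2,3) T(2) in auto)
  also have "(\<Sum>b\<in>C. representation (B \<union> C) (T b) b) = (\<Sum>b\<in>C. representation C (T b) b)"
    by (intro sum.cong refl, subst representation_extend[OF ind, of _ C]) (use C(2,3) T(3) in auto)
  finally show "trace_on (M + N) T = trace_on M T + trace_on N T"
    unfolding trace_on_eq[OF B(1,2) T(1,2)] trace_on_eq[OF C(1,2) T(1,3)] .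
qed

lemma dim_direct_sum:
  assumes "subspace M" "subspace N" "M \<inter> N = {0}"
  shows "dim (M + N) = dim M + dim N"
  using trace_on_direct_sum(2)[OF assms endo_ident] by simp

lemma complement_exists:
  assumes "subspace T" "subspace S" "T \<subseteq> S"
  obtains R where "subspace R" "S = T + R" "T \<inter> R = {0}"
proof -
  obtain B where B: "independent B" "span B = T" "B \<subseteq> T" using subspace_basis[OF assms(1)] by blast
  obtain C where C: "B \<subseteq> C" "C \<subseteq> S" "independent C" "S \<subseteq> span C"
    using maximal_independent_subset_extend[of B S] B assms(3) by (metis order_trans)
  have CS: "span C = S" using span_subspace[OF C(2,4) assms(2)] .
  have un: "B \<union> (C - B) = C" using C(1) by blast
  have "S = T + span (C - B)"
    unfolding CS[symmetric] B(2)[symmetric] set_plus_eq_sums using span_Un[of B "C - B"] un by simp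
  moreover have "T \<inter> span (C - B) = {0}"
  proof -
    have "dim T = card B" using dim_span_eq_card_independent[OF B(1)] B(2) by simp
    moreover have "dim S = card C" using dim_span_eq_card_independent[OF C(3)] CS by simp
    moreover have "dim (span (C - B)) = card (C - B)"
      by (rule dim_span_eq_card_independent[OF independent_mono[OF C(3)]]) blast
    moreover have "card C = card B + card (C - B)"
      using finiteI_independent[OF C(3)] C(1) by (metis card_Un_disjoint Diff_disjoint finite_Diff finite_subset un)
    ultimately have "dim (T \<inter> span (C - B)) = 0"
      using dim_sums_Int[OF assms(1) subspace_span, of "C - B"] \<open>S = T + span (C - B)\<close>
      unfolding set_plus_eq_sums by simp
    then show ?thesis
      using subspace_0[OF assms(1)] span_zero by auto
  qed
  ultimately show thesis using that subspace_span by blast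
qed

lemma trace_on_zero_space: "endo T \<Longrightarrow> trace_on {0} T = 0"
  using trace_on_eq[of "{}" "{0}" T] independent_empty by (simp add: endo_zero)

lemma trace_on_UN:
  assumes "finite A" "indep_family A V" "\<And>i. i \<in> A \<Longrightarrow> subspace (V i)"
    and T: "endo T" "\<And>i. i \<in> A \<Longrightarrow> T ` V i \<subseteq> V i"
  shows "trace_on (span (\<Union>i\<in>A. V i)) T = (\<Sum>i\<in>A. trace_on (V i) T)"
  using assms
proof (induction A rule: finite_induct)
  case empty
  then show ?case by (simp add: trace_on_zero_space)
next
  case (insert j A)
  let ?N = "span (\<Union>i\<in>A. V i)"
  have "indep_family A V"
    using indep_family_mono[OF insert.prems(1), of A] insert subspace_0 by auto
  then have IH: "trace_on ?N T = (\<Sum>i\<in>A. trace_on (V i) T)" using insert by auto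
  have int: "V j \<inter> ?N = {0}"
    by (rule indep_family_insert_Int[OF insert.prems(1) insert.hyps insert.prems(2)])
  have "span (\<Union>i\<in>insert j A. V i) = V j + ?N"
    using span_Un[of "V j" "\<Union>i\<in>A. V i"] insert.prems(2)[of j]
    by (simp add: set_plus_eq_sums span_eq_iff[THEN iffD2])
  moreover have "T ` ?N \<subseteq> ?N"
    using insert.prems(4) span_mono[of "T ` (\<Union>i\<in>A. V i)" "\<Union>i\<in>A. V i"]
      module_hom.span_image[OF endo_module_hom[OF T(1)], of "\<Union>i\<in>A. V i"] by blast
  ultimately show ?case
    using trace_on_direct_sum(1)[OF _ _ int T(1)] insert IH by simp
qed

lemma psubspace_dim_less: "subspace N \<Longrightarrow> subspace M \<Longrightarrow> N \<subset> M \<Longrightarrow> dim N < dim M"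
  using dim_psubset[of N M] span_eq_iff[of N] span_eq_iff[of M] by argo

text \<open>On a nonzero space a nilpotent operator is not onto, so some hyperplane \<open>N\<close>
  of \<open>M\<close> contains its image. In a basis of \<open>N\<close> extended by one vector
  \<open>b\<close>, the image of \<open>b\<close> has no \<open>b\<close>-coordinate; hence the
  trace on \<open>M\<close> equals the trace on \<open>N\<close>, and induction on the dimension
  applies.\<close>

lemma trace_on_nilpotent:
  assumes "subspace M" "endo T" "T ` M \<subseteq> M" "\<And>x. x \<in> M \<Longrightarrow> \<exists>n. (T ^^ n) x = 0"
  shows "trace_on M T = 0"
  using assms
proof (induction "dim M" arbitrary: M rule: less_induct)
  case less
  show ?case
  proof (cases "M = {0}")
    case True
    then show ?thesis using less trace_on_zero_space by simp
  next
    case False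
    have img: "subspace (T ` M)"
      using module_hom.subspace_image endo_module_hom less.prems by blast
    have "T ` M \<noteq> M"
    proof
      assume TM: "T ` M = M"
      have TnM: "(T ^^ n) ` M = M" for n
      proof (induction n)
        case (Suc n)
        have "(T ^^ Suc n) ` M = T ` ((T ^^ n) ` M)" by (simp add: image_image)
        then show ?case using Suc TM by simp
      qed simp
      obtain B where B: "span B = M" "finite B" "B \<subseteq> M"
        using subspace_basis[OF less.prems(1)] by blast
      obtain f where f: "\<And>x. x \<in> M \<Longrightarrow> (T ^^ f x) x = 0"
        using less.prems(4) by metis
      \<comment> \<open>Nilpotency is assumed vector by vector; the sum of the exponents over a
        finite basis is a common exponent.\<close>
      define n where "n = sum f B"
      have "(T ^^ n) x = 0" if "x \<in> B" for x
      proof -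
        have "f x \<le> n" using that B member_le_sum[of x B f] by (simp add: n_def)
        then have "(T ^^ n) x = (T ^^ (n - f x)) ((T ^^ f x) x)"
          by (metis funpow_add comp_apply le_add_diff_inverse2)
        then show ?thesis
          using f[of x] that B(3) endo_zero[OF endo_pow[OF less.prems(2)]] by auto
      qed
      then have "(T ^^ n) x = 0" if "x \<in> M" for x
        using module_hom.eq_0_on_span[OF endo_module_hom[OF endo_pow[OF less.prems(2)]], of B] B(1) that
        by simp
      then have "(T ^^ n) ` M \<subseteq> {0}" by auto
      then have "M \<subseteq> {0}" unfolding TnM .
      then show False using False subspace_0[OF less.prems(1)] by blast
    qed
    then have TM: "T ` M \<subset> M" using less.prems(3) by blast
    obtain B0 where B0: "independent B0" "span B0 = T ` M" "B0 \<subseteq> T ` M"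
      using subspace_basis[OF img] by blast
    then obtain B where B: "B0 \<subseteq> B" "B \<subseteq> M" "independent B" "M \<subseteq> span B"
      using maximal_independent_subset_extend[of B0 M] TM by (metis order_trans psubset_imp_subset)
    have spB: "span B = M" using span_subspace[OF B(2,4) less.prems(1)] .
    then have "B \<noteq> B0" using TM B0(2) by auto
    then obtain b where b: "b \<in> B" "b \<notin> B0" using B(1) by blast
    define N where "N = span (B - {b})"
    have N: "subspace N" "N \<subseteq> M" "T ` M \<subseteq> N"
    proof -
      show "subspace N" by (simp add: N_def)
      show "N \<subseteq> M" unfolding N_def spB[symmetric] by (rule span_mono) blast
      show "T ` M \<subseteq> N" unfolding N_def B0(2)[symmetric] by (rule span_mono) (use B(1) b(2) in blast)
    qed
    have "b \<notin> N" using b(1) B(3) unfolding N_def dependent_def by blast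
    then have "dim N < dim M" using psubspace_dim_less[OF N(1) less.prems(1)] N(2) b(1) B(2) by blast
    moreover have "T ` N \<subseteq> N" using N by blast
    ultimately have "trace_on N T = 0"
      using less.hyps[OF _ N(1) less.prems(2)] less.prems(4) N(2) by blast
    have indN: "independent (B - {b})" using independent_mono[OF B(3)] by blast
    have "trace_on M T = (\<Sum>b\<in>B. representation B (T b) b)"
      by (rule trace_on_eq[OF B(3) spB less.prems(2,3)])
    also have "\<dots> = representation B (T b) b + (\<Sum>c\<in>B - {b}. representation B (T c) c)"
      using b(1) finiteI_independent[OF B(3)] by (simp add: sum.remove)
    also have "(\<Sum>c\<in>B - {b}. representation B (T c) c)
             = (\<Sum>c\<in>B - {b}. representation (B - {b}) (T c) c)"
      by (intro sum.cong refl, subst representation_extend[OF B(3), of _ "B - {b}"])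
        (use N(3) B(2) in \<open>auto simp: N_def\<close>)
    also have "\<dots> = trace_on N T"
      using trace_on_eq[OF indN N_def[symmetric] less.prems(2) \<open>T ` N \<subseteq> N\<close>] by simp
    also have "representation B (T b) b = 0"
    proof -
      have "T b \<in> span (B - {b})" using N(3) b(1) B(2) by (auto simp: N_def)
      then have "representation B (T b) b = representation (B - {b}) (T b) b"
        by (subst representation_extend[OF B(3), of _ "B - {b}"]) auto
      then show ?thesis using representation_ne_zero[of "B - {b}" "T b" b] by auto
    qed
    finally show ?thesis using \<open>trace_on N T = 0\<close> by simp
  qed
qed

lemma trace_on_generalized_eigenspace:
  assumes "subspace M" "endo T" "T ` M \<subseteq> M"
    "\<And>x. x \<in> M \<Longrightarrow> \<exists>n. ((\<lambda>x. T x - scale c x) ^^ n) x = 0"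
  shows "trace_on M T = of_nat (dim M) * c"
proof -
  have e: "endo (scale c)" by (rule endo_homothety)
  have s: "scale c ` M \<subseteq> M" using assms by (auto intro!: subspace_scale)
  have "(\<lambda>x. T x - scale c x) ` M \<subseteq> M" using s assms(3) subspace_diff[OF assms(1)] by blast
  then have "trace_on M (\<lambda>x. T x - scale c x) = 0"
    using trace_on_nilpotent[OF assms(1) endo_shift[OF assms(2)] _ assms(4)] by blast
  then show ?thesis
    using trace_on_diff[OF assms(1,2,3) e s] trace_on_homothety[OF assms(1)] by simp
qed

end

subsection \<open>Generalized eigenspaces\<close>

context linear_space
begin

definition gen_eigenspace :: "('b \<Rightarrow> 'b) \<Rightarrow> 'a \<Rightarrow> 'b set" where
  "gen_eigenspace T c = {x. \<exists>n. ((\<lambda>x. T x - scale c x) ^^ n) x = 0}"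

lemma shift_pow_mono:
  assumes "endo T" "((\<lambda>x. T x - scale c x) ^^ n) x = 0" "n \<le> m"
  shows "((\<lambda>x. T x - scale c x) ^^ m) x = 0"
proof -
  let ?S = "\<lambda>x. T x - scale c x"
  have "(?S ^^ m) x = (?S ^^ (m - n)) ((?S ^^ n) x)"
    using assms(3) by (metis funpow_add comp_apply le_add_diff_inverse2)
  then show ?thesis
    using assms(2) endo_zero[OF endo_pow[OF endo_shift[OF assms(1)]]] by simp
qed

lemma subspace_gen_eigenspace:
  assumes "endo T"
  shows "subspace (gen_eigenspace T c)"
proof (rule subspaceI)
  note e = endo_pow[OF endo_shift[OF assms]]
  show "0 \<in> gen_eigenspace T c"
    unfolding gen_eigenspace_def by (auto intro: exI[of _ 0])
  fix x y assume "x \<in> gen_eigenspace T c" "y \<in> gen_eigenspace T c"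
  then obtain n m where nm: "((\<lambda>x. T x - scale c x) ^^ n) x = 0" "((\<lambda>x. T x - scale c x) ^^ m) y = 0"
    unfolding gen_eigenspace_def by blast
  have "((\<lambda>x. T x - scale c x) ^^ (max n m)) (x + y) = 0"
    using shift_pow_mono[OF assms nm(1), of "max n m"] shift_pow_mono[OF assms nm(2), of "max n m"]
    by (simp add: endo_add[OF e])
  then show "x + y \<in> gen_eigenspace T c" unfolding gen_eigenspace_def by blast
next
  note e = endo_pow[OF endo_shift[OF assms]]
  fix d x assume "x \<in> gen_eigenspace T c"
  then obtain n where "((\<lambda>x. T x - scale c x) ^^ n) x = 0"
    unfolding gen_eigenspace_def by blast
  then have "((\<lambda>x. T x - scale c x) ^^ n) (scale d x) = 0" by (simp add: endo_scale[OF e])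
  then show "scale d x \<in> gen_eigenspace T c" unfolding gen_eigenspace_def by blast
qed

text \<open>The vector \<open>(T - c) x\<close> has a smaller nilpotency exponent and inherits the
  hypothesis. Once it lies in \<open>U\<close>, so does
  \<open>(T - d) x - (T - c) x = (c - d) x\<close>. Thus \<open>T - d\<close> is injective modulo
  \<open>U\<close> on the generalized eigenspace of \<open>c\<close>.\<close>

lemma gen_eigenspace_shift_mem:
  assumes "endo T" "x \<in> gen_eigenspace T c" "c \<noteq> d"
    and U: "subspace U" "T ` U \<subseteq> U" and x: "T x - scale d x \<in> U"
  shows "x \<in> U"
proof -
  obtain n where "((\<lambda>x. T x - scale c x) ^^ n) x = 0"
    using assms(2) unfolding gen_eigenspace_def by blast
  then show ?thesis using x
  proof (induction n arbitrary: x)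
    case 0
    then show ?case using subspace_0[OF U(1)] by simp
  next
    case (Suc n)
    let ?y = "T x - scale c x" and ?z = "T x - scale d x"
    have "T ?y - scale d ?y = T ?z - scale c ?z"
      by (simp add: endo_diff[OF assms(1)] endo_scale[OF assms(1)] scale_right_diff_distrib
          mult.commute algebra_simps)
    moreover have "T ?z - scale c ?z \<in> U"
      using Suc.prems(2) U(2) subspace_diff[OF U(1) _ subspace_scale[OF U(1)]] by blast
    ultimately have "?y \<in> U"
      using Suc.IH[of ?y] Suc.prems(1) by (simp add: funpow_Suc_right del: funpow.simps)
    then have "?z - ?y \<in> U" using Suc.prems(2) subspace_diff[OF U(1)] by blast
    then have "scale (c - d) x \<in> U" by (simp add: scale_left_diff_distrib)
    then have "scale (inverse (c - d)) (scale (c - d) x) \<in> U" by (rule subspace_scale[OF U(1)])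
    then show ?case using assms(3) by simp
  qed
qed

lemma gen_eigenspace_stable:
  assumes "endo T" "x \<in> gen_eigenspace T c"
  shows "T x \<in> gen_eigenspace T c"
proof -
  obtain n where n: "((\<lambda>x. T x - scale c x) ^^ n) x = 0"
    using assms(2) unfolding gen_eigenspace_def by blast
  have "((\<lambda>x. T x - scale c x) ^^ n) (T x - scale c x) = 0"
    using shift_pow_mono[OF assms(1) n, of "Suc n"] by (simp add: funpow_Suc_right del: funpow.simps)
  then have "T x - scale c x \<in> gen_eigenspace T c" unfolding gen_eigenspace_def by blast
  then have "(T x - scale c x) + scale c x \<in> gen_eigenspace T c"
    using assms(2) subspace_gen_eigenspace[OF assms(1)] by (intro subspace_add subspace_scale)
  then show ?thesis by simp
qed

lemma gen_eigenspace_shift_pow_mem: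
  assumes "endo T" "x \<in> gen_eigenspace T c" "c \<noteq> d"
    and U: "subspace U" "T ` U \<subseteq> U" and x: "((\<lambda>x. T x - scale d x) ^^ n) x \<in> U"
  shows "x \<in> U"
  using assms(2) x
proof (induction n arbitrary: x)
  case (Suc n)
  have "T x - scale d x \<in> gen_eigenspace T c"
    using Suc.prems(1) gen_eigenspace_stable[OF assms(1)] subspace_gen_eigenspace[OF assms(1)]
    by (intro subspace_diff subspace_scale) auto
  moreover have "((\<lambda>x. T x - scale d x) ^^ n) (T x - scale d x) \<in> U"
    using Suc.prems(2) by (simp add: funpow_Suc_right del: funpow.simps)
  ultimately have "T x - scale d x \<in> U" by (rule Suc.IH)
  then show ?case by (rule gen_eigenspace_shift_mem[OF assms(1) Suc.prems(1) assms(3) U])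
qed simp

text \<open>On this space \<open>T - d\<close> is a nonzero scalar plus a nilpotent operator, hence
  invertible. The preimage is built by recursion on the nilpotency exponent, which avoids an
  explicit geometric series.\<close>

lemma gen_eigenspace_shift_surj:
  assumes T: "endo T" "x \<in> gen_eigenspace T c" "c \<noteq> d"
    and U: "subspace U" "T ` U \<subseteq> U" "x \<in> U"
  shows "\<exists>u \<in> gen_eigenspace T c \<inter> U. T u - scale d u = x"
proof -
  let ?G = "gen_eigenspace T c \<inter> U"
  have G: "subspace ?G" using subspace_gen_eigenspace[OF T(1)] U(1) by (rule subspace_inter)
  obtain n where "((\<lambda>x. T x - scale c x) ^^ n) x = 0"
    using T(2) unfolding gen_eigenspace_def by blast
  moreover have "x \<in> ?G" using assms by simp
  ultimately show ?thesis
  proof (induction n arbitrary: x)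
    case 0
    then have "x = 0" by simp
    then show ?case using subspace_0[OF G] endo_zero[OF T(1)] by (intro bexI[of _ 0]) auto
  next
    case (Suc n)
    let ?y = "T x - scale c x"
    have "?y \<in> ?G"
      using Suc.prems(2) gen_eigenspace_stable[OF T(1)] U by (intro subspace_diff[OF G] subspace_scale[OF G]) auto
    moreover have "((\<lambda>x. T x - scale c x) ^^ n) ?y = 0"
      using Suc.prems(1) by (simp add: funpow_Suc_right del: funpow.simps)
    ultimately obtain u where u: "u \<in> ?G" "T u - scale d u = ?y" using Suc.IH by blast
    \<comment> \<open>With \<open>(T - d) u = (T - c) x\<close>, the operator \<open>T - d\<close>
      sends \<open>x - u\<close> to \<open>(c - d) x\<close>; this fixes the factor.\<close>
    let ?v = "scale (inverse (c - d)) (x - u)"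
    have "T ?v - scale d ?v = scale (inverse (c - d)) ((T x - scale d x) - (T u - scale d u))"
      by (simp add: endo_diff[OF T(1)] endo_scale[OF T(1)] scale_right_diff_distrib mult.commute)
    also have "\<dots> = scale (inverse (c - d)) (scale (c - d) x)"
      unfolding u(2) by (simp add: scale_left_diff_distrib)
    also have "\<dots> = x" using assms(3) by simp
    finally have "T ?v - scale d ?v = x" .
    moreover have "?v \<in> ?G"
      using Suc.prems(2) u(1) by (intro subspace_scale[OF G] subspace_diff[OF G])
    ultimately show ?case by blast
  qed
qed

text \<open>
  Operators \<open>T i - \<beta> i\<close> raised to a high power kill the \<open>\<beta>\<close>-component but are injective
  modulo \<open>U\<close> on every other component separated from \<open>\<beta>\<close> by \<open>i\<close>.
\<close>

lemma weight_components_mem: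
  assumes "finite A" and U: "subspace U" "\<And>i. i \<in> I \<Longrightarrow> T i ` U \<subseteq> U"
    and T: "\<And>i. i \<in> I \<Longrightarrow> endo (T i)"
    and V: "\<And>\<alpha> i. \<alpha> \<in> A \<Longrightarrow> i \<in> I \<Longrightarrow> T i ` V \<alpha> \<subseteq> V \<alpha>"
      "\<And>\<alpha>. \<alpha> \<in> A \<Longrightarrow> subspace (V \<alpha>)"
      "\<And>\<alpha> i. \<alpha> \<in> A \<Longrightarrow> i \<in> I \<Longrightarrow> V \<alpha> \<subseteq> gen_eigenspace (T i) (\<alpha> i)"
    and sep: "\<And>\<alpha> \<beta>. \<alpha> \<in> A \<Longrightarrow> \<beta> \<in> A \<Longrightarrow> \<alpha> \<noteq> \<beta> \<Longrightarrow> \<exists>i\<in>I. \<alpha> i \<noteq> (\<beta> i :: 'a)"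
    and x: "\<And>\<alpha>. \<alpha> \<in> A \<Longrightarrow> x \<alpha> \<in> V \<alpha>" "(\<Sum>\<alpha>\<in>A. x \<alpha>) \<in> U"
  shows "\<forall>\<alpha>\<in>A. x \<alpha> \<in> U"
  using assms(1) V sep x
proof (induction A arbitrary: x rule: finite_induct)
  case (insert \<beta> A)
  have mem: "x \<alpha> \<in> U" if \<alpha>: "\<alpha> \<in> A" for \<alpha>
  proof -
    have "\<alpha> \<noteq> \<beta>" using \<alpha> insert.hyps(2) by blast
    then obtain i where i: "i \<in> I" "\<alpha> i \<noteq> \<beta> i"
      using insert.prems(4)[of \<alpha> \<beta>] \<alpha> by blast
    let ?S = "\<lambda>x. T i x - scale (\<beta> i) x"
    have "x \<beta> \<in> gen_eigenspace (T i) (\<beta> i)"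
      using insert.prems(3)[of \<beta> i] insert.prems(5)[of \<beta>] i by blast
    then obtain n where n: "(?S ^^ n) (x \<beta>) = 0" unfolding gen_eigenspace_def by blast
    have e: "endo (?S ^^ n)" by (rule endo_pow[OF endo_shift[OF T[OF i(1)]]])
    have stab: "(?S ^^ m) y \<in> W" if "subspace W" "T i ` W \<subseteq> W" "y \<in> W" for W m y
    proof (induction m)
      case (Suc m)
      then have "T i ((?S ^^ m) y) \<in> W" using that(2) by blast
      then show ?case using Suc subspace_diff[OF that(1)] subspace_scale[OF that(1)] by simp
    qed (use that in simp)
    have "(?S ^^ n) (\<Sum>\<gamma>\<in>insert \<beta> A. x \<gamma>) \<in> U"
      using stab[OF U(1) U(2)[OF i(1)]] insert.prems(6) by blast
    then have "(\<Sum>\<gamma>\<in>A. (?S ^^ n) (x \<gamma>)) \<in> U"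
      using n insert.hyps by (simp add: endo_sum[OF e] endo_add[OF e])
    moreover have "(?S ^^ n) (x \<gamma>) \<in> V \<gamma>" if "\<gamma> \<in> A" for \<gamma>
      using that insert.prems(1)[of \<gamma> i] insert.prems(2)[of \<gamma>] insert.prems(5)[of \<gamma>] i(1)
      by (intro stab) auto
    ultimately have "\<forall>\<gamma>\<in>A. (?S ^^ n) (x \<gamma>) \<in> U"
      using insert.IH[of "\<lambda>\<gamma>. (?S ^^ n) (x \<gamma>)"] insert.prems(1-4) by simp
    then have "(?S ^^ n) (x \<alpha>) \<in> U" using \<alpha> by blast
    moreover have "x \<alpha> \<in> gen_eigenspace (T i) (\<alpha> i)"
      using insert.prems(3)[of \<alpha> i] insert.prems(5)[of \<alpha>] i(1) \<alpha> by blast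
    ultimately show ?thesis
      using gen_eigenspace_shift_pow_mem[OF T[OF i(1)] _ i(2) U(1) U(2)[OF i(1)]] by blast
  qed
  then have "(\<Sum>\<gamma>\<in>insert \<beta> A. x \<gamma>) - (\<Sum>\<gamma>\<in>A. x \<gamma>) \<in> U"
    by (rule subspace_diff[OF U(1) insert.prems(6) subspace_sum[OF U(1)]])
  then have "x \<beta> \<in> U" using insert.hyps by simp
  then show ?case using mem by blast
qed simp

section \<open>Polynomials in an operator and the decomposition into generalized eigenspaces\<close>

definition poly_op :: "('b \<Rightarrow> 'b) \<Rightarrow> 'a poly \<Rightarrow> 'b \<Rightarrow> 'b" where
  "poly_op T p v = (\<Sum>i\<le>degree p. scale (coeff p i) ((T ^^ i) v))"

lemma poly_op_le: "degree p \<le> n \<Longrightarrow> poly_op T p v = (\<Sum>i\<le>n. scale (coeff p i) ((T ^^ i) v))"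
  unfolding poly_op_def by (intro sum.mono_neutral_left) (auto simp: coeff_eq_0)

lemma poly_op_linear_factor:
  assumes "endo T"
  shows "poly_op T ([:- c, 1:] * q) v = poly_op T q (T v - scale c v)"
proof -
  let ?n = "degree q"
  have "degree ([:- c, 1:] * q) \<le> Suc ?n"
    using degree_mult_le[of "[:- c, 1:]" q] by simp
  then have "poly_op T ([:- c, 1:] * q) v
      = (\<Sum>i\<le>Suc ?n. scale (coeff ([:- c, 1:] * q) i) ((T ^^ i) v))"
    by (rule poly_op_le)
  also have "\<dots> = (\<Sum>i\<le>Suc ?n. scale (coeff (pCons 0 q) i) ((T ^^ i) v))
      - (\<Sum>i\<le>Suc ?n. scale (c * coeff q i) ((T ^^ i) v))"
    by (simp add: sum_subtractf[symmetric] scale_left_diff_distrib[symmetric] del: sum.atMost_Suc)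
  also have "(\<Sum>i\<le>Suc ?n. scale (coeff (pCons 0 q) i) ((T ^^ i) v)) = poly_op T q (T v)"
    by (subst sum.atMost_Suc_shift)
      (simp add: poly_op_def funpow_Suc_right del: funpow.simps sum.atMost_Suc)
  also have "(\<Sum>i\<le>Suc ?n. scale (c * coeff q i) ((T ^^ i) v)) = poly_op T q (scale c v)"
    by (subst poly_op_le[of q "Suc ?n"])
      (simp_all add: endo_scale[OF endo_pow[OF assms]] mult.commute del: sum.atMost_Suc)
  finally show ?thesis
    by (simp add: poly_op_def endo_diff[OF endo_pow[OF assms]] scale_right_diff_distrib sum_subtractf)
qed

end

context fd_linear_space
begin

lemma annihilating_poly:
  assumes "endo T"
  obtains p where "p \<noteq> 0" "poly_op T p v = 0"
proof -
  let ?n = "card Basis" and ?f = "\<lambda>i. (T ^^ i) v"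
  have "\<exists>a k. k \<le> ?n \<and> a k \<noteq> 0 \<and> (\<Sum>i\<le>?n. scale (a i) (?f i)) = 0"
  proof (cases "inj_on ?f {..?n}")
    case True
    then have "card (?f ` {..?n}) = Suc ?n" by (simp add: card_image)
    moreover have "dim (?f ` {..?n}) \<le> ?n" using dim_subset_UNIV by (simp add: dimension_def)
    ultimately have "dependent (?f ` {..?n})" by (intro dependent_biggerset_general) linarith
    then obtain u w where u: "w \<in> ?f ` {..?n}" "u w \<noteq> 0" "(\<Sum>w\<in>?f ` {..?n}. scale (u w) w) = 0"
      by (auto simp: dependent_finite)
    then have "(\<Sum>i\<le>?n. scale (u (?f i)) (?f i)) = 0" by (simp add: sum.reindex[OF True])
    then show ?thesis using u(1,2) by (intro exI[of _ "\<lambda>i. u (?f i)"]) auto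
  next
    \<comment> \<open>Dependence is a property of sets, so a repetition among the iterates needs its
      own treatment; it yields the polynomial \<open>X^i - X^j\<close>.\<close>
    case False
    then obtain i j where ij: "i \<le> ?n" "j \<le> ?n" "i \<noteq> j" "?f i = ?f j"
      by (auto simp: inj_on_def)
    define a where "a k = (if k = i then 1 else if k = j then -1 else (0::'a))" for k
    have "(\<Sum>k\<le>?n. scale (a k) (?f k)) = (\<Sum>k\<in>{i, j}. scale (a k) (?f k))"
      using ij by (intro sum.mono_neutral_right) (auto simp: a_def)
    also have "\<dots> = 0" using ij by (simp add: a_def)
    finally have "(\<Sum>k\<le>?n. scale (a k) (?f k)) = 0" .
    moreover have "a i \<noteq> 0" by (simp add: a_def)
    ultimately show ?thesis using ij(1) by blast
  qed
  then obtain a k where a: "k \<le> ?n" "a k \<noteq> 0" "(\<Sum>i\<le>?n. scale (a i) (?f i)) = 0" by blast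
  define p where "p = (\<Sum>i\<le>?n. monom (a i) i)"
  have coeff: "coeff p i = (if i \<le> ?n then a i else 0)" for i
    by (simp add: p_def coeff_sum)
  have "p \<noteq> 0" using coeff[of k] a by auto
  moreover have "degree p \<le> ?n" by (rule degree_le) (simp add: coeff)
  then have "poly_op T p v = 0" using a(3) by (simp add: poly_op_le coeff)
  ultimately show thesis by (rule that)
qed

end

locale ac_linear_space = fd_linear_space scale Basis
  for scale :: "'a::alg_closed_field \<Rightarrow> 'b::ab_group_add \<Rightarrow> 'b" and Basis :: "'b set"
begin

text \<open>A polynomial that annihilates a single vector suffices. Its linear factors are removed
  one at a time, by showing that \<open>v\<close> lies in the span \<open>?G\<close> as soon as
  \<open>(T - d) v\<close> does: \<open>(T - d) v\<close> agrees with \<open>(T - d) u\<close> for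
  some \<open>u\<close> in \<open>?G\<close>, up to a generalized eigenvector for \<open>d\<close>,
  and then \<open>u - v\<close> is itself such an eigenvector.\<close>

lemma gen_eigenspace_decomposition:
  assumes T: "endo T" and M: "subspace M" "T ` M \<subseteq> M"
  shows "M = span (\<Union>c. gen_eigenspace T c \<inter> M)"
proof (intro equalityI subsetI)
  let ?G = "span (\<Union>c. gen_eigenspace T c \<inter> M)"
  have GM: "?G \<subseteq> M" by (intro span_minimal M(1)) blast
  \<comment> \<open>On components with another eigenvalue \<open>T - d\<close> is onto; a component
    with eigenvalue \<open>d\<close> is itself an admissible error, with
    \<open>u = 0\<close>.\<close>
  have surj: "\<exists>u\<in>?G. T u - scale d u - w \<in> gen_eigenspace T d \<inter> M" if "w \<in> ?G" for d w
    using that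
  proof (induction w rule: span_induct_alt)
    case base
    have "T 0 - scale d 0 - 0 \<in> gen_eigenspace T d \<inter> M"
      using subspace_0[OF subspace_gen_eigenspace[OF T]] subspace_0[OF M(1)] by (simp add: endo_zero[OF T])
    then show ?case using span_zero by blast
  next
    case (step c x y)
    have sub: "subspace (gen_eigenspace T d \<inter> M)"
      by (intro subspace_inter subspace_gen_eigenspace T M)
    obtain u where u: "u \<in> ?G" "T u - scale d u - y \<in> gen_eigenspace T d \<inter> M"
      using step by blast
    obtain \<mu> where \<mu>: "x \<in> gen_eigenspace T \<mu>" "x \<in> M" using step by blast
    obtain z where z: "z \<in> ?G" "T z - scale d z - x \<in> gen_eigenspace T d \<inter> M"
    proof (cases "\<mu> = d")
      case True
      have "T 0 - scale d 0 - x \<in> gen_eigenspace T d \<inter> M"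
        using \<mu> True subspace_neg[OF sub, of x] by (simp add: endo_zero[OF T])
      then show thesis using that[of 0] span_zero by blast
    next
      case False
      then obtain z where z: "z \<in> gen_eigenspace T \<mu> \<inter> M" "T z - scale d z = x"
        using gen_eigenspace_shift_surj[OF T \<mu>(1) _ M \<mu>(2)] by blast
      have "z \<in> ?G" using z(1) by (intro span_base) blast
      moreover have "T z - scale d z - x \<in> gen_eigenspace T d \<inter> M"
        using z(2) subspace_0[OF sub] by simp
      ultimately show thesis by (rule that)
    qed
    let ?v = "scale c z + u"
    have "T ?v - scale d ?v - (scale c x + y)
        = scale c (T z - scale d z - x) + (T u - scale d u - y)"
      by (simp add: endo_add[OF T] endo_scale[OF T] scale_right_diff_distrib scale_right_distrib
          mult.commute algebra_simps)
    also have "\<dots> \<in> gen_eigenspace T d \<inter> M"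
      by (intro subspace_add[OF sub] subspace_scale[OF sub] z u)
    finally have "T ?v - scale d ?v - (scale c x + y) \<in> gen_eigenspace T d \<inter> M" .
    moreover have "?v \<in> ?G" by (intro span_add span_scale z u)
    ultimately show ?case by (rule bexI)
  qed
  have key: "v \<in> ?G" if v: "v \<in> M" "T v - scale d v \<in> ?G" for v d
  proof -
    obtain u where u: "u \<in> ?G" "T u - scale d u - (T v - scale d v) \<in> gen_eigenspace T d \<inter> M"
      using surj[OF v(2)] by blast
    let ?y = "u - v"
    have "T ?y - scale d ?y \<in> gen_eigenspace T d"
      using u(2) by (simp add: endo_diff[OF T] scale_right_diff_distrib algebra_simps)
    then obtain n where "((\<lambda>x. T x - scale d x) ^^ n) (T ?y - scale d ?y) = 0"
      unfolding gen_eigenspace_def by blast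
    then have "((\<lambda>x. T x - scale d x) ^^ Suc n) ?y = 0"
      by (simp add: funpow_Suc_right del: funpow.simps)
    then have "?y \<in> gen_eigenspace T d" unfolding gen_eigenspace_def by blast
    moreover have "?y \<in> M" using u(1) GM v(1) subspace_diff[OF M(1)] by blast
    ultimately have "?y \<in> ?G" by (intro span_base) blast
    then have "u - ?y \<in> ?G" by (rule span_diff[OF u(1)])
    then show ?thesis by simp
  qed
  have "v \<in> ?G" if "p \<noteq> 0" "poly_op T p v = 0" "v \<in> M" for p v
    using that
  proof (induction "degree p" arbitrary: p v)
    case 0
    then have "scale (coeff p 0) v = 0" "coeff p 0 \<noteq> 0"
      by (simp_all add: poly_op_def leading_coeff_neq_0[of p, unfolded 0(1)[symmetric]])
    then show ?case using span_zero by simp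
  next
    case (Suc n)
    then obtain c where "poly p c = 0"
      using alg_closed_imp_poly_has_root[of p] by auto
    then obtain q where q: "p = [:- c, 1:] * q" by (auto simp: poly_eq_0_iff_dvd dvd_def)
    then have "q \<noteq> 0" using Suc.prems by auto
    moreover have "degree q = n"
      using Suc.hyps(2) q \<open>q \<noteq> 0\<close> by (simp add: degree_mult_eq del: mult_pCons_left)
    moreover have "poly_op T q (T v - scale c v) = 0"
      using Suc.prems(2) poly_op_linear_factor[OF T] unfolding q by simp
    moreover have "T v - scale c v \<in> M"
      using Suc.prems(3) M by (intro subspace_diff[OF M(1)] subspace_scale[OF M(1)]) auto
    ultimately have "T v - scale c v \<in> ?G" using Suc.hyps(1)[of q] by blast
    then show ?case by (rule key[OF Suc.prems(3)])
  qed
  then show "x \<in> ?G" if "x \<in> M" for x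
    using annihilating_poly[OF T, of x] that by metis
  show "x \<in> M" if "x \<in> ?G" for x using GM that by blast
qed

end

subsection \<open>Weight spaces of a Cartan subalgebra\<close>

text \<open>\<open>Basis\<close> feeds the dimension theory. Any finite basis of the algebra will
  do, and the final proof extracts one from a finite spanning set.\<close>

locale cartan_pair = simple_lie_algebra scale bracket + ac_linear_space scale Basis
  for scale :: "'f::{alg_closed_field, field_char_0} \<Rightarrow> 'g::ab_group_add \<Rightarrow> 'g"
    and bracket :: "'g \<Rightarrow> 'g \<Rightarrow> 'g" and Basis :: "'g set" +
  fixes H :: "'g set"
  assumes cartan: "cartan_subalgebra H"
begin

lemma endo_bracket: "endo (bracket x)"
  by (simp add: endo_iff bracket_add_right bracket_scale_right)

lemma bracket_zero_right [simp]: "bracket x 0 = 0"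
  by (rule endo_zero[OF endo_bracket])

lemma bracket_anticomm: "bracket x y = - bracket y x"
proof -
  have "bracket x y + bracket y x = bracket (x + y) (x + y)"
    by (simp only: bracket_add_left bracket_add_right bracket_self[of x] bracket_self[of y] add_0_left add_0_right add.commute)
  then show ?thesis by (simp add: bracket_self eq_neg_iff_add_eq_0)
qed

lemma bracket_zero_left [simp]: "bracket 0 x = 0"
  using bracket_anticomm[of 0 x] by simp

lemma bracket_diff_right: "bracket x (y - z) = bracket x y - bracket x z"
  by (rule endo_diff[OF endo_bracket])

lemma bracket_diff_left: "bracket (x - y) z = bracket x z - bracket y z"
  using bracket_add_left[of "x - y" y z] by (simp add: eq_diff_eq)

lemma bracket_derivation: "bracket x (bracket y z) = bracket (bracket x y) z + bracket y (bracket x z)"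
proof -
  have "bracket y (bracket z x) = - bracket y (bracket x z)"
    using bracket_anticomm[of z x] module_hom.neg[OF endo_module_hom[OF endo_bracket]] by simp
  moreover have "bracket z (bracket x y) = - bracket (bracket x y) z" by (rule bracket_anticomm)
  ultimately show ?thesis using jacobi[of x y z] by (simp add: algebra_simps)
qed

text \<open>By the Leibniz rule, \<open>ad h - (a + b)\<close> sends \<open>[x, y]\<close> to
  \<open>[(ad h - a) x, y] + [x, (ad h - b) y]\<close>. Both summands have a smaller total exponent,
  and the induction runs over this total.\<close>

lemma bracket_gen_eigenspace:
  assumes "x \<in> gen_eigenspace (bracket h) a" "y \<in> gen_eigenspace (bracket h) b"
  shows "bracket x y \<in> gen_eigenspace (bracket h) (a + b)"
proof -
  let ?S = "\<lambda>c x. bracket h x - scale c x"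
  obtain n m where nm: "(?S a ^^ n) x = 0" "(?S b ^^ m) y = 0"
    using assms unfolding gen_eigenspace_def by blast
  have "(?S (a + b) ^^ k) (bracket x y) = 0"
    if "k = n + m" "(?S a ^^ n) x = 0" "(?S b ^^ m) y = 0" for k n m x y
    using that
  proof (induction k arbitrary: n m x y)
    case 0
    then show ?case by simp
  next
    case (Suc k)
    note e = endo_pow[OF endo_shift[OF endo_bracket[of h]]]
    show ?case
    proof (cases "n = 0 \<or> m = 0")
      case True
      then have "bracket x y = 0" using Suc.prems by auto
      then show ?thesis using endo_zero[OF e] by metis
    next
      case False
      then obtain n' m' where n': "n = Suc n'" "m = Suc m'" by (metis not0_implies_Suc)
      have "?S (a + b) (bracket x y) = bracket (?S a x) y + bracket x (?S b y)"
        using bracket_derivation[of h x y]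
        by (simp add: bracket_diff_left bracket_diff_right bracket_scale_left bracket_scale_right
            scale_left_distrib)
      then have "(?S (a + b) ^^ Suc k) (bracket x y)
          = (?S (a + b) ^^ k) (bracket (?S a x) y) + (?S (a + b) ^^ k) (bracket x (?S b y))"
        by (simp add: funpow_Suc_right endo_add[OF e] del: funpow.simps)
      also have "(?S (a + b) ^^ k) (bracket (?S a x) y) = 0"
        using Suc.prems n' by (intro Suc.IH[of n' m]) (simp_all add: funpow_Suc_right del: funpow.simps)
      also have "(?S (a + b) ^^ k) (bracket x (?S b y)) = 0"
        using Suc.prems n' by (intro Suc.IH[of n m']) (simp_all add: funpow_Suc_right del: funpow.simps)
      finally show ?thesis by simp
    qed
  qed
  then show ?thesis using nm unfolding gen_eigenspace_def by blast
qed

lemma subspace_H: "subspace H"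
  and bracket_H: "x \<in> H \<Longrightarrow> y \<in> H \<Longrightarrow> bracket x y \<in> H"
  using cartan unfolding cartan_subalgebra_def nilpotent_subalgebra_def lie_subalgebra_def by blast+

lemma lower_central_H_subset: "lower_central H k \<subseteq> H"
proof (induction k)
  case (Suc k)
  then have "{bracket x y | x y. x \<in> H \<and> y \<in> lower_central H k} \<subseteq> H" using bracket_H by blast
  then show ?case using span_minimal[OF _ subspace_H] by simp
qed simp

lemma lower_central_H_nil: "\<exists>n. lower_central H n = {0}"
  using cartan unfolding cartan_subalgebra_def nilpotent_subalgebra_def by blast

text \<open>Generalized eigenvectors are forced as long as \<open>H\<close> is only known to be
  nilpotent. \<alpha> is an arbitrary function, since linearity of weights is proved later, and only
  its values on \<open>H\<close> matter.\<close>

definition weight_space :: "('g \<Rightarrow> 'f) \<Rightarrow> 'g set" where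
  "weight_space \<alpha> = {x. \<forall>h\<in>H. x \<in> gen_eigenspace (bracket h) (\<alpha> h)}"

lemma weight_spaceD: "x \<in> weight_space \<alpha> \<Longrightarrow> h \<in> H \<Longrightarrow> x \<in> gen_eigenspace (bracket h) (\<alpha> h)"
  by (simp add: weight_space_def)

lemma subspace_weight_space: "subspace (weight_space \<alpha>)"
proof -
  have "weight_space \<alpha> = (\<Inter>h\<in>H. gen_eigenspace (bracket h) (\<alpha> h))"
    by (auto simp: weight_space_def)
  then show ?thesis by (simp add: subspace_Int subspace_gen_eigenspace endo_bracket)
qed

lemma H_subset_weight_space_zero: "H \<subseteq> weight_space (\<lambda>_. 0)"
proof
  fix x assume x: "x \<in> H"
  obtain n where n: "lower_central H n = {0}" using lower_central_H_nil by blast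
  have "(bracket h ^^ k) x \<in> lower_central H k" if "h \<in> H" for h k
  proof (induction k)
    case (Suc k)
    then show ?case using that by (auto intro!: span_base)
  qed (use x in simp)
  then have "(bracket h ^^ n) x = 0" if "h \<in> H" for h using n that by blast
  then show "x \<in> weight_space (\<lambda>_. 0)" unfolding weight_space_def gen_eigenspace_def by auto
qed

lemma bracket_weight_space:
  "x \<in> weight_space \<alpha> \<Longrightarrow> y \<in> weight_space \<beta> \<Longrightarrow> bracket x y \<in> weight_space (\<lambda>h. \<alpha> h + \<beta> h)"
  using bracket_gen_eigenspace unfolding weight_space_def by blast

lemma bracket_H_gen_eigenspace:
  assumes "h \<in> H" "k \<in> H" "x \<in> gen_eigenspace (bracket k) c"
  shows "bracket h x \<in> gen_eigenspace (bracket k) c"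
proof -
  have "h \<in> weight_space (\<lambda>_. 0)" using H_subset_weight_space_zero assms(1) by blast
  then have "h \<in> gen_eigenspace (bracket k) 0" using assms(2) weight_spaceD by blast
  then show ?thesis using bracket_gen_eigenspace[of h k 0 x c] assms(3) by simp
qed

lemma bracket_H_weight_space: "h \<in> H \<Longrightarrow> x \<in> weight_space \<alpha> \<Longrightarrow> bracket h x \<in> weight_space \<alpha>"
  using bracket_H_gen_eigenspace unfolding weight_space_def by blast

text \<open>Weights vanish outside \<open>H\<close>, as the representatives in \<open>dual_space H\<close> do.\<close>

definition weights :: "('g \<Rightarrow> 'f) set" where
  "weights = {\<alpha>. (\<forall>x. x \<notin> H \<longrightarrow> \<alpha> x = 0) \<and> weight_space \<alpha> \<noteq> {0}}"

text \<open>Quantifying over all stable subspaces allows induction on the dimension. If some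
  \<open>h\<close> has no single generalized eigenvalue on \<open>M\<close>, its generalized
  eigenspaces in \<open>M\<close> are proper and again \<open>H\<close>-stable; otherwise
  \<open>M\<close> lies in one weight space.\<close>

lemma weight_decomposition:
  assumes "subspace M" "\<And>h. h \<in> H \<Longrightarrow> bracket h ` M \<subseteq> M"
  shows "M \<subseteq> span (\<Union>\<alpha>\<in>weights. weight_space \<alpha> \<inter> M)"
  using assms
proof (induction "dim M" arbitrary: M rule: less_induct)
  case less
  show ?case
  proof (cases "\<exists>h\<in>H. \<forall>c. \<not> M \<subseteq> gen_eigenspace (bracket h) c")
    case True
    then obtain h where h: "h \<in> H" "\<And>c. \<not> M \<subseteq> gen_eigenspace (bracket h) c" by blast
    have "gen_eigenspace (bracket h) c \<inter> M \<subseteq> span (\<Union>\<alpha>\<in>weights. weight_space \<alpha> \<inter> M)" for c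
    proof -
      let ?N = "gen_eigenspace (bracket h) c \<inter> M"
      have N: "subspace ?N"
        by (intro subspace_inter subspace_gen_eigenspace endo_bracket less.prems)
      moreover have "?N \<subset> M" using h(2)[of c] by blast
      ultimately have "dim ?N < dim M" using psubspace_dim_less less.prems(1) by blast
      moreover have "bracket k ` ?N \<subseteq> ?N" if "k \<in> H" for k
        using bracket_H_gen_eigenspace[OF that h(1)] less.prems(2)[OF that] by blast
      ultimately have "?N \<subseteq> span (\<Union>\<alpha>\<in>weights. weight_space \<alpha> \<inter> ?N)"
        using less.hyps[OF _ N] by blast
      also have "\<dots> \<subseteq> span (\<Union>\<alpha>\<in>weights. weight_space \<alpha> \<inter> M)" by (intro span_mono) blast
      finally show ?thesis .
    qed
    then have "span (\<Union>c. gen_eigenspace (bracket h) c \<inter> M)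
        \<subseteq> span (\<Union>\<alpha>\<in>weights. weight_space \<alpha> \<inter> M)"
      by (intro span_minimal UN_least subspace_span)
    then show ?thesis
      using gen_eigenspace_decomposition[OF endo_bracket less.prems(1) less.prems(2)[OF h(1)]] by simp
  next
    case False
    then have "\<forall>h\<in>H. \<exists>c. M \<subseteq> gen_eigenspace (bracket h) c" by blast
    then obtain a where a: "\<And>h. h \<in> H \<Longrightarrow> M \<subseteq> gen_eigenspace (bracket h) (a h)"
      by (metis bchoice)
    define \<alpha> where "\<alpha> h = (if h \<in> H then a h else 0)" for h
    have M: "M \<subseteq> weight_space \<alpha>" using a by (auto simp: weight_space_def \<alpha>_def)
    show ?thesis
    proof (cases "M \<subseteq> {0}")
      case True
      then show ?thesis using span_zero by blast
    next
      case False
      then have "\<alpha> \<in> weights" using M by (auto simp: weights_def \<alpha>_def)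
      then have "M \<subseteq> (\<Union>\<alpha>\<in>weights. weight_space \<alpha> \<inter> M)" using M by blast
      then show ?thesis using span_superset by (rule order_trans)
    qed
  qed
qed

lemma weights_span: "span (\<Union>\<alpha>\<in>weights. weight_space \<alpha>) = UNIV"
  using weight_decomposition[OF subspace_UNIV] by auto

lemma weights_separated:
  assumes "\<alpha> \<in> weights" "\<beta> \<in> weights" "\<alpha> \<noteq> \<beta>"
  shows "\<exists>h\<in>H. \<alpha> h \<noteq> \<beta> h"
proof (rule ccontr)
  assume "\<not> ?thesis"
  then have "\<alpha> x = \<beta> x" for x using assms(1,2) by (cases "x \<in> H") (auto simp: weights_def)
  then show False using assms(3) by blast
qed

text \<open>The case \<open>U = {0}\<close> of \<open>weight_components_mem\<close>. Separation is
  assumed in place of membership in \<open>weights\<close> so that \<open>root_index\<close> is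
  covered too.\<close>

lemma indep_weight_spaces_separated:
  assumes "finite A" "\<And>\<alpha> \<beta>. \<alpha> \<in> A \<Longrightarrow> \<beta> \<in> A \<Longrightarrow> \<alpha> \<noteq> \<beta> \<Longrightarrow> \<exists>h\<in>H. \<alpha> h \<noteq> \<beta> h"
  shows "indep_family A weight_space"
  unfolding indep_family_def
proof (intro allI impI)
  fix x assume x: "\<forall>\<alpha>\<in>A. x \<alpha> \<in> weight_space \<alpha>" "(\<Sum>\<alpha>\<in>A. x \<alpha>) = 0"
  have "\<forall>\<alpha>\<in>A. x \<alpha> \<in> {0}"
  proof (rule weight_components_mem[OF assms(1) subspace_single_0, where I = H and T = bracket and V = weight_space])
    show "weight_space \<alpha> \<subseteq> gen_eigenspace (bracket h) (\<alpha> h)" if "h \<in> H" for \<alpha> h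
      using that weight_spaceD by blast
  qed (use x assms(2) bracket_H_weight_space in \<open>auto simp: endo_bracket subspace_weight_space\<close>)
  then show "\<forall>\<alpha>\<in>A. x \<alpha> = 0" by simp
qed

lemma indep_weight_spaces:
  assumes "finite A" "A \<subseteq> weights"
  shows "indep_family A weight_space"
  using assms weights_separated by (intro indep_weight_spaces_separated) blast+

lemma dim_weight_space_pos: "\<alpha> \<in> weights \<Longrightarrow> 0 < dim (weight_space \<alpha>)"
proof -
  assume "\<alpha> \<in> weights"
  then have "\<not> weight_space \<alpha> \<subseteq> {0}"
    using subspace_0[OF subspace_weight_space, of \<alpha>] by (auto simp: weights_def)
  then have "dim (weight_space \<alpha>) \<noteq> 0" by simp
  then show ?thesis by linarith
qed

lemma finite_weights: "finite weights"
proof -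
  have bound: "card A \<le> card Basis" if A: "A \<subseteq> weights" "finite A" for A
  proof -
  \<comment> \<open>The trace of the identity adds up dimensions; in characteristic 0 the resulting
    equation in the field is one of natural numbers.\<close>
  let ?M = "span (\<Union>\<alpha>\<in>A. weight_space \<alpha>)"
  have "trace_on ?M (scale 1) = (\<Sum>\<alpha>\<in>A. trace_on (weight_space \<alpha>) (scale 1))"
    by (rule trace_on_UN[OF A(2) indep_weight_spaces[OF A(2,1)]])
      (auto simp: subspace_weight_space endo_homothety)
  then have "of_nat (dim ?M) = (of_nat (\<Sum>\<alpha>\<in>A. dim (weight_space \<alpha>)) :: 'f)"
    by (simp only: trace_on_homothety subspace_weight_space subspace_span of_nat_sum mult_1_right)
  then have "dim ?M = (\<Sum>\<alpha>\<in>A. dim (weight_space \<alpha>))" by (simp only: of_nat_eq_iff)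
  moreover have "1 \<le> dim (weight_space \<alpha>)" if "\<alpha> \<in> A" for \<alpha>
    using dim_weight_space_pos[of \<alpha>] that A(1) by (simp add: Suc_le_eq subset_iff)
  then have "card A \<le> (\<Sum>\<alpha>\<in>A. dim (weight_space \<alpha>))"
    using sum_mono[of A "\<lambda>_. 1" "\<lambda>\<alpha>. dim (weight_space \<alpha>)"] by simp
  moreover have "dim ?M \<le> card Basis" using dim_subset_UNIV dimension_def by metis
  ultimately show ?thesis by linarith
  qed
  then show ?thesis using finite_if_finite_subsets_card_bdd by blast
qed

lemma trace_weight_space:
  assumes "h \<in> H"
  shows "trace_on (weight_space \<alpha>) (bracket h) = of_nat (dim (weight_space \<alpha>)) * \<alpha> h"
proof (rule trace_on_generalized_eigenspace[OF subspace_weight_space endo_bracket])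
  show "bracket h ` weight_space \<alpha> \<subseteq> weight_space \<alpha>" using bracket_H_weight_space[OF assms] by blast
  show "\<exists>n. ((\<lambda>x. bracket h x - scale (\<alpha> h) x) ^^ n) x = 0" if "x \<in> weight_space \<alpha>" for x
    using weight_spaceD[OF that assms] by (simp add: gen_eigenspace_def)
qed

lemma trace_weight_spaces:
  assumes "h \<in> H" "A \<subseteq> weights"
  shows "trace_on (span (\<Union>\<alpha>\<in>A. weight_space \<alpha>)) (bracket h)
    = (\<Sum>\<alpha>\<in>A. of_nat (dim (weight_space \<alpha>)) * \<alpha> h)"
proof -
  have fin: "finite A" using assms(2) finite_weights finite_subset by blast
  have "trace_on (span (\<Union>\<alpha>\<in>A. weight_space \<alpha>)) (bracket h)
      = (\<Sum>\<alpha>\<in>A. trace_on (weight_space \<alpha>) (bracket h))"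
    by (rule trace_on_UN[OF fin indep_weight_spaces[OF fin assms(2)] subspace_weight_space endo_bracket])
      (use bracket_H_weight_space[OF assms(1)] in auto)
  then show ?thesis by (simp add: trace_weight_space[OF assms(1)])
qed

text \<open>\<open>ad [x, y]\<close> is a commutator of operators that preserve \<open>M\<close>.
  The relations between weights along a string all come from here, by suitable choices of
  \<open>M\<close>.\<close>

lemma trace_bracket:
  assumes "subspace M" "bracket x ` M \<subseteq> M" "bracket y ` M \<subseteq> M"
  shows "trace_on M (bracket (bracket x y)) = 0"
proof -
  have "bracket (bracket x y) = (\<lambda>z. bracket x (bracket y z) - bracket y (bracket x z))"
    using bracket_derivation[of x y] by (simp add: fun_eq_iff)
  moreover have "trace_on M (\<lambda>z. bracket x (bracket y z) - bracket y (bracket x z)) = 0"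
    using trace_on_diff[OF assms(1), of "\<lambda>z. bracket x (bracket y z)" "\<lambda>z. bracket y (bracket x z)"]
      trace_on_comm[OF assms(1) endo_bracket assms(2) endo_bracket assms(3)] assms(2,3)
    by (simp add: endo_compose endo_bracket image_subset_iff)
  ultimately show ?thesis by simp
qed

text \<open>Equalities of traces on one weight space, divided by its dimension. That weights vanish
  on brackets of \<open>H\<close> is what later forces \<open>H\<close> to be abelian.\<close>

lemma weight_linear:
  assumes "\<alpha> \<in> weights"
  shows "h \<in> H \<Longrightarrow> k \<in> H \<Longrightarrow> \<alpha> (h + k) = \<alpha> h + \<alpha> k"
    and "h \<in> H \<Longrightarrow> \<alpha> (scale c h) = c * \<alpha> h"
    and "h \<in> H \<Longrightarrow> k \<in> H \<Longrightarrow> \<alpha> (bracket h k) = 0"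
proof -
  let ?V = "weight_space \<alpha>" and ?d = "of_nat (dim (weight_space \<alpha>)) :: 'f"
  have d: "?d \<noteq> 0" using dim_weight_space_pos[OF assms] by (metis of_nat_eq_0_iff less_irrefl)
  note stab = bracket_H_weight_space
  show "\<alpha> (h + k) = \<alpha> h + \<alpha> k" if "h \<in> H" "k \<in> H"
  proof -
    have "bracket (h + k) = (\<lambda>x. bracket h x + bracket k x)" by (simp add: fun_eq_iff bracket_add_left)
    then have "trace_on ?V (bracket (h + k)) = trace_on ?V (bracket h) + trace_on ?V (bracket k)"
      using trace_on_add[OF subspace_weight_space endo_bracket _ endo_bracket, of h \<alpha> k] stab that
      by (simp add: image_subset_iff)
    then have "?d * \<alpha> (h + k) = ?d * (\<alpha> h + \<alpha> k)"
      using that subspace_add[OF subspace_H] by (simp add: trace_weight_space distrib_left)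
    then show ?thesis using d by simp
  qed
  show "\<alpha> (scale c h) = c * \<alpha> h" if "h \<in> H"
  proof -
    have "bracket (scale c h) = (\<lambda>x. scale c (bracket h x))" by (simp add: fun_eq_iff bracket_scale_left)
    then have "trace_on ?V (bracket (scale c h)) = c * trace_on ?V (bracket h)"
      using trace_on_scale[OF subspace_weight_space endo_bracket, of h \<alpha> c] stab that
      by (simp add: image_subset_iff)
    then have "?d * \<alpha> (scale c h) = ?d * (c * \<alpha> h)"
      using that subspace_scale[OF subspace_H] by (simp add: trace_weight_space)
    then show ?thesis using d by simp
  qed
  show "\<alpha> (bracket h k) = 0" if "h \<in> H" "k \<in> H"
    using trace_bracket[OF subspace_weight_space, of h \<alpha> k] stab that d
      trace_weight_space[OF bracket_H[OF that]]
    by (simp add: image_subset_iff)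
qed

lemma weights_dual_space: "\<alpha> \<in> weights \<Longrightarrow> \<alpha> \<in> dual_space H"
  using weight_linear(1,2)[of \<alpha>] by (auto simp: dual_space_def weights_def)

text \<open>
  Engel's argument: a minimal \<open>H\<close>-stable subspace of the zero weight space that properly
  contains \<open>H\<close> normalizes \<open>H\<close>, by descending along the lower central series.
\<close>

lemma weight_space_zero: "weight_space (\<lambda>_. 0) = H"
proof (rule ccontr)
  let ?Z = "weight_space (\<lambda>_. 0)"
  let ?P = "\<lambda>U. subspace U \<and> H \<subset> U \<and> U \<subseteq> ?Z \<and> (\<forall>h\<in>H. bracket h ` U \<subseteq> U)"
  assume "?Z \<noteq> H"
  then have "?P ?Z"
    using H_subset_weight_space_zero subspace_weight_space bracket_H_weight_space by blast
  then obtain U where PU: "?P U" and least: "\<And>V. ?P V \<Longrightarrow> dim U \<le> dim V"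
    using exE[OF ex_has_least_nat[of ?P ?Z dim]] by metis
  have U: "subspace U" "H \<subset> U" "U \<subseteq> ?Z" "\<And>h. h \<in> H \<Longrightarrow> bracket h ` U \<subseteq> U"
    using PU by simp_all
  obtain n where n: "lower_central H n = {0}" using lower_central_H_nil by blast
  \<comment> \<open>Descending induction from the vanishing term of the series; at term 0 the claim
    says that \<open>U\<close> normalizes \<open>H\<close>.\<close>
  have "\<forall>u\<in>lower_central H 0. \<forall>v\<in>U. bracket u v \<in> H"
  proof (rule inc_induct[of 0 n])
    show "\<forall>u\<in>lower_central H n. \<forall>v\<in>U. bracket u v \<in> H"
      using n subspace_0[OF subspace_H] by simp
    fix k assume IH: "\<forall>u\<in>lower_central H (Suc k). \<forall>v\<in>U. bracket u v \<in> H"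
    show "\<forall>u\<in>lower_central H k. \<forall>v\<in>U. bracket u v \<in> H"
    proof
      fix u assume u: "u \<in> lower_central H k"
      then have uH: "u \<in> H" using lower_central_H_subset by blast
      \<comment> \<open>Stability of \<open>V\<close> rests on \<open>[h, u]\<close> lying one term
        further down the series. Once \<open>V\<close> is seen to be larger than \<open>H\<close>,
        minimality gives \<open>V = U\<close>.\<close>
      define V where "V = U \<inter> {v. bracket u v \<in> H}"
      have V: "subspace V"
        unfolding V_def using module_hom.subspace_linear_preimage[OF endo_module_hom[OF endo_bracket] subspace_H]
        by (intro subspace_inter U(1))
      have HV: "H \<subseteq> V" using U(2) bracket_H[OF uH] by (auto simp: V_def)
      have stab: "bracket h v \<in> V" if h: "h \<in> H" and v: "v \<in> V" for h v
      proof -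
        have "bracket h u \<in> lower_central H (Suc k)" using h u by (auto intro!: span_base)
        then have "bracket (bracket h u) v \<in> H" using IH v V_def by blast
        moreover have "bracket u (bracket h v) = bracket h (bracket u v) - bracket (bracket h u) v"
          using bracket_derivation[of h u v] by simp
        moreover have "bracket h (bracket u v) \<in> H" using bracket_H h v V_def by blast
        ultimately have "bracket u (bracket h v) \<in> H" using subspace_diff[OF subspace_H] by simp
        moreover have "bracket h v \<in> U" using U(4)[OF h] v V_def by blast
        ultimately show ?thesis by (simp add: V_def)
      qed
      obtain v where v: "v \<in> U" "v \<notin> H" using U(2) by blast
      have "v \<in> gen_eigenspace (bracket u) 0" using v(1) U(3) weight_spaceD[OF _ uH] by blast
      then obtain m0 where "(bracket u ^^ m0) v = 0" by (auto simp: gen_eigenspace_def)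
      then have "(bracket u ^^ m0) v \<in> H" using subspace_0[OF subspace_H] by simp
      \<comment> \<open>This iterate witnesses that \<open>V\<close> is strictly larger than
        \<open>H\<close>; it exists because \<open>ad u\<close> is nilpotent on
        \<open>v\<close>.\<close>
      then obtain l where l: "(bracket u ^^ l) v \<notin> H" "bracket u ((bracket u ^^ l) v) \<in> H"
        using funpow_first_entry[of "\<lambda>x. x \<in> H" m0 "bracket u" v] v(2) by blast
      have "(bracket u ^^ i) v \<in> U" for i
      proof (induction i)
        case (Suc i)
        then show ?case using U(4)[OF uH] by auto
      qed (use v(1) in simp)
      then have "(bracket u ^^ l) v \<in> V" using l by (simp add: V_def)
      then have "?P V" using l V HV stab U(3) V_def by blast
      then have "V = U" using subspace_dim_equal[OF V U(1)] least V_def by blast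
      then show "\<forall>v\<in>U. bracket u v \<in> H" by (auto simp: V_def)
    qed
  qed simp
  moreover obtain v where v: "v \<in> U" "v \<notin> H" using U(2) by blast
  ultimately have "\<forall>y\<in>H. bracket v y \<in> H"
    using subspace_neg[OF subspace_H] bracket_anticomm[of v] by simp
  then have "v \<in> normalizer H" by (simp add: normalizer_def)
  then show False using cartan v(2) by (simp add: cartan_subalgebra_def)
qed

lemma bracket_span:
  assumes M: "subspace M" and XY: "\<And>x y. x \<in> X \<Longrightarrow> y \<in> Y \<Longrightarrow> bracket x y \<in> M"
    and u: "u \<in> span X" and v: "v \<in> span Y"
  shows "bracket u v \<in> M"
proof -
  have 1: "bracket x v \<in> M" if "x \<in> X" for x
    using v
  proof (induction v rule: span_induct_alt)
    case base
    then show ?case using subspace_0[OF M] by simp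
  next
    case (step c y z)
    then show ?case using XY[OF that step(1)] subspace_add[OF M] subspace_scale[OF M]
      by (simp add: bracket_add_right bracket_scale_right)
  qed
  show ?thesis using u
  proof (induction u rule: span_induct_alt)
    case base
    then show ?case using subspace_0[OF M] by simp
  next
    case (step c y z)
    then show ?case using 1[OF step(1)] subspace_add[OF M] subspace_scale[OF M]
      by (simp add: bracket_add_left bracket_scale_left)
  qed
qed

subsection \<open>The Killing form\<close>

definition killing :: "'g \<Rightarrow> 'g \<Rightarrow> 'f" where
  "killing x y = trace_on UNIV (\<lambda>z. bracket x (bracket y z))"

lemma endo_bracket2: "endo (\<lambda>z. bracket x (bracket y z))"
  by (rule endo_compose[OF endo_bracket endo_bracket])

lemma killing_sym: "killing x y = killing y x"
  unfolding killing_def by (rule trace_on_comm) (simp_all add: endo_bracket)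

lemma killing_add_left: "killing (x + y) z = killing x z + killing y z"
  unfolding killing_def
  using trace_on_add[OF subspace_UNIV endo_bracket2 _ endo_bracket2, of x z y z]
  by (simp add: bracket_add_left)

lemma killing_scale_left: "killing (scale c x) z = c * killing x z"
  unfolding killing_def
  using trace_on_scale[OF subspace_UNIV endo_bracket2, of x z c]
  by (simp add: bracket_scale_left)

lemma killing_add_right: "killing z (x + y) = killing z x + killing z y"
  using killing_add_left[of x y z] by (simp add: killing_sym[of z])

lemma killing_scale_right: "killing z (scale c x) = c * killing z x"
  using killing_scale_left[of c x z] by (simp add: killing_sym[of z])

lemma killing_neg_left: "killing (- x) z = - killing x z"
  using killing_scale_left[of "-1" x z] by simp

lemma killing_zero_left [simp]: "killing 0 z = 0"
  using killing_scale_left[of 0 0 z] by simp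

text \<open>Both sides expand into a difference of two traces of triple products. One product is
  shared, and the other two differ by cycling \<open>y\<close> from the front to the end.\<close>

lemma killing_invariant: "killing (bracket x y) z = killing x (bracket y z)"
proof -
  let ?t = "trace_on UNIV"
  have e3: "endo (\<lambda>w. bracket a (bracket b (bracket c w)))" for a b c
    by (rule endo_compose[OF endo_bracket endo_bracket2])
  have "killing (bracket x y) z
      = ?t (\<lambda>w. bracket x (bracket y (bracket z w)) - bracket y (bracket x (bracket z w)))"
    unfolding killing_def using bracket_derivation[of x y]
    by (intro arg_cong[where f = ?t]) (simp add: fun_eq_iff)
  also have "\<dots> = ?t (\<lambda>w. bracket x (bracket y (bracket z w))) - ?t (\<lambda>w. bracket y (bracket x (bracket z w)))"
    by (rule trace_on_diff) (simp_all add: e3)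
  also have "?t (\<lambda>w. bracket y (bracket x (bracket z w))) = ?t (\<lambda>w. bracket x (bracket z (bracket y w)))"
    by (rule trace_on_comm[of UNIV "bracket y" "\<lambda>w. bracket x (bracket z w)"])
      (simp_all add: endo_bracket endo_bracket2)
  also have "?t (\<lambda>w. bracket x (bracket y (bracket z w))) - ?t (\<lambda>w. bracket x (bracket z (bracket y w)))
      = ?t (\<lambda>w. bracket x (bracket y (bracket z w)) - bracket x (bracket z (bracket y w)))"
    by (rule trace_on_diff[symmetric]) (simp_all add: e3)
  also have "\<dots> = killing x (bracket y z)"
    unfolding killing_def using bracket_derivation[of y z]
    by (intro arg_cong[where f = ?t]) (simp add: fun_eq_iff bracket_add_right)
  finally show ?thesis .
qed

lemma killing_eq_0_on_span:
  assumes "\<And>y. y \<in> Y \<Longrightarrow> killing x y = 0" "z \<in> span Y"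
  shows "killing x z = 0"
  using assms(2)
proof (induction z rule: span_induct_alt)
  case base
  then show ?case using killing_sym[of x 0] by simp
next
  case (step c y z)
  then show ?case using assms(1) by (simp add: killing_add_right killing_scale_right)
qed

text \<open>Invariance makes the radical of the form an ideal, and simplicity leaves two
  possibilities for it.\<close>

lemma killing_zero_or_nondegenerate:
  "(\<forall>x y. killing x y = 0) \<or> (\<forall>x. (\<forall>y. killing x y = 0) \<longrightarrow> x = 0)"
proof -
  let ?R = "{x. \<forall>y. killing x y = 0}"
  have "subspace ?R" by (rule subspaceI) (simp_all add: killing_add_left killing_scale_left)
  moreover have "bracket x y \<in> ?R" if "y \<in> ?R" for x y
    using that bracket_anticomm[of x y] by (simp add: killing_neg_left killing_invariant)
  ultimately have "lie_ideal ?R" by (simp add: lie_ideal_def)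
  then have "?R = {0} \<or> ?R = UNIV" by (rule ideals_trivial)
  then show ?thesis by blast
qed

lemma derived_algebra: "span {bracket x y | x y. True} = UNIV"
proof -
  let ?D = "span {bracket x y | x y. True}"
  have "lie_ideal ?D" unfolding lie_ideal_def by (auto intro: span_base)
  moreover have "?D \<noteq> {0}"
  proof -
    obtain x y where "bracket x y \<noteq> 0" using not_abelian by blast
    moreover have "bracket x y \<in> ?D" by (rule span_base) blast
    ultimately show ?thesis by blast
  qed
  ultimately show ?thesis using ideals_trivial by blast
qed

section \<open>Weight strings and Cartan's criterion\<close>

abbreviation weight_sum :: "('g \<Rightarrow> 'f) set \<Rightarrow> 'g set" where
  "weight_sum A \<equiv> span (\<Union>\<alpha>\<in>A. weight_space \<alpha>)"

lemma weight_space_nonzero_weight: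
  assumes "x \<in> weight_space \<alpha>" "x \<noteq> 0" "\<And>h. h \<notin> H \<Longrightarrow> \<alpha> h = 0"
  shows "\<alpha> \<in> weights"
  using assms by (auto simp: weights_def)

lemma weights_vanish: "\<alpha> \<in> weights \<Longrightarrow> h \<notin> H \<Longrightarrow> \<alpha> h = 0"
  by (simp add: weights_def)

lemma weight_space_subset_weight_sum: "\<alpha> \<in> A \<Longrightarrow> weight_space \<alpha> \<subseteq> weight_sum A"
  by (rule order_trans[OF UN_upper span_superset])

lemma bracket_weight_sumI:
  assumes M: "subspace M" and x: "\<And>\<gamma> z. \<gamma> \<in> A \<Longrightarrow> z \<in> weight_space \<gamma> \<Longrightarrow> bracket x z \<in> M"
  shows "bracket x ` weight_sum A \<subseteq> M"
proof -
  have "bracket x' z \<in> M" if "x' \<in> {x}" "z \<in> (\<Union>\<alpha>\<in>A. weight_space \<alpha>)" for x' z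
    using that x by blast
  then have "bracket x z \<in> M" if "z \<in> weight_sum A" for z
    using bracket_span[OF M, of "{x}" "\<Union>\<alpha>\<in>A. weight_space \<alpha>" x z] that span_base[of x "{x}"]
    by blast
  then show ?thesis by blast
qed

lemma bracket_mem_weight_sum:
  assumes "x \<in> weight_space \<alpha>" "z \<in> weight_space \<gamma>" "\<And>h. h \<notin> H \<Longrightarrow> \<alpha> h + \<gamma> h = 0"
    "(\<lambda>h. \<alpha> h + \<gamma> h) \<in> weights \<Longrightarrow> (\<lambda>h. \<alpha> h + \<gamma> h) \<in> A"
  shows "bracket x z \<in> weight_sum A"
proof (cases "bracket x z = 0")
  case False
  note xz = bracket_weight_space[OF assms(1,2)]
  have "(\<lambda>h. \<alpha> h + \<gamma> h) \<in> weights" by (rule weight_space_nonzero_weight[OF xz False assms(3)])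
  then show ?thesis using assms(4) xz weight_space_subset_weight_sum by blast
qed (simp add: span_zero)

text \<open>This is \<open>trace_bracket\<close> on a stable piece of a string, sorted by \<beta>
  and \<alpha>. The coefficient of \<beta> is the total dimension of the piece, so it can be divided
  by as soon as the piece is nonempty.\<close>

lemma weight_string_trace:
  assumes A: "A \<subseteq> weights" and h: "bracket x y \<in> H"
    and stable: "bracket x ` weight_sum A \<subseteq> weight_sum A" "bracket y ` weight_sum A \<subseteq> weight_sum A"
    and k: "\<And>\<gamma>. \<gamma> \<in> A \<Longrightarrow> \<gamma> (bracket x y) = \<beta> (bracket x y) + of_int (k \<gamma>) * \<alpha> (bracket x y)"
  shows "of_nat (\<Sum>\<gamma>\<in>A. dim (weight_space \<gamma>)) * \<beta> (bracket x y)
    + of_int (\<Sum>\<gamma>\<in>A. int (dim (weight_space \<gamma>)) * k \<gamma>) * \<alpha> (bracket x y) = 0"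
proof -
  let ?h = "bracket x y" and ?d = "\<lambda>\<gamma>. of_nat (dim (weight_space \<gamma>)) :: 'f"
  have "0 = (\<Sum>\<gamma>\<in>A. ?d \<gamma> * \<gamma> ?h)"
    using trace_bracket[OF subspace_span stable] trace_weight_spaces[OF h A] by simp
  also have "\<dots> = (\<Sum>\<gamma>\<in>A. ?d \<gamma> * \<beta> ?h + (?d \<gamma> * of_int (k \<gamma>)) * \<alpha> ?h)"
    by (rule sum.cong[OF refl]) (simp add: k algebra_simps)
  also have "\<dots> = of_nat (\<Sum>\<gamma>\<in>A. dim (weight_space \<gamma>)) * \<beta> ?h
    + of_int (\<Sum>\<gamma>\<in>A. int (dim (weight_space \<gamma>)) * k \<gamma>) * \<alpha> ?h"
    by (simp add: sum.distrib sum_distrib_right)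
  finally show ?thesis by simp
qed

text \<open>\<open>S\<close> selects positions: \<open>UNIV\<close> gives the whole string through
  \<beta>, and \<open>{..0}\<close> gives its lower half, on which the two counting arguments for
  root spaces are based.\<close>

definition weight_string :: "('g \<Rightarrow> 'f) \<Rightarrow> ('g \<Rightarrow> 'f) \<Rightarrow> int set \<Rightarrow> ('g \<Rightarrow> 'f) set" where
  "weight_string \<beta> \<alpha> S = {\<gamma> \<in> weights. \<exists>k\<in>S. \<gamma> = (\<lambda>h. \<beta> h + of_int k * \<alpha> h)}"

text \<open>A vector of weight \<open>e\<close> times \<alpha> moves every position by
  \<open>e\<close>. The values 1 and -1 treat the two members of an opposite pair alike.\<close>

lemma weight_string_stable:
  assumes "x \<in> weight_space (\<lambda>h. of_int e * \<alpha> h)" "\<And>h. h \<notin> H \<Longrightarrow> \<alpha> h = 0"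
    "\<And>k. k \<in> S \<Longrightarrow> (\<lambda>h. \<beta> h + of_int (k + e) * \<alpha> h) \<in> weights \<Longrightarrow> k + e \<in> S"
  shows "bracket x ` weight_sum (weight_string \<beta> \<alpha> S) \<subseteq> weight_sum (weight_string \<beta> \<alpha> S)"
proof (rule bracket_weight_sumI[OF subspace_span])
  fix \<gamma> z assume \<gamma>: "\<gamma> \<in> weight_string \<beta> \<alpha> S" and z: "z \<in> weight_space \<gamma>"
  obtain k where k: "k \<in> S" "\<gamma> = (\<lambda>h. \<beta> h + of_int k * \<alpha> h)"
    using \<gamma> by (auto simp: weight_string_def)
  have eq: "(\<lambda>h. of_int e * \<alpha> h + \<gamma> h) = (\<lambda>h. \<beta> h + of_int (k + e) * \<alpha> h)"
    by (simp add: k(2) fun_eq_iff algebra_simps)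
  show "bracket x z \<in> weight_sum (weight_string \<beta> \<alpha> S)"
  proof (rule bracket_mem_weight_sum[OF assms(1) z])
    show "of_int e * \<alpha> h + \<gamma> h = 0" if "h \<notin> H" for h
      using that \<gamma> weights_vanish[of \<gamma> h] assms(2) by (simp add: weight_string_def)
    assume w: "(\<lambda>h. of_int e * \<alpha> h + \<gamma> h) \<in> weights"
    then have "k + e \<in> S" using assms(3)[OF k(1)] eq by simp
    then show "(\<lambda>h. of_int e * \<alpha> h + \<gamma> h) \<in> weight_string \<beta> \<alpha> S"
      unfolding weight_string_def using w eq by blast
  qed
qed

lemma bracket_opposite_in_H:
  assumes "x \<in> weight_space \<alpha>" "y \<in> weight_space (\<lambda>h. - \<alpha> h)"
  shows "bracket x y \<in> H"
  using bracket_weight_space[OF assms] by (simp add: weight_space_zero)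

lemma weight_string_dim_pos:
  assumes "\<gamma> \<in> weight_string \<beta> \<alpha> S"
  shows "0 < (\<Sum>\<gamma>\<in>weight_string \<beta> \<alpha> S. dim (weight_space \<gamma>))"
proof -
  have "finite (weight_string \<beta> \<alpha> S)"
    using finite_weights by (simp add: weight_string_def)
  moreover have "0 < dim (weight_space \<gamma>)"
    using dim_weight_space_pos assms by (simp only: weight_string_def mem_Collect_eq)
  ultimately show ?thesis using assms by (meson member_le_sum le0 less_le_trans)
qed

text \<open>The whole \<alpha>-string through \<beta> is stable under both vectors. The vanishing
  trace then shows that the ratio is minus the mean position on the string, weighted by
  dimensions.\<close>

lemma weight_rational_multiple:
  assumes x: "x \<in> weight_space \<alpha>" and y: "y \<in> weight_space (\<lambda>h. - \<alpha> h)"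
    and \<alpha>: "\<And>h. h \<notin> H \<Longrightarrow> \<alpha> h = 0" and \<beta>: "\<beta> \<in> weights"
  shows "\<exists>q. \<beta> (bracket x y) = of_rat q * \<alpha> (bracket x y)"
proof -
  let ?W = "weight_sum (weight_string \<beta> \<alpha> UNIV)"
  have 1: "bracket x ` ?W \<subseteq> ?W"
    using weight_string_stable[of x 1 \<alpha> UNIV \<beta>] x \<alpha> by simp
  have 2: "bracket y ` ?W \<subseteq> ?W"
    using weight_string_stable[of y "-1" \<alpha> UNIV \<beta>] y \<alpha> by simp
  have sub: "weight_string \<beta> \<alpha> UNIV \<subseteq> weights" by (auto simp: weight_string_def)
  \<comment> \<open>For \<alpha> = 0 a position is not determined by its weight; any choice serves
    the trace relation.\<close>
  have "\<forall>\<gamma>\<in>weight_string \<beta> \<alpha> UNIV. \<exists>k. \<gamma> = (\<lambda>h. \<beta> h + of_int k * \<alpha> h)"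
    by (auto simp: weight_string_def)
  then obtain k where k_eq: "\<And>\<gamma>. \<gamma> \<in> weight_string \<beta> \<alpha> UNIV \<Longrightarrow> \<gamma> = (\<lambda>h. \<beta> h + of_int (k \<gamma>) * \<alpha> h)"
    by (metis bchoice)
  note k = weight_string_trace[OF sub bracket_opposite_in_H[OF x y] 1 2, of \<beta> k \<alpha>, OF fun_cong[OF k_eq]]
  define D K where "D = (\<Sum>\<gamma>\<in>weight_string \<beta> \<alpha> UNIV. dim (weight_space \<gamma>))"
    and "K = (\<Sum>\<gamma>\<in>weight_string \<beta> \<alpha> UNIV. int (dim (weight_space \<gamma>)) * k \<gamma>)"
  have "\<beta> \<in> weight_string \<beta> \<alpha> UNIV"
    using \<beta> by (auto simp: weight_string_def intro!: exI[of _ 0])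
  then have D: "(of_nat D :: 'f) \<noteq> 0" unfolding D_def using weight_string_dim_pos by (metis of_nat_eq_0_iff less_irrefl)
  have "of_nat D * \<beta> (bracket x y) = - of_int K * \<alpha> (bracket x y)"
    using k unfolding D_def[symmetric] K_def[symmetric] by (simp add: eq_neg_iff_add_eq_0)
  then have "\<beta> (bracket x y) = of_rat (- of_int K / of_nat D) * \<alpha> (bracket x y)"
    using D by (simp add: of_rat_divide of_rat_minus field_simps)
  then show ?thesis by blast
qed

text \<open>\<open>(ad h)^2 - c^2\<close> factors as \<open>(ad h + c) (ad h - c)\<close> with
  commuting factors, so nilpotency of the second factor passes to the product.\<close>

lemma trace_square_weight_space:
  assumes "h \<in> H"
  shows "trace_on (weight_space \<alpha>) (\<lambda>x. bracket h (bracket h x))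
    = of_nat (dim (weight_space \<alpha>)) * (\<alpha> h)\<^sup>2"
proof (rule trace_on_generalized_eigenspace[OF subspace_weight_space endo_bracket2])
  show "(\<lambda>x. bracket h (bracket h x)) ` weight_space \<alpha> \<subseteq> weight_space \<alpha>"
    using bracket_H_weight_space[OF assms] by blast
  fix x assume x: "x \<in> weight_space \<alpha>"
  let ?c = "\<alpha> h"
  let ?N = "\<lambda>x. bracket h x - scale ?c x" and ?S = "\<lambda>x. bracket h x + scale ?c x"
  have SN: "bracket h (bracket h z) - scale (?c\<^sup>2) z = ?S (?N z)" "?S (?N z) = ?N (?S z)" for z
    by (simp_all add: bracket_diff_right bracket_add_right bracket_scale_right scale_right_diff_distrib
        scale_right_distrib power2_eq_square)
  have eS: "endo ?S" by (simp add: endo_iff bracket_add_right bracket_scale_right algebra_simps scale_right_distrib)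
  have eN: "endo ?N" by (rule endo_shift[OF endo_bracket])
  have comm: "(?N ^^ n) (?S z) = ?S ((?N ^^ n) z)" for n z
    by (induction n) (simp_all add: SN(2))
  have pow: "((\<lambda>z. ?S (?N z)) ^^ n) z = (?S ^^ n) ((?N ^^ n) z)" for n z
  proof (induction n)
    case (Suc n)
    have "(?N ^^ m) ((?S ^^ n) w) = (?S ^^ n) ((?N ^^ m) w)" for m n w
      by (induction n) (simp_all add: comm)
    from this[of 1 n] have "?N ((?S ^^ n) w) = (?S ^^ n) (?N w)" for w by simp
    then show ?case using Suc by simp
  qed simp
  obtain n where "(?N ^^ n) x = 0"
    using weight_spaceD[OF x assms] by (auto simp: gen_eigenspace_def)
  then have "((\<lambda>z. bracket h (bracket h z) - scale (?c\<^sup>2) z) ^^ n) x = 0"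
    unfolding SN(1) pow using endo_zero[OF endo_pow[OF eS]] by simp
  then show "\<exists>n. ((\<lambda>z. bracket h (bracket h z) - scale (?c\<^sup>2) z) ^^ n) x = 0" by blast
qed

lemma killing_H_square:
  assumes "h \<in> H"
  shows "killing h h = (\<Sum>\<alpha>\<in>weights. of_nat (dim (weight_space \<alpha>)) * (\<alpha> h)\<^sup>2)"
proof -
  have "killing h h = trace_on (weight_sum weights) (\<lambda>x. bracket h (bracket h x))"
    by (simp add: killing_def weights_span)
  also have "\<dots> = (\<Sum>\<alpha>\<in>weights. trace_on (weight_space \<alpha>) (\<lambda>x. bracket h (bracket h x)))"
    by (rule trace_on_UN[OF finite_weights indep_weight_spaces[OF finite_weights order_refl]
          subspace_weight_space endo_bracket2])
      (use bracket_H_weight_space[OF assms] in auto)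
  finally show ?thesis by (simp add: trace_square_weight_space[OF assms])
qed

text \<open>All weights at \<open>[x, y]\<close> are rational multiples of the value of \<alpha>.
  The vanishing of the form at this element is therefore that value squared times a sum of
  nonnegative rationals, one of which, belonging to \<alpha> itself, is positive unless the value is
  0.\<close>

lemma weights_zero_of_killing_zero:
  assumes "\<And>x y. killing x y = 0"
    and x: "x \<in> weight_space \<alpha>" and y: "y \<in> weight_space (\<lambda>h. - \<alpha> h)"
    and \<alpha>: "\<alpha> \<in> weights" and \<beta>: "\<beta> \<in> weights"
  shows "\<beta> (bracket x y) = 0"
proof -
  let ?h = "bracket x y"
  have h: "?h \<in> H" by (rule bracket_opposite_in_H[OF x y])
  obtain q where q: "\<And>\<gamma>. \<gamma> \<in> weights \<Longrightarrow> \<gamma> ?h = of_rat (q \<gamma>) * \<alpha> ?h"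
    using weight_rational_multiple[OF x y weights_vanish[OF \<alpha>]] by metis
  have "\<alpha> ?h = 0"
  proof (rule ccontr)
    assume nz: "\<alpha> ?h \<noteq> 0"
    let ?s = "\<Sum>\<gamma>\<in>weights. of_nat (dim (weight_space \<gamma>)) * (q \<gamma>)\<^sup>2"
    have "0 = (\<Sum>\<gamma>\<in>weights. of_nat (dim (weight_space \<gamma>)) * (\<gamma> ?h)\<^sup>2)"
      using killing_H_square[OF h] assms(1) by simp
    also have "\<dots> = (\<Sum>\<gamma>\<in>weights. of_rat (of_nat (dim (weight_space \<gamma>)) * (q \<gamma>)\<^sup>2) * (\<alpha> ?h)\<^sup>2)"
      by (intro sum.cong refl) (simp add: q of_rat_mult of_rat_power power_mult_distrib)
    also have "\<dots> = of_rat ?s * (\<alpha> ?h)\<^sup>2" by (simp add: of_rat_sum sum_distrib_right)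
    finally have "?s = 0" using nz by simp
    then have "of_nat (dim (weight_space \<alpha>)) * (q \<alpha>)\<^sup>2 = 0"
      using \<alpha> finite_weights by (subst (asm) sum_nonneg_eq_0_iff) auto
    then have "q \<alpha> = 0" using dim_weight_space_pos[OF \<alpha>] by (metis less_irrefl mult_eq_0_iff of_nat_eq_0_iff power_eq_0_iff)
    then show False using q[OF \<alpha>] nz by simp
  qed
  then show ?thesis using q[OF \<beta>] by simp
qed

lemma zero_weight_Int:
  "H \<inter> weight_sum (weights - {\<lambda>_. 0}) = {0}"
proof (cases "(\<lambda>_. 0) \<in> weights")
  case True
  then have "insert (\<lambda>_. 0) (weights - {\<lambda>_. 0}) = weights" by blast
  then show ?thesis
    using indep_family_insert_Int[of "\<lambda>_. 0" "weights - {\<lambda>_. 0}" weight_space]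
      indep_weight_spaces[OF finite_weights order_refl] finite_weights
    by (simp add: subspace_weight_space weight_space_zero)
next
  case False
  then have "H = {0}" by (simp add: weights_def weight_space_zero)
  then show ?thesis using span_zero by auto
qed

lemma lower_central_perfect:
  assumes "H = UNIV"
  shows "lower_central H n = UNIV"
  using assms derived_algebra by (induction n) (simp_all del: Collect_const)

text \<open>
  Cartan's criterion: were the form zero, the rational multiples above would force every weight
  to vanish on \<open>[g\<^sub>\<alpha>, g\<^sub>-\<^sub>\<alpha>]\<close>, hence on \<open>H\<close> as the algebra is perfect, and \<open>H\<close> would be everything.
\<close>

lemma killing_not_zero: "\<exists>x y. killing x y \<noteq> 0"
proof (rule ccontr)
  assume "\<not> ?thesis"
  then have zero: "\<And>x y. killing x y = 0" by blast
  \<comment> \<open>Brackets of opposite weight vectors fall into \<open>K\<close>, all others into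
    the sum \<open>?N\<close> of the nonzero weight spaces. As brackets span the algebra,
    \<open>K + ?N\<close> is everything; since \<open>H\<close> meets \<open>?N\<close> only in 0,
    it is contained in \<open>K\<close>.\<close>
  define K where "K = {h \<in> H. \<forall>\<beta>\<in>weights. \<beta> h = 0}"
  let ?N = "weight_sum (weights - {\<lambda>_. 0})"
  have K: "subspace K"
  proof (rule subspaceI)
    have "\<beta> 0 = 0" if "\<beta> \<in> weights" for \<beta>
      using weight_linear(2)[OF that subspace_0[OF subspace_H], of 0] by simp
    then show "0 \<in> K" using subspace_0[OF subspace_H] by (simp add: K_def)
  qed (auto simp: K_def weight_linear subspace_add[OF subspace_H] subspace_scale[OF subspace_H])
  have V: "subspace (K + ?N)" by (intro subspace_plus K subspace_span)
  have KV: "K \<subseteq> K + ?N" using set_zero_plus2[OF span_zero] by (metis add.commute)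
  have NV: "?N \<subseteq> K + ?N" by (rule set_zero_plus2[OF subspace_0[OF K]])
  have gen: "bracket x y \<in> K + ?N"
    if xy: "x \<in> (\<Union>\<alpha>\<in>weights. weight_space \<alpha>)" "y \<in> (\<Union>\<alpha>\<in>weights. weight_space \<alpha>)" for x y
  proof -
    obtain \<alpha> \<beta> where \<alpha>\<beta>: "\<alpha> \<in> weights" "x \<in> weight_space \<alpha>" "\<beta> \<in> weights" "y \<in> weight_space \<beta>"
      using xy by blast
    show ?thesis
    proof (cases "\<beta> = (\<lambda>h. - \<alpha> h)")
      case True
      then have y: "y \<in> weight_space (\<lambda>h. - \<alpha> h)" using \<alpha>\<beta>(4) by simp
      have "bracket x y \<in> K"
        unfolding K_def using bracket_opposite_in_H[OF \<alpha>\<beta>(2) y] weights_zero_of_killing_zero[OF zero \<alpha>\<beta>(2) y \<alpha>\<beta>(1)]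
        by simp
      then show ?thesis using KV by blast
    next
      case False
      then have "(\<lambda>h. \<alpha> h + \<beta> h) \<noteq> (\<lambda>_. 0)" by (metis (no_types, lifting) add.inverse_unique ext)
      moreover have xy: "bracket x y \<in> weight_space (\<lambda>h. \<alpha> h + \<beta> h)" by (rule bracket_weight_space[OF \<alpha>\<beta>(2,4)])
      then have "(\<lambda>h. \<alpha> h + \<beta> h) \<in> weights" if "bracket x y \<noteq> 0"
        using weight_space_nonzero_weight[OF xy that] weights_vanish[OF \<alpha>\<beta>(1)] weights_vanish[OF \<alpha>\<beta>(3)] by simp
      ultimately have "bracket x y \<in> ?N"
        using xy weight_space_subset_weight_sum[of "\<lambda>h. \<alpha> h + \<beta> h" "weights - {\<lambda>_. 0}"] span_zero
        by (cases "bracket x y = 0") auto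
      then show ?thesis using NV by blast
    qed
  qed
  have "bracket x y \<in> K + ?N" for x y
  proof (rule bracket_span[OF V gen])
    show "x \<in> weight_sum weights" "y \<in> weight_sum weights" by (simp_all add: weights_span)
  qed
  then have "span {bracket x y | x y. True} \<subseteq> K + ?N" by (intro span_minimal V) blast
  then have UV: "K + ?N = UNIV" using derived_algebra by auto
  have HK: "h \<in> K" if h: "h \<in> H" for h
  proof -
    obtain k s where ks: "h = k + s" "k \<in> K" "s \<in> ?N"
      using UV by (metis UNIV_I set_plus_elim)
    have "s \<in> H" using ks(1,2) h subspace_diff[OF subspace_H, of h k] by (simp add: K_def)
    then have "s = 0" using zero_weight_Int ks(3) by blast
    then show ?thesis using ks by simp
  qed
  have "\<beta> = (\<lambda>_. 0)" if "\<beta> \<in> weights" for \<beta>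
    using HK that weights_vanish[OF that] by (auto simp: K_def fun_eq_iff)
  then have "weight_sum weights \<subseteq> H"
    using weight_space_zero by (intro span_minimal subspace_H UN_least) auto
  then have "H = UNIV" using weights_span by auto
  then have "(UNIV :: 'g set) = {0}"
    using lower_central_H_nil lower_central_perfect by metis
  moreover obtain x y where "bracket x y \<noteq> 0" using not_abelian by blast
  ultimately show False by blast
qed

section \<open>Orthogonality of weight spaces and opposite weights\<close>

lemma killing_nondegenerate: "(\<And>y. killing x y = 0) \<Longrightarrow> x = 0"
  using killing_zero_or_nondegenerate killing_not_zero by blast

text \<open>Since \<open>b\<close> differs from \<open>- a\<close>, the vector \<open>y\<close> can
  be written as \<open>(ad h + a) u\<close> with \<open>u\<close> in the same eigenspace. By
  invariance the value at \<open>x\<close> and \<open>y\<close> is minus the value at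
  \<open>(ad h - a) x\<close> and \<open>u\<close>, where the exponent has dropped.\<close>

lemma killing_gen_eigenspaces:
  assumes "x \<in> gen_eigenspace (bracket h) a" "y \<in> gen_eigenspace (bracket h) b" "a + b \<noteq> 0"
  shows "killing x y = 0"
proof -
  have ba: "b \<noteq> - a" using assms(3) by (metis add.right_inverse)
  obtain n where "((\<lambda>x. bracket h x - scale a x) ^^ n) x = 0"
    using assms(1) unfolding gen_eigenspace_def by blast
  then show ?thesis using assms(2)
  proof (induction n arbitrary: x y)
    case (Suc n)
    obtain u where u: "u \<in> gen_eigenspace (bracket h) b" "bracket h u - scale (- a) u = y"
      using gen_eigenspace_shift_surj[OF endo_bracket Suc.prems(2) ba subspace_UNIV] by auto
    have "((\<lambda>x. bracket h x - scale a x) ^^ n) (bracket h x - scale a x) = 0"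
      using Suc.prems(1) by (simp add: funpow_Suc_right del: funpow.simps)
    then have "killing (bracket h x - scale a x) u = 0" using u(1) by (rule Suc.IH)
    moreover have "killing (bracket h x - scale a x) u = killing (bracket h x) u - a * killing x u"
      using killing_add_left[of "bracket h x - scale a x" "scale a x" u] by (simp add: killing_scale_left)
    moreover have "killing x (bracket h u) = - killing (bracket h x) u"
      using killing_invariant[of x h u] bracket_anticomm[of x h] by (simp add: killing_neg_left)
    moreover have "y = bracket h u + scale a u" using u(2) by simp
    ultimately show ?case by (simp add: killing_add_right killing_scale_right)
  qed simp
qed

lemma killing_pairing:
  assumes x: "x \<in> weight_space \<alpha>" "x \<noteq> 0" and \<alpha>: "\<And>h. h \<notin> H \<Longrightarrow> \<alpha> h = 0"
  shows "\<exists>y \<in> weight_space (\<lambda>h. - \<alpha> h). killing x y \<noteq> 0"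
proof (rule ccontr)
  assume "\<not> ?thesis"
  then have no: "killing x y = 0" if "y \<in> weight_space (\<lambda>h. - \<alpha> h)" for y using that by blast
  have "killing x y = 0" if y: "y \<in> (\<Union>\<beta>\<in>weights. weight_space \<beta>)" for y
  proof -
    obtain \<beta> where \<beta>: "\<beta> \<in> weights" "y \<in> weight_space \<beta>" using y by blast
    show ?thesis
    proof (cases "\<forall>h\<in>H. \<alpha> h + \<beta> h = 0")
      case True
      then have "\<beta> h = - \<alpha> h" for h
        using \<alpha> weights_vanish[OF \<beta>(1)] by (cases "h \<in> H") (auto simp: add_eq_0_iff)
      then have "\<beta> = (\<lambda>h. - \<alpha> h)" by blast
      then show ?thesis using no \<beta>(2) by simp
    next
      case False
      then obtain h where h: "h \<in> H" "\<alpha> h + \<beta> h \<noteq> 0" by blast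
      show ?thesis
        by (rule killing_gen_eigenspaces[OF weight_spaceD[OF x(1) h(1)] weight_spaceD[OF \<beta>(2) h(1)] h(2)])
    qed
  qed
  then have "killing x z = 0" for z
    by (rule killing_eq_0_on_span[of "\<Union>\<beta>\<in>weights. weight_space \<beta>"]) (simp_all add: weights_span)
  then show False using killing_nondegenerate x(2) by blast
qed

lemma weights_neg: "\<alpha> \<in> weights \<Longrightarrow> (\<lambda>h. - \<alpha> h) \<in> weights"
proof -
  assume \<alpha>: "\<alpha> \<in> weights"
  then obtain x where x: "x \<in> weight_space \<alpha>" "x \<noteq> 0"
    using subspace_0[OF subspace_weight_space, of \<alpha>] by (auto simp: weights_def)
  then obtain y where y: "y \<in> weight_space (\<lambda>h. - \<alpha> h)" "killing x y \<noteq> 0"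
    using killing_pairing[OF x weights_vanish[OF \<alpha>]] by blast
  then have "y \<noteq> 0" using killing_sym[of x 0] by auto
  then show ?thesis using y(1) weight_space_nonzero_weight weights_vanish[OF \<alpha>] by simp
qed

subsection \<open>The root space decomposition\<close>

text \<open>On \<open>H\<close> the form is known through its squares only, so it is polarized. If
  all weights vanish at \<open>h\<close>, adding \<open>h\<close> to \<open>k\<close> changes no
  square, whence \<open>2 * killing h k = 0\<close> for all \<open>k\<close> in \<open>H\<close>;
  but the form pairs the zero weight space nondegenerately with itself.\<close>

lemma H_eq_0_of_weights:
  assumes h: "h \<in> H" "\<And>\<alpha>. \<alpha> \<in> weights \<Longrightarrow> \<alpha> h = 0"
  shows "h = 0"
proof (rule ccontr)
  assume "h \<noteq> 0"
  moreover have "h \<in> weight_space (\<lambda>_. 0)" using h(1) weight_space_zero by simp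
  ultimately obtain k where "k \<in> weight_space (\<lambda>h. - 0)" and nz: "killing h k \<noteq> 0"
    using killing_pairing[of h "\<lambda>_. 0"] by blast
  then have k: "k \<in> H" by (simp add: weight_space_zero)
  have "killing (h + k) (h + k) = killing k k"
    unfolding killing_H_square[OF subspace_add[OF subspace_H h(1) k]] killing_H_square[OF k]
    by (intro sum.cong refl) (simp add: weight_linear(1)[OF _ h(1) k] h(2))
  moreover have "killing h h = 0" by (simp add: killing_H_square[OF h(1)] h(2))
  ultimately have "2 * killing h k = 0"
    by (simp add: killing_add_left killing_add_right killing_sym[of k h])
  then show False using nz by simp
qed

lemma H_abelian: "h \<in> H \<Longrightarrow> k \<in> H \<Longrightarrow> bracket h k = 0"
  by (rule H_eq_0_of_weights) (simp_all add: bracket_H weight_linear(3))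

lemma root_space_subset_weight_space: "root_space H \<alpha> \<subseteq> weight_space \<alpha>"
proof -
  have "((\<lambda>x. bracket h x - scale (\<alpha> h) x) ^^ 1) x = 0" if "x \<in> root_space H \<alpha>" "h \<in> H" for x h
    using that by (simp add: root_space_def)
  then show ?thesis unfolding weight_space_def gen_eigenspace_def by blast
qed

lemma subspace_root_space: "subspace (root_space H \<alpha>)"
  by (rule subspaceI)
    (auto simp: root_space_def bracket_add_right bracket_scale_right scale_right_distrib mult.commute)

text \<open>
  On an \<open>H\<close>-stable subspace of minimal dimension every \<open>h - \<alpha> h\<close> vanishes, because its kernel
  is stable and nonzero.
\<close>

lemma root_vector_exists:
  assumes "\<alpha> \<in> weights"
  obtains x where "x \<noteq> 0" "x \<in> root_space H \<alpha>"
proof -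
  let ?P = "\<lambda>U. subspace U \<and> U \<noteq> {0} \<and> U \<subseteq> weight_space \<alpha> \<and> (\<forall>h\<in>H. bracket h ` U \<subseteq> U)"
  have "?P (weight_space \<alpha>)"
    using assms subspace_weight_space bracket_H_weight_space by (auto simp: weights_def)
  then obtain U where PU: "?P U" and least: "\<And>V. ?P V \<Longrightarrow> dim U \<le> dim V"
    using exE[OF ex_has_least_nat[of ?P "weight_space \<alpha>" dim]] by metis
  have U: "subspace U" "U \<noteq> {0}" "U \<subseteq> weight_space \<alpha>" "\<And>h. h \<in> H \<Longrightarrow> bracket h ` U \<subseteq> U"
    using PU by simp_all
  have eig: "bracket h v = scale (\<alpha> h) v" if h: "h \<in> H" and v: "v \<in> U" for h v
  proof -
    let ?N = "\<lambda>x. bracket h x - scale (\<alpha> h) x"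
    define V where "V = U \<inter> {v. ?N v = 0}"
    have V: "subspace V"
      unfolding V_def
      by (intro subspace_inter U(1) module_hom.subspace_kernel[OF endo_module_hom[OF endo_shift[OF endo_bracket]]])
    have "bracket k v \<in> V" if k: "k \<in> H" and v: "v \<in> V" for k v
    proof -
      \<comment> \<open>Commutativity of \<open>H\<close> is what makes the kernel stable.\<close>
      have "bracket h (bracket k v) = bracket k (bracket h v)"
        using bracket_derivation[of h k v] H_abelian[OF h k] by simp
      moreover have "bracket h v = scale (\<alpha> h) v" using v by (simp add: V_def)
      moreover have "bracket k v \<in> U" using U(4)[OF k] v V_def by blast
      ultimately show ?thesis by (simp add: V_def bracket_scale_right)
    qed
    moreover have "V \<noteq> {0}"
    proof -
      obtain u where u: "u \<in> U" "u \<noteq> 0" using U(2) subspace_0[OF U(1)] by blast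
      then have "u \<in> gen_eigenspace (bracket h) (\<alpha> h)" using U(3) weight_spaceD[OF _ h] by blast
      then obtain m where "(?N ^^ m) u = 0" by (auto simp: gen_eigenspace_def)
      then obtain l where l: "(?N ^^ l) u \<noteq> 0" "?N ((?N ^^ l) u) = 0"
        using funpow_first_entry[of "\<lambda>x. x = 0" m ?N u] u(2) by blast
      have "(?N ^^ i) u \<in> U" for i
      proof (induction i)
        case (Suc i)
        then have "bracket h ((?N ^^ i) u) \<in> U" using U(4)[OF h] by blast
        then show ?case using Suc subspace_diff[OF U(1)] subspace_scale[OF U(1)] by simp
      qed (use u(1) in simp)
      then have "(?N ^^ l) u \<in> V" using l by (simp add: V_def)
      then show ?thesis using l by blast
    qed
    ultimately have "?P V" using V U(3) V_def by blast
    then have "V = U" using subspace_dim_equal[OF V U(1)] least V_def by blast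
    then show ?thesis using v by (auto simp: V_def)
  qed
  obtain u where u: "u \<in> U" "u \<noteq> 0" using U(2) subspace_0[OF U(1)] by blast
  then show thesis using that eig by (simp add: root_space_def)
qed

text \<open>If \<alpha> vanished at \<open>[x, y]\<close>, so would every weight by rationality, and
  \<open>[x, y]\<close> would be 0. For a true eigenvector \<open>x\<close>, invariance then gives
  \<open>\<alpha> h * killing x y = killing h [x, y] = 0\<close> for all \<open>h\<close>, although
  \<open>y\<close> was chosen to pair with \<open>x\<close>.\<close>

lemma coroot_exists:
  assumes \<alpha>: "\<alpha> \<in> weights" "\<alpha> \<noteq> (\<lambda>_. 0)"
  obtains x y where "x \<in> root_space H \<alpha>" "y \<in> weight_space (\<lambda>h. - \<alpha> h)" "\<alpha> (bracket x y) \<noteq> 0"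
proof -
  obtain x where x: "x \<noteq> 0" "x \<in> root_space H \<alpha>" using root_vector_exists[OF \<alpha>(1)] .
  then have xw: "x \<in> weight_space \<alpha>" using root_space_subset_weight_space by blast
  obtain y where y: "y \<in> weight_space (\<lambda>h. - \<alpha> h)" "killing x y \<noteq> 0"
    using killing_pairing[OF xw x(1) weights_vanish[OF \<alpha>(1)]] by blast
  have "\<alpha> (bracket x y) \<noteq> 0"
  proof
    assume z: "\<alpha> (bracket x y) = 0"
    have "\<beta> (bracket x y) = 0" if "\<beta> \<in> weights" for \<beta>
      using weight_rational_multiple[OF xw y(1) weights_vanish[OF \<alpha>(1)] that] z by auto
    then have t: "bracket x y = 0" by (rule H_eq_0_of_weights[OF bracket_opposite_in_H[OF xw y(1)]])
    have "\<alpha> h = 0" if h: "h \<in> H" for h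
    proof -
      have "\<alpha> h * killing x y = killing (bracket h x) y"
        using x(2) h by (simp add: root_space_def killing_scale_left)
      also have "\<dots> = 0" using killing_invariant[of h x y] t killing_sym[of h 0] by simp
      finally show ?thesis using y(2) by simp
    qed
    then have "\<alpha> h = 0" for h using weights_vanish[OF \<alpha>(1)] by (cases "h \<in> H") auto
    then show False using \<alpha>(2) by blast
  qed
  then show thesis using that x(2) y(1) by blast
qed

text \<open>
  With \<open>x\<close>, \<open>y\<close> as in \<open>coroot_exists\<close>, the trace of \<open>[x, y]\<close> on the sum of the line through \<open>x\<close>
  and the weight spaces of \<open>0, -\<alpha>, -2\<alpha>, \<dots>\<close> is zero.
\<close>

lemma dim_weight_space_neg:
  assumes \<alpha>: "\<alpha> \<in> weights" "\<alpha> \<noteq> (\<lambda>_. 0)"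
  shows "dim (weight_space (\<lambda>h. - \<alpha> h)) = 1"
proof -
  obtain x y where x: "x \<in> root_space H \<alpha>" and y: "y \<in> weight_space (\<lambda>h. - \<alpha> h)"
    and nz: "\<alpha> (bracket x y) \<noteq> 0" using coroot_exists[OF \<alpha>] .
  have xw: "x \<in> weight_space \<alpha>" using x root_space_subset_weight_space by blast
  define t where "t = bracket x y"
  have t: "t \<in> H" unfolding t_def by (rule bracket_opposite_in_H[OF xw y])
  have "t \<noteq> 0" using nz weight_linear(2)[OF \<alpha>(1) t, of 0] by (auto simp: t_def)
  have zw: "(\<lambda>_. 0) \<in> weights" using t \<open>t \<noteq> 0\<close> by (auto simp: weights_def weight_space_zero)
  have "x \<noteq> 0" using \<open>t \<noteq> 0\<close> by (auto simp: t_def)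
  \<comment> \<open>\<open>{..0}\<close> keeps 0, whose weight space is \<open>H\<close>, and the
    negative multiples of \<alpha>. The weight \<alpha> is represented by the line \<open>?L\<close>
    alone, so its multiplicity does not enter the trace.\<close>
  define A where "A = weight_string (\<lambda>_. 0) \<alpha> {..0}"
  have Aw: "A \<subseteq> weights" by (auto simp: A_def weight_string_def)
  have finA: "finite A" using Aw finite_weights finite_subset by blast
  have "\<forall>\<gamma>\<in>A. \<exists>k. k \<le> 0 \<and> \<gamma> = (\<lambda>h. of_int k * \<alpha> h)" by (auto simp: A_def weight_string_def)
  then obtain k where k: "\<And>\<gamma>. \<gamma> \<in> A \<Longrightarrow> k \<gamma> \<le> 0"
    "\<And>\<gamma>. \<gamma> \<in> A \<Longrightarrow> \<gamma> = (\<lambda>h. of_int (k \<gamma>) * \<alpha> h)"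
    by (metis bchoice)
  have zA: "(\<lambda>_. 0) \<in> A" using zw by (auto simp: A_def weight_string_def intro!: bexI[of _ 0])
  have nA: "(\<lambda>h. - \<alpha> h) \<in> A"
    using weights_neg[OF \<alpha>(1)] by (auto simp: A_def weight_string_def intro!: bexI[of _ "-1"])
  have "\<alpha> \<notin> A"
  proof
    assume "\<alpha> \<in> A"
    then have "\<alpha> t = of_int (k \<alpha>) * \<alpha> t" using fun_cong[OF k(2)] by blast
    then have "k \<alpha> = 1" using nz t_def by simp
    then show False using k(1)[OF \<open>\<alpha> \<in> A\<close>] by simp
  qed
  let ?N = "weight_sum A" and ?L = "span {x}"
  have "insert \<alpha> A \<subseteq> weights" using Aw \<alpha>(1) by blast
  then have "weight_space \<alpha> \<inter> ?N = {0}"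
    using indep_family_insert_Int[OF indep_weight_spaces finA \<open>\<alpha> \<notin> A\<close> subspace_weight_space] finA by simp
  moreover have "?L \<subseteq> weight_space \<alpha>" using xw by (intro span_minimal subspace_weight_space) simp
  ultimately have int: "?L \<inter> ?N = {0}" using span_zero by auto
  have M: "subspace (?L + ?N)" by (intro subspace_plus subspace_span)
  have LM: "?L \<subseteq> ?L + ?N" using set_zero_plus2[OF span_zero] by (metis add.commute)
  have NM: "?N \<subseteq> ?L + ?N" by (rule set_zero_plus2[OF span_zero])
  have HN: "H \<subseteq> ?N" using weight_space_subset_weight_sum[OF zA] weight_space_zero by simp
  have closed: "bracket z ` (?L + ?N) \<subseteq> ?L + ?N"
    if "bracket z x \<in> ?L + ?N" "bracket z ` ?N \<subseteq> ?L + ?N" for z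
  proof
    fix w assume "w \<in> bracket z ` (?L + ?N)"
    then obtain c n where w: "w = bracket z (scale c x + n)" "n \<in> ?N"
      by (auto simp: set_plus_def span_singleton)
    have "scale c (bracket z x) + bracket z n \<in> ?L + ?N"
      using that w(2) by (intro subspace_add[OF M] subspace_scale[OF M]) auto
    then show "w \<in> ?L + ?N" by (simp add: w(1) bracket_add_right bracket_scale_right)
  qed
  have xM: "bracket x ` (?L + ?N) \<subseteq> ?L + ?N"
  proof (rule closed)
    show "bracket x x \<in> ?L + ?N" using subspace_0[OF M] by (simp add: bracket_self)
    show "bracket x ` ?N \<subseteq> ?L + ?N"
    proof (rule bracket_weight_sumI[OF M])
      fix \<gamma> z assume \<gamma>: "\<gamma> \<in> A" and z: "z \<in> weight_space \<gamma>"
      show "bracket x z \<in> ?L + ?N"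
      proof (cases "k \<gamma> = 0")
        case True
        then have "\<gamma> = (\<lambda>_. 0)" using k(2)[OF \<gamma>] by simp
        then have "z \<in> H" using z weight_space_zero by simp
        \<comment> \<open>As \<open>x\<close> is a true eigenvector of \<open>H\<close>, the step up
          from weight 0 stays on the line \<open>?L\<close>.\<close>
        then have "bracket x z = scale (- \<alpha> z) x"
          using x bracket_anticomm[of x z] by (simp add: root_space_def)
        then have "bracket x z \<in> ?L" by (simp only: span_scale span_base singletonI)
        then show ?thesis using LM by blast
      next
        case False
        then have k': "k \<gamma> + 1 \<le> 0" using k(1)[OF \<gamma>] by linarith
        have e: "(\<lambda>h. \<alpha> h + \<gamma> h) = (\<lambda>h. 0 + of_int (k \<gamma> + 1) * \<alpha> h)"
          using fun_cong[OF k(2)[OF \<gamma>]] by (simp add: fun_eq_iff algebra_simps)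
        have "bracket x z \<in> ?N"
        proof (rule bracket_mem_weight_sum[OF xw z])
          show "\<alpha> h + \<gamma> h = 0" if "h \<notin> H" for h
            using that weights_vanish[OF \<alpha>(1)] weights_vanish[of \<gamma>] \<gamma> Aw by auto
          show "(\<lambda>h. \<alpha> h + \<gamma> h) \<in> A" if "(\<lambda>h. \<alpha> h + \<gamma> h) \<in> weights"
            using that k' e unfolding A_def weight_string_def by blast
        qed
        then show ?thesis using NM by blast
      qed
    qed
  qed
  have yM: "bracket y ` (?L + ?N) \<subseteq> ?L + ?N"
  proof (rule closed)
    have "bracket y x = - t" using bracket_anticomm[of y x] by (simp add: t_def)
    then have "bracket y x \<in> H" using t subspace_neg[OF subspace_H] by simp
    then show "bracket y x \<in> ?L + ?N" using HN NM by blast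
    have "bracket y ` ?N \<subseteq> ?N"
      unfolding A_def by (rule weight_string_stable[of y "-1"]) (use y weights_vanish[OF \<alpha>(1)] in auto)
    then show "bracket y ` ?N \<subseteq> ?L + ?N" using NM by blast
  qed
  have txL: "bracket t z = scale (\<alpha> t) z" if "z \<in> ?L" for z
    using that x t by (auto simp: span_singleton root_space_def bracket_scale_right mult.commute)
  have tL: "bracket t ` ?L \<subseteq> ?L" using txL span_scale by auto
  have tN: "bracket t ` ?N \<subseteq> ?N"
    by (rule bracket_weight_sumI[OF subspace_span])
      (use bracket_H_weight_space[OF t] weight_space_subset_weight_sum in blast)
  have "trace_on ?L (bracket t) = trace_on ?L (scale (\<alpha> t))"
    by (rule trace_on_cong[OF subspace_span endo_bracket tL endo_homothety txL])
  also have "\<dots> = \<alpha> t" using \<open>x \<noteq> 0\<close> by (simp add: trace_on_homothety)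
  finally have "0 = \<alpha> t + (\<Sum>\<gamma>\<in>A. of_nat (dim (weight_space \<gamma>)) * \<gamma> t)"
    using trace_bracket[OF M xM yM] trace_on_direct_sum(1)[OF subspace_span subspace_span int endo_bracket tL tN]
      trace_weight_spaces[OF t Aw] unfolding t_def by simp
  also have "(\<Sum>\<gamma>\<in>A. of_nat (dim (weight_space \<gamma>)) * \<gamma> t)
      = (\<Sum>\<gamma>\<in>A. of_int (int (dim (weight_space \<gamma>)) * k \<gamma>) * \<alpha> t)"
  proof (rule sum.cong[OF refl])
    fix \<gamma> assume "\<gamma> \<in> A"
    then have "\<gamma> t = of_int (k \<gamma>) * \<alpha> t" using fun_cong[OF k(2)] by blast
    then show "of_nat (dim (weight_space \<gamma>)) * \<gamma> t = of_int (int (dim (weight_space \<gamma>)) * k \<gamma>) * \<alpha> t"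
      by simp
  qed
  also have "\<alpha> t + \<dots> = of_int (1 + (\<Sum>\<gamma>\<in>A. int (dim (weight_space \<gamma>)) * k \<gamma>)) * \<alpha> t"
    by (simp add: sum_distrib_right distrib_right)
  finally have "of_int (1 + (\<Sum>\<gamma>\<in>A. int (dim (weight_space \<gamma>)) * k \<gamma>)) = (0 :: 'f)"
    using nz by (simp add: t_def)
  then have s: "1 + (\<Sum>\<gamma>\<in>A. int (dim (weight_space \<gamma>)) * k \<gamma>) = 0" by (simp only: of_int_eq_0_iff)
  let ?\<beta> = "\<lambda>h. - \<alpha> h"
  have "- \<alpha> t = of_int (k ?\<beta>) * \<alpha> t" using fun_cong[OF k(2)[OF nA]] by blast
  then have "of_int (k ?\<beta> + 1) * \<alpha> t = 0" by (simp add: distrib_right eq_commute[of "- \<alpha> t"])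
  then have "k ?\<beta> + 1 = 0" using nz unfolding t_def by (simp only: mult_eq_0_iff of_int_eq_0_iff) simp
  then have k\<beta>: "k ?\<beta> = -1" by simp
  \<comment> \<open>The weight -\<alpha> contributes minus its dimension to a sum equal to -1, and
    no other term is positive; hence that dimension is at most 1.\<close>
  have "(\<Sum>\<gamma>\<in>A - {?\<beta>}. int (dim (weight_space \<gamma>)) * k \<gamma>) \<le> 0"
    using k(1) by (intro sum_nonpos mult_nonneg_nonpos) auto
  then have "int (dim (weight_space ?\<beta>)) \<le> 1"
    using s sum.remove[OF finA nA, of "\<lambda>\<gamma>. int (dim (weight_space \<gamma>)) * k \<gamma>"] k\<beta> by simp
  moreover have "0 < dim (weight_space ?\<beta>)"
    using dim_weight_space_pos[OF weights_neg[OF \<alpha>(1)]] .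
  ultimately show ?thesis by linarith
qed

lemma dim_weight_space:
  assumes "\<alpha> \<in> weights" "\<alpha> \<noteq> (\<lambda>_. 0)"
  shows "dim (weight_space \<alpha>) = 1"
proof -
  have "(\<lambda>h. - \<alpha> h) \<noteq> (\<lambda>_. 0)"
    using assms(2) by (metis (no_types, lifting) neg_equal_0_iff_equal ext)
  then show ?thesis using dim_weight_space_neg[OF weights_neg[OF assms(1)]] by simp
qed

lemma weight_space_line:
  assumes "\<alpha> \<in> weights" "\<alpha> \<noteq> (\<lambda>_. 0)" "x \<in> weight_space \<alpha>" "x \<noteq> 0"
  shows "weight_space \<alpha> = span {x}"
proof -
  have "span {x} \<subseteq> weight_space \<alpha>" using assms(3) by (intro span_minimal subspace_weight_space) simp
  then show ?thesis
    using subspace_dim_equal[OF subspace_span subspace_weight_space, of "{x}" \<alpha>] dim_weight_space[OF assms(1,2)]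
      assms(4) by simp
qed

lemma root_space_eq_weight_space:
  assumes "\<alpha> \<in> weights" "\<alpha> \<noteq> (\<lambda>_. 0)"
  shows "root_space H \<alpha> = weight_space \<alpha>"
proof -
  obtain x where x: "x \<noteq> 0" "x \<in> root_space H \<alpha>" using root_vector_exists[OF assms(1)] .
  then have "weight_space \<alpha> = span {x}"
    using weight_space_line[OF assms] root_space_subset_weight_space by blast
  also have "\<dots> \<subseteq> root_space H \<alpha>" using x(2) by (intro span_minimal subspace_root_space) simp
  finally show ?thesis using root_space_subset_weight_space by blast
qed

lemma roots_eq_weights: "roots H = weights - {\<lambda>_. 0}"
proof (intro equalityI subsetI)
  fix \<alpha> assume \<alpha>: "\<alpha> \<in> roots H"
  then have "weight_space \<alpha> \<noteq> {0}"
    using root_space_subset_weight_space[of \<alpha>] subspace_0[OF subspace_root_space, of \<alpha>]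
    by (auto simp: roots_def)
  then show "\<alpha> \<in> weights - {\<lambda>_. 0}"
    using \<alpha> by (auto simp: roots_def weights_def dual_space_def)
next
  fix \<alpha> assume \<alpha>: "\<alpha> \<in> weights - {\<lambda>_. 0}"
  then obtain x where "x \<noteq> 0" "x \<in> root_space H \<alpha>" using root_vector_exists by blast
  then show "\<alpha> \<in> roots H" using \<alpha> weights_dual_space by (auto simp: roots_def)
qed

text \<open>
  If \<open>[g\<^sub>\<alpha>, g\<^sub>\<beta>] = 0\<close>, the lower half \<open>k \<le> 0\<close> of the \<open>\<alpha>\<close>-string through \<open>\<beta>\<close> would be stable
  under an \<open>sl\<^sub>2\<close>-triple, so that its weights would average to zero, like those of the full string.
\<close>

lemma bracket_root_spaces_nonzero:
  assumes \<alpha>: "\<alpha> \<in> weights" "\<alpha> \<noteq> (\<lambda>_. 0)" and \<beta>: "\<beta> \<in> weights"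
    and \<alpha>\<beta>: "(\<lambda>h. \<alpha> h + \<beta> h) \<in> weights"
  shows "\<exists>x\<in>weight_space \<alpha>. \<exists>z\<in>weight_space \<beta>. bracket x z \<noteq> 0"
proof (rule ccontr)
  assume "\<not> ?thesis"
  then have zero: "bracket x z = 0" if "x \<in> weight_space \<alpha>" "z \<in> weight_space \<beta>" for x z
    using that by blast
  obtain x y where x: "x \<in> root_space H \<alpha>" and y: "y \<in> weight_space (\<lambda>h. - \<alpha> h)"
    and nz: "\<alpha> (bracket x y) \<noteq> 0" using coroot_exists[OF \<alpha>] .
  have xw: "x \<in> weight_space \<alpha>" using x root_space_subset_weight_space by blast
  let ?t = "bracket x y"
  have t: "?t \<in> H" by (rule bracket_opposite_in_H[OF xw y])
  define A where "A = weight_string \<beta> \<alpha> UNIV"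
  have Aw: "A \<subseteq> weights" by (auto simp: A_def weight_string_def)
  have finA: "finite A" using Aw finite_weights finite_subset by blast
  have "\<forall>\<gamma>\<in>A. \<exists>k. \<gamma> = (\<lambda>h. \<beta> h + of_int k * \<alpha> h)" by (auto simp: A_def weight_string_def)
  then obtain k where k: "\<And>\<gamma>. \<gamma> \<in> A \<Longrightarrow> \<gamma> = (\<lambda>h. \<beta> h + of_int (k \<gamma>) * \<alpha> h)"
    by (metis bchoice)
  have kt: "\<gamma> ?t = \<beta> ?t + of_int (k \<gamma>) * \<alpha> ?t" if "\<gamma> \<in> A" for \<gamma>
    using fun_cong[OF k[OF that]] .
  \<comment> \<open>Positions are unique because \<alpha> does not vanish at
    \<open>?t\<close>.\<close>
  have k_eq: "k \<gamma> = j" if "\<gamma> \<in> A" "\<gamma> = (\<lambda>h. \<beta> h + of_int j * \<alpha> h)" for \<gamma> j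
    using kt[OF that(1)] fun_cong[OF that(2), of ?t] nz by simp
  define A1 where "A1 = {\<gamma> \<in> A. k \<gamma> \<le> 0}"
  have A1w: "A1 \<subseteq> weights" using Aw by (auto simp: A1_def)
  have A1: "A1 = weight_string \<beta> \<alpha> {..0}"
  proof (intro equalityI subsetI)
    fix \<gamma> assume "\<gamma> \<in> A1"
    then show "\<gamma> \<in> weight_string \<beta> \<alpha> {..0}"
      using k[of \<gamma>] Aw unfolding A1_def weight_string_def by blast
  next
    fix \<gamma> assume "\<gamma> \<in> weight_string \<beta> \<alpha> {..0}"
    then obtain j where j: "\<gamma> \<in> weights" "j \<le> 0" "\<gamma> = (\<lambda>h. \<beta> h + of_int j * \<alpha> h)"
      by (auto simp: weight_string_def)
    then have "\<gamma> \<in> A" unfolding A_def weight_string_def by blast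
    then show "\<gamma> \<in> A1" using k_eq[OF _ j(3)] j(2) by (simp add: A1_def)
  qed
  have van: "\<And>h. h \<notin> H \<Longrightarrow> \<alpha> h = 0" by (rule weights_vanish[OF \<alpha>(1)])
  have xA: "bracket x ` weight_sum A \<subseteq> weight_sum A"
    unfolding A_def by (rule weight_string_stable[of x 1]) (use xw van in auto)
  have yA: "bracket y ` weight_sum A \<subseteq> weight_sum A"
    unfolding A_def by (rule weight_string_stable[of y "-1"]) (use y van in auto)
  have yA1: "bracket y ` weight_sum A1 \<subseteq> weight_sum A1"
    unfolding A1 by (rule weight_string_stable[of y "-1"]) (use y van in auto)
  have xA1: "bracket x ` weight_sum A1 \<subseteq> weight_sum A1"
  proof (rule bracket_weight_sumI[OF subspace_span])
    fix \<gamma> z assume \<gamma>: "\<gamma> \<in> A1" and z: "z \<in> weight_space \<gamma>"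
    then have \<gamma>A: "\<gamma> \<in> A" "k \<gamma> \<le> 0" by (auto simp: A1_def)
    show "bracket x z \<in> weight_sum A1"
    proof (cases "k \<gamma> = 0")
      case True
      \<comment> \<open>The only upward step that could leave the lower half starts at \<beta>, and
        there the assumed vanishing applies.\<close>
      then have "\<gamma> = \<beta>" using k[OF \<gamma>A(1)] by simp
      then show ?thesis using zero[OF xw] z span_zero by simp
    next
      case False
      then have k': "k \<gamma> + 1 \<le> 0" using \<gamma>A by linarith
      have e: "(\<lambda>h. \<alpha> h + \<gamma> h) = (\<lambda>h. \<beta> h + of_int (k \<gamma> + 1) * \<alpha> h)"
        using fun_cong[OF k[OF \<gamma>A(1)]] by (simp add: fun_eq_iff algebra_simps)
      show ?thesis
      proof (rule bracket_mem_weight_sum[OF xw z])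
        show "\<alpha> h + \<gamma> h = 0" if "h \<notin> H" for h
          using that van weights_vanish[of \<gamma>] \<gamma>A(1) Aw by auto
        show "(\<lambda>h. \<alpha> h + \<gamma> h) \<in> A1" if "(\<lambda>h. \<alpha> h + \<gamma> h) \<in> weights"
          using that k' e unfolding A1 weight_string_def by blast
      qed
    qed
  qed
  define d where "d \<gamma> = int (dim (weight_space \<gamma>))" for \<gamma>
  have dpos: "d \<gamma> > 0" if "\<gamma> \<in> A" for \<gamma>
    using dim_weight_space_pos[of \<gamma>] that Aw unfolding d_def by (simp only: of_nat_0_less_iff subset_iff)
  define D D1 K K1 where "D = (\<Sum>\<gamma>\<in>A. d \<gamma>)" "D1 = (\<Sum>\<gamma>\<in>A1. d \<gamma>)"
    "K = (\<Sum>\<gamma>\<in>A. d \<gamma> * k \<gamma>)" "K1 = (\<Sum>\<gamma>\<in>A1. d \<gamma> * k \<gamma>)"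
  note defs = this
  have "of_int D * \<beta> ?t + of_int K * \<alpha> ?t = 0"
    using weight_string_trace[OF Aw t xA yA, of \<beta> k \<alpha>] kt by (simp add: defs d_def)
  moreover have "of_int D1 * \<beta> ?t + of_int K1 * \<alpha> ?t = 0"
    using weight_string_trace[OF A1w t xA1 yA1, of \<beta> k \<alpha>] kt by (simp add: defs d_def A1_def)
  \<comment> \<open>\<beta> is eliminated between the relations for the full string and for its
    lower half; as \<alpha> is nonzero at \<open>?t\<close>, an identity of integers
    remains.\<close>
  ultimately have "of_int (D1 * K - D * K1) * \<alpha> ?t = 0"
  proof -
    assume a: "of_int D * \<beta> ?t + of_int K * \<alpha> ?t = 0" and b: "of_int D1 * \<beta> ?t + of_int K1 * \<alpha> ?t = 0"
    have "of_int (D1 * K - D * K1) * \<alpha> ?t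
        = of_int D1 * (of_int D * \<beta> ?t + of_int K * \<alpha> ?t) - of_int D * (of_int D1 * \<beta> ?t + of_int K1 * \<alpha> ?t)"
      by (simp add: algebra_simps)
    then show ?thesis using a b by simp
  qed
  then have eq: "D1 * K = D * K1" using nz by (simp only: mult_eq_0_iff of_int_eq_0_iff) simp
  have sub: "A1 \<subseteq> A" by (auto simp: A1_def)
  let ?A2 = "A - A1"
  have KK: "K = K1 + (\<Sum>\<gamma>\<in>?A2. d \<gamma> * k \<gamma>)" and DD: "D = D1 + (\<Sum>\<gamma>\<in>?A2. d \<gamma>)"
    by (simp_all add: defs sum.subset_diff[OF sub finA] add.commute)
  have "\<beta> \<in> A" using \<beta> unfolding A_def weight_string_def by (auto intro!: exI[of _ 0])
  then have "\<beta> \<in> A1" using k_eq[of \<beta> 0] by (simp add: A1_def)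
  then have D1: "D1 > 0" unfolding defs
    using dpos sub finA finite_subset[OF sub finA] by (intro sum_pos) auto
  have "(\<lambda>h. \<alpha> h + \<beta> h) = (\<lambda>h. \<beta> h + of_int 1 * \<alpha> h)" by (simp add: fun_eq_iff)
  then have abA: "(\<lambda>h. \<alpha> h + \<beta> h) \<in> A" "k (\<lambda>h. \<alpha> h + \<beta> h) = 1"
    using \<alpha>\<beta> k_eq[of "\<lambda>h. \<alpha> h + \<beta> h" 1] unfolding A_def weight_string_def by blast+
  then have "(\<lambda>h. \<alpha> h + \<beta> h) \<in> ?A2" by (simp add: A1_def)
  moreover have "d \<gamma> * k \<gamma> > 0" if "\<gamma> \<in> ?A2" for \<gamma>
    using that dpos[of \<gamma>] by (intro mult_pos_pos) (auto simp: A1_def)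
  ultimately have K2: "(\<Sum>\<gamma>\<in>?A2. d \<gamma> * k \<gamma>) > 0"
    using finA by (intro sum_pos) auto
  have D2: "(\<Sum>\<gamma>\<in>?A2. d \<gamma>) \<ge> 0" using dpos by (intro sum_nonneg) (simp add: less_imp_le)
  have K1: "K1 \<le> 0" unfolding defs
    by (intro sum_nonpos mult_nonneg_nonpos) (auto simp: A1_def d_def)
  \<comment> \<open>After cancelling \<open>D1 * K1\<close>, the left side is positive because
    \<alpha> + \<beta> lies in the upper half, while the right side carries the factor
    \<open>K1 \<le> 0\<close>.\<close>
  have "D1 * (\<Sum>\<gamma>\<in>?A2. d \<gamma> * k \<gamma>) = (\<Sum>\<gamma>\<in>?A2. d \<gamma>) * K1"
    using eq unfolding KK DD by (simp add: algebra_simps)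
  moreover have "D1 * (\<Sum>\<gamma>\<in>?A2. d \<gamma> * k \<gamma>) > 0" using D1 K2 by simp
  moreover have "(\<Sum>\<gamma>\<in>?A2. d \<gamma>) * K1 \<le> 0" using D2 K1 by (rule mult_nonneg_nonpos)
  ultimately show False by linarith
qed

subsection \<open>Subspaces of the product algebra\<close>

interpretation pair: lie_algebra "prod_scale scale" "prod_bracket bracket"
  by (rule lie_algebra_prod)

lemma pair_subspace_iff:
  "module.subspace (prod_scale scale) W \<longleftrightarrow>
     0 \<in> W \<and> (\<forall>v\<in>W. \<forall>w\<in>W. v + w \<in> W) \<and> (\<forall>c. \<forall>w\<in>W. prod_scale scale c w \<in> W)"
  by (auto simp: pair.subspace_def)

lemma pair_subalgebra_iff:
  "lie_algebra.lie_subalgebra (prod_scale scale) (prod_bracket bracket) W \<longleftrightarrow>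
     module.subspace (prod_scale scale) W \<and> (\<forall>v\<in>W. \<forall>w\<in>W. prod_bracket bracket v w \<in> W)"
  by (simp add: pair.lie_subalgebra_def)

text \<open>The graph of \<phi> over \<open>R\<close> is already a subspace, so the span in
  \<open>glued_subspace\<close> adds nothing to it.\<close>

lemma pair_span_graph:
  assumes "subspace R" "linear_iso_on R R' \<phi>"
  shows "module.span (prod_scale scale) {(h, \<phi> h) | h. h \<in> R} = {(h, \<phi> h) | h. h \<in> R}"
proof -
  have add: "\<phi> (x + y) = \<phi> x + \<phi> y" if "x \<in> R" "y \<in> R" for x y
    using assms(2) that by (simp add: linear_iso_on_def)
  have scale: "\<phi> (scale c x) = scale c (\<phi> x)" if "x \<in> R" for x c
    using assms(2) that by (simp add: linear_iso_on_def)
  have "\<phi> 0 = 0" using scale[of 0 0] subspace_0[OF assms(1)] by simp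
  then have "module.subspace (prod_scale scale) {(h, \<phi> h) | h. h \<in> R}"
    unfolding pair_subspace_iff
    using subspace_0[OF assms(1)] subspace_add[OF assms(1)] subspace_scale[OF assms(1)] add scale
    by (auto simp: prod_scale_def zero_prod_def)
  then show ?thesis by (simp add: pair.span_eq_iff[THEN iffD2])
qed

section \<open>The decomposition into \<open>H\<close> and root spaces, split along a
  partition\<close>

lemma roots_weights: "\<alpha> \<in> roots H \<Longrightarrow> \<alpha> \<in> weights"
  and roots_nonzero: "\<alpha> \<in> roots H \<Longrightarrow> \<alpha> \<noteq> (\<lambda>_. 0)"
  by (simp_all add: roots_eq_weights)

lemma root_space_eq: "\<alpha> \<in> roots H \<Longrightarrow> root_space H \<alpha> = weight_space \<alpha>"
  by (simp add: root_space_eq_weight_space roots_weights roots_nonzero)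

lemma finite_roots: "finite (roots H)"
  by (simp add: roots_eq_weights finite_weights)

lemma root_sum_eq: "S \<subseteq> roots H \<Longrightarrow> root_sum H S = weight_sum S"
  unfolding root_sum_def using root_space_eq by (intro arg_cong[where f = span]) auto

lemma subspace_root_sum: "subspace (root_sum H S)"
  by (simp add: root_sum_def)

lemma root_space_subset_root_sum: "\<alpha> \<in> S \<Longrightarrow> root_space H \<alpha> \<subseteq> root_sum H S"
  unfolding root_sum_def by (rule order_trans[OF UN_upper span_superset])

text \<open>The zero functional together with the roots; unlike \<open>weights\<close>, it contains zero even if \<open>H = {0}\<close>.\<close>

definition root_index :: "('g \<Rightarrow> 'f) set" where
  "root_index = insert (\<lambda>_. 0) (roots H)"

lemma finite_root_index: "finite root_index"
  by (simp add: root_index_def finite_roots)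

text \<open>With \<open>H\<close> abelian and root spaces equal to weight spaces, nothing
  generalized is left.\<close>

lemma bracket_root_index:
  assumes "\<gamma> \<in> root_index" "h \<in> H" "x \<in> weight_space \<gamma>"
  shows "bracket h x = scale (\<gamma> h) x"
proof (cases "\<gamma> = (\<lambda>_. 0)")
  case True
  then show ?thesis using assms by (simp add: weight_space_zero H_abelian)
next
  case False
  then have "\<gamma> \<in> roots H" using assms(1) by (simp add: root_index_def)
  then show ?thesis using assms(2,3) root_space_eq by (auto simp: root_space_def)
qed

lemma root_index_separated:
  assumes "\<alpha> \<in> root_index" "\<beta> \<in> root_index" "\<alpha> \<noteq> \<beta>"
  shows "\<exists>h\<in>H. \<alpha> h \<noteq> \<beta> h"
proof (rule ccontr)
  assume same: "\<not> ?thesis"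
  have van: "\<gamma> x = 0" if "\<gamma> \<in> root_index" "x \<notin> H" for \<gamma> x
    using that weights_vanish[OF roots_weights] by (auto simp: root_index_def)
  have "\<alpha> x = \<beta> x" for x
    using same van[OF assms(1), of x] van[OF assms(2), of x] by (cases "x \<in> H") auto
  then show False using assms(3) by blast
qed

lemma root_index_sum: "\<exists>x. (\<forall>\<gamma>\<in>root_index. x \<gamma> \<in> weight_space \<gamma>) \<and> z = (\<Sum>\<gamma>\<in>root_index. x \<gamma>)"
proof -
  have "weights \<subseteq> root_index" by (auto simp: root_index_def roots_eq_weights)
  then have "weight_sum root_index = UNIV" using span_mono[OF UN_mono[OF _ order_refl]] weights_span by blast
  then have "z \<in> {\<Sum>\<gamma>\<in>root_index. x \<gamma> | x. \<forall>\<gamma>\<in>root_index. x \<gamma> \<in> weight_space \<gamma>}"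
    using span_UN_eq_sums[of root_index weight_space, OF finite_root_index subspace_weight_space] by simp
  then show ?thesis by blast
qed

lemma root_index_indep: "indep_family root_index weight_space"
  by (rule indep_weight_spaces_separated[OF finite_root_index root_index_separated])

lemma root_decomposition_sum:
  assumes "SP \<union> SM = roots H"
  shows "\<exists>h\<in>H. \<exists>p\<in>root_sum H SP. \<exists>q\<in>root_sum H SM. z = h + p + q"
proof -
  obtain x where x: "\<And>\<gamma>. \<gamma> \<in> root_index \<Longrightarrow> x \<gamma> \<in> weight_space \<gamma>" "z = (\<Sum>\<gamma>\<in>root_index. x \<gamma>)"
    using root_index_sum by blast
  have "finite SP" "SP \<inter> (SM - SP) = {}" "finite (SM - SP)"
    using assms finite_roots finite_subset[of _ "roots H"] by auto
  then have "(\<Sum>\<gamma>\<in>SP \<union> (SM - SP). x \<gamma>) = (\<Sum>\<gamma>\<in>SP. x \<gamma>) + (\<Sum>\<gamma>\<in>SM - SP. x \<gamma>)"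
    by (intro sum.union_disjoint)
  moreover have "SP \<union> (SM - SP) = roots H" using assms by blast
  ultimately have "(\<Sum>\<gamma>\<in>roots H. x \<gamma>) = (\<Sum>\<gamma>\<in>SP. x \<gamma>) + (\<Sum>\<gamma>\<in>SM - SP. x \<gamma>)"
    by (simp only:)
  moreover have "(\<lambda>_. 0) \<notin> roots H" using roots_nonzero by blast
  ultimately have "z = x (\<lambda>_. 0) + (\<Sum>\<gamma>\<in>SP. x \<gamma>) + (\<Sum>\<gamma>\<in>SM - SP. x \<gamma>)"
    using x(2) finite_roots by (simp add: root_index_def add.assoc)
  moreover have "x (\<lambda>_. 0) \<in> H" using x(1)[of "\<lambda>_. 0"] by (simp add: root_index_def weight_space_zero)
  moreover have mem: "x \<gamma> \<in> root_space H \<gamma>" if "\<gamma> \<in> SP \<union> SM" for \<gamma>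
    using x(1)[of \<gamma>] root_space_eq[of \<gamma>] that assms by (simp add: root_index_def)
  have "(\<Sum>\<gamma>\<in>SP. x \<gamma>) \<in> root_sum H SP"
    using mem root_space_subset_root_sum[of _ SP] by (intro subspace_sum[OF subspace_root_sum]) blast
  moreover have "(\<Sum>\<gamma>\<in>SM - SP. x \<gamma>) \<in> root_sum H SM"
    using mem root_space_subset_root_sum[of _ SM] by (intro subspace_sum[OF subspace_root_sum]) blast
  ultimately show ?thesis by blast
qed

lemma root_decomposition_unique:
  assumes S: "SP \<union> SM = roots H" "SP \<inter> SM = {}"
    and z: "h \<in> H" "p \<in> root_sum H SP" "q \<in> root_sum H SM" "h + p + q = 0"
  shows "h = 0 \<and> p = 0 \<and> q = 0"
proof -
  have sub: "SP \<subseteq> roots H" "SM \<subseteq> roots H" using S by auto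
  have fin: "finite SP" "finite SM" using sub finite_roots finite_subset by auto
  obtain x where x: "\<forall>\<gamma>\<in>SP. x \<gamma> \<in> weight_space \<gamma>" "p = (\<Sum>\<gamma>\<in>SP. x \<gamma>)"
    using z(2) span_UN_eq_sums[of SP weight_space, OF fin(1) subspace_weight_space] unfolding root_sum_eq[OF sub(1)] by blast
  obtain y where y: "\<forall>\<gamma>\<in>SM. y \<gamma> \<in> weight_space \<gamma>" "q = (\<Sum>\<gamma>\<in>SM. y \<gamma>)"
    using z(3) span_UN_eq_sums[of SM weight_space, OF fin(2) subspace_weight_space] unfolding root_sum_eq[OF sub(2)] by blast
  \<comment> \<open>On \<open>root_index\<close> the default \<open>h\<close> is reached only at the
    zero functional.\<close>
  define w where "w \<gamma> = (if \<gamma> \<in> SP then x \<gamma> else if \<gamma> \<in> SM then y \<gamma> else h)" for \<gamma>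
  have zero: "(\<lambda>_. 0) \<notin> SP" "(\<lambda>_. 0) \<notin> SM" using sub roots_nonzero by blast+
  have p: "(\<Sum>\<gamma>\<in>SP. w \<gamma>) = p" unfolding x(2) by (rule sum.cong) (simp_all add: w_def)
  have q: "(\<Sum>\<gamma>\<in>SM. w \<gamma>) = q" unfolding y(2) using S(2) by (intro sum.cong) (auto simp: w_def)
  have "(\<Sum>\<gamma>\<in>root_index. w \<gamma>) = w (\<lambda>_. 0) + ((\<Sum>\<gamma>\<in>SP. w \<gamma>) + (\<Sum>\<gamma>\<in>SM. w \<gamma>))"
    unfolding root_index_def S(1)[symmetric] sum.union_disjoint[OF fin S(2), symmetric]
    by (rule sum.insert) (use fin zero in auto)
  also have "\<dots> = h + p + q" unfolding p q using zero by (simp add: w_def add.assoc)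
  also note z(4)
  finally have "(\<Sum>\<gamma>\<in>root_index. w \<gamma>) = 0" .
  moreover have "\<forall>\<gamma>\<in>root_index. w \<gamma> \<in> weight_space \<gamma>"
    using x(1) y(1) z(1) S(1) weight_space_zero by (auto simp: root_index_def w_def)
  ultimately have w0: "\<forall>\<gamma>\<in>root_index. w \<gamma> = 0"
    using root_index_indep unfolding indep_family_def by blast
  then have "h = 0" using zero by (auto simp: root_index_def w_def)
  moreover have "p = 0" unfolding p[symmetric]
    using w0 sub by (intro sum.neutral) (auto simp: root_index_def)
  ultimately show ?thesis using z(4) by simp
qed

lemma bracket_H_root_sum:
  assumes "S \<subseteq> roots H" "h \<in> H" "p \<in> root_sum H S"
  shows "bracket h p \<in> root_sum H S"
proof -
  have "bracket h ` weight_sum S \<subseteq> weight_sum S"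
    by (rule bracket_weight_sumI[OF subspace_span])
      (use bracket_H_weight_space[OF assms(2)] weight_space_subset_weight_sum in blast)
  then show ?thesis using assms(3) by (auto simp: root_sum_eq[OF assms(1)])
qed

text \<open>A bracket of root vectors leaves the root part only for opposite roots, and
  \<open>contains_coroot_lines\<close> places exactly these brackets in \<open>T\<close>.\<close>

lemma bracket_root_sums:
  assumes closed: "closed_roots H S" and T: "subspace T" "contains_coroot_lines H S T"
    and p: "p \<in> root_sum H S" "p' \<in> root_sum H S"
  shows "bracket p p' \<in> T + root_sum H S"
proof -
  have S: "S \<subseteq> roots H" using closed by (simp add: closed_roots_def)
  note M = subspace_plus[OF T(1) subspace_root_sum]
  have TM: "T \<subseteq> T + root_sum H S" using set_zero_plus2[OF subspace_0[OF subspace_root_sum]] by (metis add.commute)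
  have SM: "root_sum H S \<subseteq> T + root_sum H S" by (rule set_zero_plus2[OF subspace_0[OF T(1)]])
  have gen: "bracket x y \<in> T + root_sum H S"
    if xy: "x \<in> (\<Union>\<alpha>\<in>S. root_space H \<alpha>)" "y \<in> (\<Union>\<alpha>\<in>S. root_space H \<alpha>)" for x y
  proof -
    obtain \<alpha> \<beta> where \<alpha>\<beta>: "\<alpha> \<in> S" "x \<in> root_space H \<alpha>" "\<beta> \<in> S" "y \<in> root_space H \<beta>"
      using xy by blast
    show ?thesis
    proof (cases "\<beta> = (\<lambda>h. - \<alpha> h)")
      case True
      then have "bracket x y \<in> T" using T(2) \<alpha>\<beta> unfolding contains_coroot_lines_def by blast
      then show ?thesis using TM by blast
    next
      case False
      have ne: "(\<lambda>h. \<alpha> h + \<beta> h) \<noteq> (\<lambda>_. 0)"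
        using False by (metis (no_types, lifting) add.inverse_unique ext)
      have "bracket x y \<in> weight_sum S"
      proof (rule bracket_mem_weight_sum)
        show "x \<in> weight_space \<alpha>" "y \<in> weight_space \<beta>"
          using \<alpha>\<beta> root_space_subset_weight_space by blast+
        show "\<alpha> h + \<beta> h = 0" if "h \<notin> H" for h
          using that \<alpha>\<beta>(1,3) S weights_vanish[OF roots_weights, of \<alpha> h]
            weights_vanish[OF roots_weights, of \<beta> h] by (simp add: subset_iff)
        show "(\<lambda>h. \<alpha> h + \<beta> h) \<in> S" if "(\<lambda>h. \<alpha> h + \<beta> h) \<in> weights"
          using that ne closed \<alpha>\<beta>(1,3) unfolding closed_roots_def by (simp add: roots_eq_weights)
      qed
      then show ?thesis using SM root_sum_eq[OF S] by blast
    qed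
  qed
  show ?thesis by (rule bracket_span[OF M gen p[unfolded root_sum_def]])
qed

text \<open>A gluing map is linear on its domain and arbitrary elsewhere; facts about images and
  their dimensions require an operator on the whole space.\<close>

lemma linear_on_extend:
  assumes R: "subspace R" and "linear_iso_on R R' \<phi>"
  shows "\<exists>\<Phi>. endo \<Phi> \<and> (\<forall>x\<in>R. \<Phi> x = \<phi> x)"
proof -
  interpret vector_space_pair scale scale by unfold_locales
  obtain B where B: "independent B" "span B = R" "B \<subseteq> R" using subspace_basis[OF R] by blast
  obtain \<Phi> where \<Phi>: "endo \<Phi>" "\<forall>x\<in>B. \<Phi> x = \<phi> x"
    using linear_independent_extend[OF B(1), of \<phi>] by blast
  have add: "\<phi> (x + y) = \<phi> x + \<phi> y" if "x \<in> R" "y \<in> R" for x y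
    using assms(2) that by (simp add: linear_iso_on_def)
  have scale: "\<phi> (scale c x) = scale c (\<phi> x)" if "x \<in> R" for x c
    using assms(2) that by (simp add: linear_iso_on_def)
  have "x \<in> R \<and> \<Phi> x = \<phi> x" if "x \<in> span B" for x
    using that
  proof (induction x rule: span_induct_alt)
    case base
    then show ?case using scale[of 0 0] subspace_0[OF R] endo_zero[OF \<Phi>(1)] by simp
  next
    case (step c x y)
    then have "x \<in> R" "\<Phi> x = \<phi> x" using B(3) \<Phi>(2) by auto
    then show ?case
      using step(2) add[of "scale c x" y] scale[of x c] subspace_scale[OF R, of x c] subspace_add[OF R]
      by (simp add: endo_add[OF \<Phi>(1)] endo_scale[OF \<Phi>(1)])
  qed
  then show ?thesis using \<Phi>(1) B(2) by blast
qed

end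

subsection \<open>Subspaces glued from a datum\<close>

locale glued_datum = cartan_pair scale bracket Basis H
  for scale :: "'f::{alg_closed_field, field_char_0} \<Rightarrow> 'g::ab_group_add \<Rightarrow> 'g"
    and bracket :: "'g \<Rightarrow> 'g \<Rightarrow> 'g" and Basis :: "'g set" and H :: "'g set" +
  fixes SP SM sP sM tP tM rP rM \<phi>
  assumes regular: "regular_partition H SP SM"
    and datum: "gluing_datum H sP sM tP tM rP rM \<phi>"
begin

interpretation pair: lie_algebra "prod_scale scale" "prod_bracket bracket"
  by (rule lie_algebra_prod)

abbreviation "W \<equiv> glued_subspace H SP SM tP tM rP \<phi>"

abbreviation "P \<equiv> root_sum H SP"

abbreviation "Q \<equiv> root_sum H SM"

lemma partition: "SP \<union> SM = roots H" "SP \<inter> SM = {}" "closed_roots H SP" "closed_roots H SM"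
  "SP \<subseteq> roots H" "SM \<subseteq> roots H"
  using regular by (auto simp: regular_partition_def)

lemma subspaces: "subspace tP" "subspace tM" "subspace rP" "subspace rM"
  and sums: "sP = tP + rP" "sM = tM + rM" "H = sP + sM"
  and trivial_Int: "tP \<inter> rP = {0}" "tM \<inter> rM = {0}" "tP \<inter> tM = {0}"
  and iso: "linear_iso_on rP rM \<phi>"
  and s_subset: "sP \<subseteq> H" "sM \<subseteq> H"
  using datum by (auto simp: gluing_datum_def is_direct_sum_def)

lemma subset_H: "tP \<subseteq> H" "rP \<subseteq> H" "tM \<subseteq> H" "rM \<subseteq> H"
proof -
  have "tP \<subseteq> sP" unfolding sums(1) using set_zero_plus2[OF subspace_0[OF subspaces(3)]] by (metis add.commute)
  moreover have "rP \<subseteq> sP" unfolding sums(1) by (rule set_zero_plus2[OF subspace_0[OF subspaces(1)]])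
  moreover have "tM \<subseteq> sM" unfolding sums(2) using set_zero_plus2[OF subspace_0[OF subspaces(4)]] by (metis add.commute)
  moreover have "rM \<subseteq> sM" unfolding sums(2) by (rule set_zero_plus2[OF subspace_0[OF subspaces(2)]])
  ultimately show "tP \<subseteq> H" "rP \<subseteq> H" "tM \<subseteq> H" "rM \<subseteq> H" using s_subset by blast+
qed

lemma \<phi>_add: "x \<in> rP \<Longrightarrow> y \<in> rP \<Longrightarrow> \<phi> (x + y) = \<phi> x + \<phi> y"
  and \<phi>_scale: "x \<in> rP \<Longrightarrow> \<phi> (scale c x) = scale c (\<phi> x)"
  and \<phi>_mem: "x \<in> rP \<Longrightarrow> \<phi> x \<in> rM"
  and \<phi>_inj: "x \<in> rP \<Longrightarrow> y \<in> rP \<Longrightarrow> \<phi> x = \<phi> y \<Longrightarrow> x = y"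
  using iso by (auto simp: linear_iso_on_def bij_betw_def inj_on_def)

lemma \<phi>_zero: "\<phi> 0 = 0"
  using \<phi>_scale[of 0 0] subspace_0[OF subspaces(3)] by simp

lemma glued_mem_iff:
  "w \<in> W \<longleftrightarrow> (\<exists>t\<in>tP. \<exists>p\<in>P. \<exists>t'\<in>tM. \<exists>q\<in>Q. \<exists>r\<in>rP. w = (t + p + r, t' + q + \<phi> r))"
  (is "_ \<longleftrightarrow> ?R")
proof
  assume "w \<in> W"
  then have "w \<in> (tP + P) \<times> {0} + {0} \<times> (tM + Q) + {(h, \<phi> h) | h. h \<in> rP}"
    unfolding glued_subspace_def pair_span_graph[OF subspaces(3) iso] .
  then obtain ab c where "w = ab + c" "ab \<in> (tP + P) \<times> {0} + {0} \<times> (tM + Q)"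
    and abc4: "c \<in> {(h, \<phi> h) | h. h \<in> rP}" by (rule set_plus_elim)
  from this(2) obtain a b where "ab = a + b" and abc2: "a \<in> (tP + P) \<times> {0}"
    and abc3: "b \<in> {0} \<times> (tM + Q)" by (rule set_plus_elim)
  then have abc1: "w = a + b + c" using \<open>w = ab + c\<close> by simp
  obtain t p where a: "a = (t + p, 0)" "t \<in> tP" "p \<in> P" using abc2 by (auto elim!: set_plus_elim)
  obtain t' q where b: "b = (0, t' + q)" "t' \<in> tM" "q \<in> Q" using abc3 by (auto elim!: set_plus_elim)
  obtain r where c: "c = (r, \<phi> r)" "r \<in> rP" using abc4 by auto
  have "w = (t + p + r, t' + q + \<phi> r)" by (simp add: abc1 a b c)
  then show ?R using a b c by blast
next
  assume ?R
  then obtain t p t' q r where m: "t \<in> tP" "p \<in> P" "t' \<in> tM" "q \<in> Q" "r \<in> rP"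
    and w: "w = (t + p + r, t' + q + \<phi> r)" by blast
  have "w = (t + p, 0) + (0, t' + q) + (r, \<phi> r)" by (simp add: w)
  moreover have A: "(t + p, 0) \<in> (tP + P) \<times> {0}" and B: "(0, t' + q) \<in> {0} \<times> (tM + Q)"
    using m by (auto intro: set_plus_intro)
  moreover have C: "(r, \<phi> r) \<in> {(h, \<phi> h) | h. h \<in> rP}" using m(5) by blast
  ultimately show "w \<in> W"
    unfolding glued_subspace_def pair_span_graph[OF subspaces(3) iso]
    using set_plus_intro[OF set_plus_intro[OF A B] C] by (simp only:)
qed

lemma gluedI: "t \<in> tP \<Longrightarrow> p \<in> P \<Longrightarrow> t' \<in> tM \<Longrightarrow> q \<in> Q \<Longrightarrow> r \<in> rP \<Longrightarrow>
    (t + p + r, t' + q + \<phi> r) \<in> W"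
  unfolding glued_mem_iff by blast

lemma gluedE:
  assumes "w \<in> W"
  obtains t p t' q r where "t \<in> tP" "p \<in> P" "t' \<in> tM" "q \<in> Q" "r \<in> rP"
    "w = (t + p + r, t' + q + \<phi> r)"
  using assms unfolding glued_mem_iff by blast

lemma gluedI_graph_zero:
  assumes "a \<in> tP + P" "b \<in> tM + Q"
  shows "(a, b) \<in> W"
proof -
  obtain t p t' q where m: "a = t + p" "t \<in> tP" "p \<in> P" "b = t' + q" "t' \<in> tM" "q \<in> Q"
    using assms by (auto elim!: set_plus_elim)
  then show ?thesis using gluedI[OF m(2,3,5,6) subspace_0[OF subspaces(3)]] \<phi>_zero by simp
qed

lemma P_subset: "P \<subseteq> tP + P" and Q_subset: "Q \<subseteq> tM + Q"
  using set_zero_plus2 subspace_0 subspaces by blast+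

lemma zero_mem: "0 \<in> tP" "0 \<in> tM" "0 \<in> rP" "0 \<in> P" "0 \<in> Q"
  using subspace_0 subspaces subspace_root_sum by blast+

section \<open>Stability and closure under the bracket\<close>

lemma glued_diagonally_stable: "diagonally_stable H W"
  unfolding diagonally_stable_def
proof (intro ballI)
  fix h w assume h: "h \<in> H" and "w \<in> W"
  from this(2) obtain t p t' q r where m: "t \<in> tP" "p \<in> P" "t' \<in> tM" "q \<in> Q" "r \<in> rP"
    and w: "w = (t + p + r, t' + q + \<phi> r)" by (rule gluedE)
  have "bracket h t = 0" "bracket h r = 0" "bracket h t' = 0" "bracket h (\<phi> r) = 0"
    using H_abelian[OF h] m subset_H \<phi>_mem by blast+
  then have "prod_bracket bracket (h, h) w = (bracket h p, bracket h q)"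
    by (simp add: prod_bracket_def w bracket_add_right)
  moreover have "bracket h p \<in> P" "bracket h q \<in> Q"
    using bracket_H_root_sum partition h m by blast+
  ultimately show "prod_bracket bracket (h, h) w \<in> W"
    using gluedI_graph_zero P_subset Q_subset by (metis subsetD)
qed

lemma subspace_glued: "module.subspace (prod_scale scale) W"
  unfolding pair_subspace_iff
proof (intro conjI ballI allI)
  show "0 \<in> W" using gluedI[OF zero_mem(1,4,2,5,3)] \<phi>_zero by (simp add: zero_prod_def)
  fix v w assume "v \<in> W" "w \<in> W"
  from this(1) obtain t p t' q r where m: "t \<in> tP" "p \<in> P" "t' \<in> tM" "q \<in> Q" "r \<in> rP"
    and v: "v = (t + p + r, t' + q + \<phi> r)" by (rule gluedE)
  from \<open>w \<in> W\<close> obtain u n u' o' s where m': "u \<in> tP" "n \<in> P" "u' \<in> tM" "o' \<in> Q" "s \<in> rP"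
    and w: "w = (u + n + s, u' + o' + \<phi> s)" by (rule gluedE)
  have "((t + u) + (p + n) + (r + s), (t' + u') + (q + o') + \<phi> (r + s)) \<in> W"
    using m m' by (intro gluedI) (simp_all add: subspace_add subspaces subspace_root_sum)
  moreover have "v + w = ((t + u) + (p + n) + (r + s), (t' + u') + (q + o') + \<phi> (r + s))"
    using m m' by (simp add: v w \<phi>_add algebra_simps)
  ultimately show "v + w \<in> W" by simp
next
  fix c w assume "w \<in> W"
  then obtain t p t' q r where m: "t \<in> tP" "p \<in> P" "t' \<in> tM" "q \<in> Q" "r \<in> rP"
    and w: "w = (t + p + r, t' + q + \<phi> r)" by (rule gluedE)
  have "(scale c t + scale c p + scale c r, scale c t' + scale c q + \<phi> (scale c r)) \<in> W"
    using m by (intro gluedI) (simp_all add: subspace_scale subspaces subspace_root_sum)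
  moreover have "prod_scale scale c w = (scale c t + scale c p + scale c r, scale c t' + scale c q + \<phi> (scale c r))"
    using m by (simp add: w prod_scale_def \<phi>_scale scale_right_distrib)
  ultimately show "prod_scale scale c w \<in> W" by simp
qed

text \<open>\<open>H\<close> is abelian, so the Cartan part of a bracket arises from opposite roots
  only. Consequently the bracket of two elements of \<open>W\<close> has no contribution from the
  graph of \<phi>.\<close>

lemma bracket_component:
  assumes S: "closed_roots H S" "contains_coroot_lines H S T" and T: "subspace T"
    and m: "a \<in> H" "p \<in> root_sum H S" "a' \<in> H" "p' \<in> root_sum H S"
  shows "bracket (a + p) (a' + p') \<in> T + root_sum H S"
proof -
  have sub: "S \<subseteq> roots H" using S(1) by (simp add: closed_roots_def)
  note V = subspace_plus[OF T subspace_root_sum[of S]]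
  have SV: "root_sum H S \<subseteq> T + root_sum H S" by (rule set_zero_plus2[OF subspace_0[OF T]])
  have "bracket (a + p) (a' + p') = bracket a p' - bracket a' p + bracket p p'"
    using H_abelian[OF m(1,3)] bracket_anticomm[of p a'] by (simp add: bracket_add_left bracket_add_right)
  moreover have "bracket a p' \<in> T + root_sum H S" "bracket a' p \<in> T + root_sum H S"
    using bracket_H_root_sum[OF sub] m SV by blast+
  moreover have "bracket p p' \<in> T + root_sum H S" by (rule bracket_root_sums[OF S(1) T S(2) m(2,4)])
  ultimately show ?thesis using subspace_add[OF V] subspace_diff[OF V] by simp
qed

lemma glued_closed:
  assumes "contains_coroot_lines H SP tP" "contains_coroot_lines H SM tM" "v \<in> W" "w \<in> W"
  shows "prod_bracket bracket v w \<in> W"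
proof -
  from \<open>v \<in> W\<close> obtain t p t' q r where m: "t \<in> tP" "p \<in> P" "t' \<in> tM" "q \<in> Q" "r \<in> rP"
    and v: "v = (t + p + r, t' + q + \<phi> r)" by (rule gluedE)
  from \<open>w \<in> W\<close> obtain u n u' o' s where m': "u \<in> tP" "n \<in> P" "u' \<in> tM" "o' \<in> Q" "s \<in> rP"
    and w: "w = (u + n + s, u' + o' + \<phi> s)" by (rule gluedE)
  have H: "t + r \<in> H" "t' + \<phi> r \<in> H" "u + s \<in> H" "u' + \<phi> s \<in> H"
    using m m' subset_H \<phi>_mem by (auto intro!: subspace_add[OF subspace_H])
  have "bracket ((t + r) + p) ((u + s) + n) \<in> tP + P"
    by (rule bracket_component[OF partition(3) assms(1) subspaces(1) H(1) m(2) H(3) m'(2)])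
  moreover have "bracket ((t' + \<phi> r) + q) ((u' + \<phi> s) + o') \<in> tM + Q"
    by (rule bracket_component[OF partition(4) assms(2) subspaces(2) H(2) m(4) H(4) m'(4)])
  ultimately have "(bracket ((t + r) + p) ((u + s) + n), bracket ((t' + \<phi> r) + q) ((u' + \<phi> s) + o')) \<in> W"
    by (rule gluedI_graph_zero)
  moreover have "prod_bracket bracket v w
      = (bracket ((t + r) + p) ((u + s) + n), bracket ((t' + \<phi> r) + q) ((u' + \<phi> s) + o'))"
    by (simp add: prod_bracket_def v w add.assoc add.commute add.left_commute)
  ultimately show ?thesis by simp
qed

lemma glued_H_unique:
  assumes "a \<in> H" "p \<in> P" "q \<in> Q" "a + p + q = 0"
  shows "a = 0" "p = 0" "q = 0"
  using root_decomposition_unique[OF partition(1,2) assms] by simp_all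

text \<open>Uniqueness of the root decomposition kills the Cartan part of the second coordinate;
  then the image of \<open>r\<close> lies in both \<open>tM\<close> and \<open>rM\<close>, and
  injectivity of \<phi> gives \<open>r = 0\<close>. So \<open>tP\<close> can be read off from
  \<open>W\<close>.\<close>

lemma glued_left_H:
  assumes "(h, 0) \<in> W" "h \<in> H"
  shows "h \<in> tP"
proof -
  from assms(1) obtain t p t' q r where m: "t \<in> tP" "p \<in> P" "t' \<in> tM" "q \<in> Q" "r \<in> rP"
    and w: "(h, 0) = (t + p + r, t' + q + \<phi> r)" by (rule gluedE)
  have "t' + \<phi> r \<in> H" using m subset_H \<phi>_mem by (auto intro!: subspace_add[OF subspace_H])
  then have "t' + \<phi> r = 0"
    using glued_H_unique(1)[OF _ zero_mem(4) m(4), of "t' + \<phi> r"] w by (simp add: algebra_simps)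
  then have "\<phi> r \<in> tM" using m(3) subspace_neg[OF subspaces(2)] by (simp add: add_eq_0_iff)
  then have "\<phi> r = 0" using trivial_Int(2) \<phi>_mem[OF m(5)] by blast
  then have r: "r = 0" using \<phi>_inj[OF m(5) zero_mem(3)] \<phi>_zero by simp
  have "t - h \<in> H" using m(1) subset_H assms(2) by (auto intro!: subspace_diff[OF subspace_H])
  then have "t - h = 0"
    using glued_H_unique(1)[OF _ m(2) zero_mem(5), of "t - h"] w r by simp
  then show ?thesis using m(1) by simp
qed

lemma glued_right_H:
  assumes "(0, h) \<in> W" "h \<in> H"
  shows "h \<in> tM"
proof -
  from assms(1) obtain t p t' q r where m: "t \<in> tP" "p \<in> P" "t' \<in> tM" "q \<in> Q" "r \<in> rP"
    and w: "(0, h) = (t + p + r, t' + q + \<phi> r)" by (rule gluedE)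
  have "t + r \<in> H" using m subset_H by (auto intro!: subspace_add[OF subspace_H])
  then have "t + r = 0"
    using glued_H_unique(1)[OF _ m(2) zero_mem(5), of "t + r"] w by (simp add: algebra_simps)
  then have "r \<in> tP" using m(1) subspace_neg[OF subspaces(1)] by (simp add: add_eq_0_iff)
  then have r: "r = 0" using trivial_Int(1) m(5) by blast
  have "t' - h \<in> H" using m(3) subset_H assms(2) by (auto intro!: subspace_diff[OF subspace_H])
  then have "t' - h = 0"
    using glued_H_unique(1)[OF _ zero_mem(4) m(4), of "t' - h"] w r \<phi>_zero by simp
  then show ?thesis using m(3) by simp
qed

text \<open>For necessity, opposite roots in \<open>SP\<close> put \<open>(x, 0)\<close> and
  \<open>(y, 0)\<close> into \<open>W\<close>, hence also \<open>([x, y], 0)\<close>, and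
  \<open>glued_left_H\<close> places \<open>[x, y]\<close> in \<open>tP\<close>. The other side is
  symmetric.\<close>

lemma glued_subalgebra_iff:
  "lie_algebra.lie_subalgebra (prod_scale scale) (prod_bracket bracket) W \<longleftrightarrow>
     contains_coroot_lines H SP tP \<and> contains_coroot_lines H SM tM"
proof
  assume W: "lie_algebra.lie_subalgebra (prod_scale scale) (prod_bracket bracket) W"
  have closed: "prod_bracket bracket v w \<in> W" if "v \<in> W" "w \<in> W" for v w
    using W that by (simp add: pair_subalgebra_iff)
  have opp: "bracket x y \<in> H" if "x \<in> root_space H \<alpha>" "y \<in> root_space H (\<lambda>h. - \<alpha> h)" for x y \<alpha>
    using that root_space_subset_weight_space bracket_opposite_in_H by blast
  show "contains_coroot_lines H SP tP \<and> contains_coroot_lines H SM tM"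
    unfolding contains_coroot_lines_def
  proof (intro conjI ballI impI)
    fix \<alpha> x y assume \<alpha>: "\<alpha> \<in> SP" "(\<lambda>h. - \<alpha> h) \<in> SP"
      and x: "x \<in> root_space H \<alpha>" and y: "y \<in> root_space H (\<lambda>h. - \<alpha> h)"
    have "x \<in> P" "y \<in> P" using \<alpha> x y root_space_subset_root_sum by blast+
    then have "(x, 0) \<in> W" "(y, 0) \<in> W"
      using gluedI_graph_zero P_subset Q_subset zero_mem(5) by (metis subsetD)+
    then have "(bracket x y, 0) \<in> W" using closed by (force simp: prod_bracket_def)
    then show "bracket x y \<in> tP" using glued_left_H opp[OF x y] by blast
  next
    fix \<alpha> x y assume \<alpha>: "\<alpha> \<in> SM" "(\<lambda>h. - \<alpha> h) \<in> SM"
      and x: "x \<in> root_space H \<alpha>" and y: "y \<in> root_space H (\<lambda>h. - \<alpha> h)"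
    have "x \<in> Q" "y \<in> Q" using \<alpha> x y root_space_subset_root_sum by blast+
    then have "(0, x) \<in> W" "(0, y) \<in> W"
      using gluedI_graph_zero P_subset Q_subset zero_mem(4) by (metis subsetD)+
    then have "(0, bracket x y) \<in> W" using closed by (force simp: prod_bracket_def)
    then show "bracket x y \<in> tM" using glued_right_H opp[OF x y] by blast
  qed
next
  assume "contains_coroot_lines H SP tP \<and> contains_coroot_lines H SM tM"
  then show "lie_algebra.lie_subalgebra (prod_scale scale) (prod_bracket bracket) W"
    using glued_closed subspace_glued by (simp add: pair_subalgebra_iff)
qed

section \<open>Complementarity to the diagonal\<close>

text \<open>
  \<open>W\<close> complements the diagonal iff \<open>(x, y) \<mapsto> x - y\<close> maps it bijectively onto the algebra;
  the root parts never obstruct this, and the Cartan part of the image is the following subspace.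
\<close>

definition cartan_difference :: "'g set" where
  "cartan_difference = tP + (tM + (\<lambda>r. r - \<phi> r) ` rP)"

text \<open>The hypothesis says that the identity minus \<phi> is injective on \<open>rP\<close>
  modulo \<open>tP + tM\<close>. Together with the trivial intersection of \<open>tP\<close> and
  \<open>tM\<close> this makes the three summands independent, so that dimensions add.\<close>

lemma cartan_difference:
  assumes "\<And>h. h \<in> rP \<Longrightarrow> \<phi> h - h \<in> tP + tM \<Longrightarrow> h = 0"
  shows "subspace cartan_difference" "cartan_difference \<subseteq> H"
    "dim cartan_difference = dim tP + dim tM + dim rP"
proof -
  interpret self: finite_dimensional_vector_space_pair_1 scale Basis scale by unfold_locales
  obtain \<Phi> where \<Phi>: "endo \<Phi>" "\<And>x. x \<in> rP \<Longrightarrow> \<Phi> x = \<phi> x"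
    using linear_on_extend[OF subspaces(3) iso] by blast
  define \<psi> where "\<psi> x = x - \<Phi> x" for x
  have \<psi>: "endo \<psi>" using \<Phi>(1) unfolding \<psi>_def by (simp add: endo_iff algebra_simps)
  have img: "(\<lambda>r. r - \<phi> r) ` rP = \<psi> ` rP" by (rule image_cong) (simp_all add: \<psi>_def \<Phi>(2))
  have sub\<psi>: "subspace (\<psi> ` rP)"
    using module_hom.subspace_image[OF endo_module_hom[OF \<psi>] subspaces(3)] .
  have key: "r = 0" if r: "r \<in> rP" "\<psi> r = t + t'" "t \<in> tP" "t' \<in> tM" for r t t'
  proof -
    have "\<phi> r - r = - t + - t'" using r(1,2) \<Phi>(2)[OF r(1)] by (simp add: \<psi>_def algebra_simps)
    moreover have "- t + - t' \<in> tP + tM" using r(3,4) subspaces subspace_neg by (intro set_plus_intro) auto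
    ultimately show ?thesis using assms[OF r(1)] by simp
  qed
  have "inj_on \<psi> (span rP)"
  proof -
    have "inj_on \<psi> rP"
    proof (rule inj_onI)
      fix x y assume xy: "x \<in> rP" "y \<in> rP" "\<psi> x = \<psi> y"
      then have "\<psi> (x - y) = 0 + 0" by (simp add: endo_diff[OF \<psi>])
      then have "x - y = 0" using key[of "x - y" 0 0] subspace_diff[OF subspaces(3)] xy zero_mem by simp
      then show "x = y" by simp
    qed
    then show ?thesis using subspaces(3) by (simp add: span_eq_iff[THEN iffD2])
  qed
  then have d1: "dim (\<psi> ` rP) = dim rP" using self.dim_image_eq[OF \<psi>] by simp
  have int1: "tM \<inter> \<psi> ` rP = {0}"
  proof (intro equalityI subsetI)
    fix x assume "x \<in> tM \<inter> \<psi> ` rP"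
    then obtain r where r: "x \<in> tM" "r \<in> rP" "x = \<psi> r" by blast
    then have "r = 0" using key[of r 0 x] zero_mem by simp
    then show "x \<in> {0}" using r(3) endo_zero[OF \<psi>] by simp
  next
    fix x assume "x \<in> {0 :: 'g}"
    then show "x \<in> tM \<inter> \<psi> ` rP" using zero_mem subspace_0[OF sub\<psi>] by simp
  qed
  have int2: "tP \<inter> (tM + \<psi> ` rP) = {0}"
  proof (intro equalityI subsetI)
    fix x assume x: "x \<in> tP \<inter> (tM + \<psi> ` rP)"
    then obtain t' r where r: "t' \<in> tM" "r \<in> rP" "x = t' + \<psi> r" by (auto elim!: set_plus_elim)
    then have "\<psi> r = x + - t'" by simp
    then have "r = 0" using key[OF r(2), of x "- t'"] x r(1) subspace_neg[OF subspaces(2)] by simp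
    then have "x \<in> tM" using r endo_zero[OF \<psi>] by simp
    then show "x \<in> {0}" using x trivial_Int(3) by blast
  next
    fix x assume "x \<in> {0 :: 'g}"
    then show "x \<in> tP \<inter> (tM + \<psi> ` rP)"
      using zero_mem subspace_0[OF subspace_plus[OF subspaces(2) sub\<psi>]] by simp
  qed
  show "subspace cartan_difference"
    unfolding cartan_difference_def img by (intro subspace_plus subspaces sub\<psi>)
  show "dim cartan_difference = dim tP + dim tM + dim rP"
    unfolding cartan_difference_def img
    using dim_direct_sum[OF subspaces(1) subspace_plus[OF subspaces(2) sub\<psi>] int2]
      dim_direct_sum[OF subspaces(2) sub\<psi> int1] d1 by simp
  show "cartan_difference \<subseteq> H"
  proof
    fix x assume "x \<in> cartan_difference"
    then obtain t t' r where "t \<in> tP" "t' \<in> tM" "r \<in> rP" "x = t + (t' + (r - \<phi> r))"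
      by (auto simp: cartan_difference_def elim!: set_plus_elim)
    then show "x \<in> H"
      using subset_H \<phi>_mem by (auto intro!: subspace_add[OF subspace_H] subspace_diff[OF subspace_H])
  qed
qed

text \<open>\<open>SP\<close> and \<open>SM\<close> share no root, so root parts of the two
  coordinates cannot cancel each other; a difference that lies in \<open>H\<close> has none.\<close>

lemma glued_difference:
  assumes "t \<in> tP" "p \<in> P" "t' \<in> tM" "q \<in> Q" "r \<in> rP" "h \<in> H"
    and "h = (t + p + r) - (t' + q + \<phi> r)"
  shows "h = t + (- t' + (r - \<phi> r))" "p = 0" "q = 0"
proof -
  let ?a = "t + (- t' + (r - \<phi> r)) - h"
  have "?a \<in> H"
    using assms(1,3,5,6) subset_H \<phi>_mem subspace_neg[OF subspace_H]
    by (auto intro!: subspace_add[OF subspace_H] subspace_diff[OF subspace_H])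
  moreover have "- q \<in> Q" using assms(4) subspace_neg[OF subspace_root_sum] by blast
  moreover have "?a + p + - q = 0" by (simp add: assms(7))
  ultimately have "?a = 0" "p = 0" "- q = 0" using glued_H_unique[OF _ assms(2), of ?a "- q"] by blast+
  then show "h = t + (- t' + (r - \<phi> r))" "p = 0" "q = 0" by simp_all
qed

lemma glued_direct_sum_iff:
  "is_direct_sum UNIV diagonal W \<longleftrightarrow> cartan_transversal H tP tM rP \<phi>"
proof
  assume W: "is_direct_sum UNIV diagonal W"
  have fix_free: "h = 0" if h: "h \<in> rP" "\<phi> h - h \<in> tP + tM" for h
  proof -
    obtain a b where ab: "\<phi> h - h = a + b" "a \<in> tP" "b \<in> tM" using h(2) by (auto elim!: set_plus_elim)
    have "- b \<in> tM" using ab(3) subspace_neg[OF subspaces(2)] by blast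
    \<comment> \<open>A fixed point modulo \<open>tP + tM\<close>, corrected by \<open>a\<close> on
      the left and \<open>- b\<close> on the right, becomes an element of \<open>W\<close> with
      equal coordinates.\<close>
    from gluedI[OF ab(2) zero_mem(4) this zero_mem(5) h(1)]
    have "(a + h, \<phi> h - b) \<in> W" by simp
    moreover have "\<phi> h - b = a + h" using ab(1) by (simp add: algebra_simps)
    ultimately have "(a + h, a + h) \<in> diagonal \<inter> W" by (simp add: diagonal_def)
    then have "a + h = 0" using W by (auto simp: is_direct_sum_def zero_prod_def)
    then have "h \<in> tP" using ab(2) subspace_neg[OF subspaces(1)] by (simp add: add_eq_0_iff)
    then show "h = 0" using trivial_Int(1) h(1) by blast
  qed
  note X = cartan_difference[OF fix_free]
  have "H \<subseteq> cartan_difference"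
  proof
    fix h assume h: "h \<in> H"
    \<comment> \<open>Adding a diagonal element preserves the coordinate difference, so
      \<open>h\<close> is the difference of an element of \<open>W\<close>.\<close>
    have "(h, 0) \<in> diagonal + W" using W by (auto simp: is_direct_sum_def)
    then obtain c w where cw: "(h, 0) = (c, c) + w" "w \<in> W" by (auto simp: diagonal_def elim!: set_plus_elim)
    from cw(2) obtain t p t' q r where m: "t \<in> tP" "p \<in> P" "t' \<in> tM" "q \<in> Q" "r \<in> rP"
      and w: "w = (t + p + r, t' + q + \<phi> r)" by (rule gluedE)
    have "h = (t + p + r) - (t' + q + \<phi> r)" using cw(1) by (simp add: w add_eq_0_iff)
    then have "h = t + (- t' + (r - \<phi> r))" by (rule glued_difference(1)[OF m h])
    moreover have "- t' \<in> tM" using m(3) subspace_neg[OF subspaces(2)] by blast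
    moreover have "r - \<phi> r \<in> (\<lambda>r. r - \<phi> r) ` rP" using m(5) by blast
    ultimately show "h \<in> cartan_difference"
      unfolding cartan_difference_def using m(1) by (simp only: set_plus_intro)
  qed
  then have "cartan_difference = H" using X(2) by blast
  then have "dim tP + dim tM + dim rP = dim H" using X(3) by simp
  then show "cartan_transversal H tP tM rP \<phi>" using fix_free by (simp add: cartan_transversal_def)
next
  assume "cartan_transversal H tP tM rP \<phi>"
  then have dims: "dim tP + dim tM + dim rP = dim H"
    and fix_free: "\<And>h. h \<in> rP \<Longrightarrow> \<phi> h - h \<in> tP + tM \<Longrightarrow> h = 0"
    by (auto simp: cartan_transversal_def)
  note X = cartan_difference[OF fix_free]
  have XH: "cartan_difference = H"
    using subspace_dim_equal[OF X(1) subspace_H X(2)] X(3) dims by simp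
  have "diagonal \<inter> W \<subseteq> {0}"
  proof
    fix w assume "w \<in> diagonal \<inter> W"
    then obtain z where z: "w = (z, z)" "(z, z) \<in> W" by (auto simp: diagonal_def)
    from z(2) obtain t p t' q r where m: "t \<in> tP" "p \<in> P" "t' \<in> tM" "q \<in> Q" "r \<in> rP"
      and w: "(z, z) = (t + p + r, t' + q + \<phi> r)" by (rule gluedE)
    have "t + p + r = t' + q + \<phi> r" using w by (metis prod.inject)
    then have d: "0 = (t + p + r) - (t' + q + \<phi> r)" by simp
    note g = glued_difference[OF m subspace_0[OF subspace_H] d]
    have "\<phi> r - r = t + - t'" using g(1) by (simp add: algebra_simps)
    moreover have "- t' \<in> tM" using m(3) subspace_neg[OF subspaces(2)] by blast
    ultimately have r: "r = 0" using fix_free[OF m(5)] m(1) by (metis set_plus_intro)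
    then have "t = t'" using g(1) \<phi>_zero by simp
    then have "t = 0" using trivial_Int(3) m(1,3) by blast
    then have "z = 0" using w r g(2) by (metis add.right_neutral prod.inject)
    then show "w \<in> {0}" using z(1) by (simp add: zero_prod_def)
  qed
  moreover have "0 \<in> W" using subspace_glued by (simp add: pair_subspace_iff)
  then have "0 \<in> diagonal \<inter> W" by (auto simp: diagonal_def zero_prod_def)
  moreover have "(a, b) \<in> diagonal + W" for a b
  proof -
    obtain h p q where hpq: "h \<in> H" "p \<in> P" "q \<in> Q" "a - b = h + p + q"
      using root_decomposition_sum[OF partition(1), of "a - b"] by blast
    obtain t t' r where m: "t \<in> tP" "t' \<in> tM" "r \<in> rP" "h = t + (t' + (r - \<phi> r))"
      using hpq(1) unfolding XH[symmetric] cartan_difference_def by (auto elim!: set_plus_elim)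
    \<comment> \<open>\<open>t'\<close> and \<open>q\<close> change sign because the second
      coordinate enters the difference negatively; what then remains of \<open>(a, b)\<close> is the
      diagonal pair of \<open>?c\<close>.\<close>
    have mw: "(t + p + r, - t' + - q + \<phi> r) \<in> W"
      using m hpq subspace_neg[OF subspaces(2)] subspace_neg[OF subspace_root_sum] by (intro gluedI)
    let ?c = "a - (t + p + r)"
    have "b = ?c + (- t' + - q + \<phi> r)" using hpq(4) m(4) by (simp add: algebra_simps)
    then have "(a, b) = (?c, ?c) + (t + p + r, - t' + - q + \<phi> r)" by simp
    moreover have "(?c, ?c) \<in> diagonal" by (simp add: diagonal_def)
    ultimately show ?thesis using mw by (simp only: set_plus_intro)
  qed
  ultimately show "is_direct_sum UNIV diagonal W" by (auto simp: is_direct_sum_def)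
qed

end

subsection \<open>Stable subalgebras complementary to the diagonal\<close>

locale diagonal_complement = cartan_pair scale bracket Basis H
  for scale :: "'f::{alg_closed_field, field_char_0} \<Rightarrow> 'g::ab_group_add \<Rightarrow> 'g"
    and bracket :: "'g \<Rightarrow> 'g \<Rightarrow> 'g" and Basis :: "'g set" and H :: "'g set" +
  fixes W :: "('g \<times> 'g) set"
  assumes subalgebra: "lie_algebra.lie_subalgebra (prod_scale scale) (prod_bracket bracket) W"
    and stable: "diagonally_stable H W"
    and complement: "is_direct_sum UNIV diagonal W"
begin

interpretation pair: lie_algebra "prod_scale scale" "prod_bracket bracket"
  by (rule lie_algebra_prod)

interpretation pair: linear_space "prod_scale scale"
  by unfold_locales

lemma subspace_W: "module.subspace (prod_scale scale) W"
  using subalgebra by (simp add: pair_subalgebra_iff)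

lemma W_zero: "(0, 0) \<in> W"
  using subspace_W by (simp add: pair_subspace_iff zero_prod_def)

lemma W_add: "(x, y) \<in> W \<Longrightarrow> (x', y') \<in> W \<Longrightarrow> (x + x', y + y') \<in> W"
  using subspace_W unfolding pair_subspace_iff by (metis add_Pair)

lemma W_scale: "(x, y) \<in> W \<Longrightarrow> (scale c x, scale c y) \<in> W"
  using subspace_W unfolding pair_subspace_iff by (metis prod_scale_def fst_conv snd_conv)

lemma W_diff: "(x, y) \<in> W \<Longrightarrow> (x', y') \<in> W \<Longrightarrow> (x - x', y - y') \<in> W"
  using W_add[of x y "scale (-1) x'" "scale (-1) y'"] W_scale[of x' y' "-1"] by simp

lemma W_bracket: "(x, y) \<in> W \<Longrightarrow> (x', y') \<in> W \<Longrightarrow> (bracket x x', bracket y y') \<in> W"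
proof -
  assume "(x, y) \<in> W" "(x', y') \<in> W"
  then have "prod_bracket bracket (x, y) (x', y') \<in> W" using subalgebra by (simp add: pair_subalgebra_iff)
  then show ?thesis by (simp add: prod_bracket_def)
qed

lemma W_diagonal: "(x, x) \<in> W \<Longrightarrow> x = 0"
proof -
  assume "(x, x) \<in> W"
  then have "(x, x) \<in> diagonal \<inter> W" by (simp add: diagonal_def)
  moreover have "diagonal \<inter> W = {0}" using complement by (simp add: is_direct_sum_def)
  ultimately show ?thesis by (simp add: zero_prod_def)
qed

text \<open>Under the diagonal action of \<open>H\<close> the square has the weight spaces
  \<open>weight_space \<gamma> \<times> weight_space \<gamma>\<close>, so
  \<open>weight_components_mem\<close> applies with \<open>W\<close> as the stable subspace.\<close>

lemma W_components:
  assumes "\<And>\<gamma>. \<gamma> \<in> root_index \<Longrightarrow> x \<gamma> \<in> weight_space \<gamma>" "\<And>\<gamma>. \<gamma> \<in> root_index \<Longrightarrow> y \<gamma> \<in> weight_space \<gamma>"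
    and "(\<Sum>\<gamma>\<in>root_index. x \<gamma>, \<Sum>\<gamma>\<in>root_index. y \<gamma>) \<in> W" and "\<gamma> \<in> root_index"
  shows "(x \<gamma>, y \<gamma>) \<in> W"
proof -
  let ?T = "\<lambda>h. prod_bracket bracket (h, h)" and ?V = "\<lambda>\<gamma>. weight_space \<gamma> \<times> weight_space \<gamma>"
  have "\<forall>\<gamma>\<in>root_index. (x \<gamma>, y \<gamma>) \<in> W"
  proof (rule pair.weight_components_mem[OF finite_root_index subspace_W, where I = H and T = ?T and V = ?V])
    show "?T h ` W \<subseteq> W" if "h \<in> H" for h using stable that unfolding diagonally_stable_def by blast
    show "pair.endo (?T h)" for h
      by (simp add: pair.endo_iff pair.bracket_add_right pair.bracket_scale_right)
    show "?T h ` ?V \<gamma> \<subseteq> ?V \<gamma>" if "h \<in> H" for h \<gamma>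
      using bracket_H_weight_space[OF that] by (auto simp: prod_bracket_def)
    show "pair.subspace (?V \<gamma>)" for \<gamma>
      using subspace_0[OF subspace_weight_space] subspace_add[OF subspace_weight_space] subspace_scale[OF subspace_weight_space]
      by (auto simp: pair_subspace_iff prod_scale_def zero_prod_def)
    show "?V \<gamma> \<subseteq> pair.gen_eigenspace (?T h) (\<gamma> h)" if "\<gamma> \<in> root_index" "h \<in> H" for \<gamma> h
    proof
      fix v assume "v \<in> ?V \<gamma>"
      then have "?T h v = prod_scale scale (\<gamma> h) v"
        using bracket_root_index[OF that] by (auto simp: prod_bracket_def prod_scale_def)
      then have "((\<lambda>v. ?T h v - prod_scale scale (\<gamma> h) v) ^^ 1) v = 0" by simp
      then show "v \<in> pair.gen_eigenspace (?T h) (\<gamma> h)" unfolding pair.gen_eigenspace_def by blast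
    qed
    show "(\<Sum>\<gamma>\<in>root_index. (x \<gamma>, y \<gamma>)) \<in> W" using assms(3) by (simp add: sum_prod)
  qed (use assms(1,2) root_index_separated in auto)
  then show ?thesis using assms(4) by blast
qed

text \<open>As the diagonal and \<open>W\<close> together give everything, coordinate differences of
  \<open>W\<close> exhaust the algebra; passing to components makes this true in each weight
  separately.\<close>

lemma W_difference:
  assumes "\<gamma> \<in> root_index" "z \<in> weight_space \<gamma>"
  obtains u v where "(u, v) \<in> W" "u \<in> weight_space \<gamma>" "v \<in> weight_space \<gamma>" "u - v = z"
proof -
  have "(z, 0) \<in> diagonal + W" using complement by (auto simp: is_direct_sum_def)
  then obtain d w where dw: "(z, 0) = d + w" "d \<in> diagonal" "w \<in> W" by (rule set_plus_elim)
  obtain c where d: "d = (c, c)" using dw(2) by (auto simp: diagonal_def)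
  obtain a b where w: "w = (a, b)" by (cases w)
  have ab: "a - b = z" using dw(1) by (simp add: d w add_eq_0_iff)
  obtain x where x: "\<And>\<delta>. \<delta> \<in> root_index \<Longrightarrow> x \<delta> \<in> weight_space \<delta>" "a = (\<Sum>\<delta>\<in>root_index. x \<delta>)"
    using root_index_sum by blast
  obtain y where y: "\<And>\<delta>. \<delta> \<in> root_index \<Longrightarrow> y \<delta> \<in> weight_space \<delta>" "b = (\<Sum>\<delta>\<in>root_index. y \<delta>)"
    using root_index_sum by blast
  define s where "s \<delta> = x \<delta> - y \<delta> - (if \<delta> = \<gamma> then z else 0)" for \<delta>
  have "(\<Sum>\<delta>\<in>root_index. s \<delta>) = 0"
    using ab assms(1) finite_root_index by (simp add: s_def sum_subtractf x(2) y(2))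
  moreover have "\<forall>\<delta>\<in>root_index. s \<delta> \<in> weight_space \<delta>"
    using x(1) y(1) assms(2) subspace_diff[OF subspace_weight_space] subspace_0[OF subspace_weight_space]
    by (simp add: s_def)
  ultimately have "s \<gamma> = 0" using root_index_indep assms(1) unfolding indep_family_def by blast
  then have "x \<gamma> - y \<gamma> = z" by (simp add: s_def)
  moreover have "(x \<gamma>, y \<gamma>) \<in> W"
    using W_components[of x y, OF x(1) y(1) _ assms(1)] dw(3) w x(2) y(2) by simp
  ultimately show thesis using that x(1) y(1) assms(1) by blast
qed

lemma W_H_difference:
  assumes "h \<in> H"
  obtains h1 h2 where "(h1, h2) \<in> W" "h1 \<in> H" "h2 \<in> H" "h1 - h2 = h"
  using W_difference[of "\<lambda>_. 0" h] assms by (auto simp: root_index_def weight_space_zero)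

section \<open>The root part of \<open>W\<close>\<close>

definition left_roots :: "('g \<Rightarrow> 'f) set" where
  "left_roots = {\<alpha> \<in> roots H. \<forall>x\<in>weight_space \<alpha>. (x, 0) \<in> W}"

definition right_roots :: "('g \<Rightarrow> 'f) set" where
  "right_roots = {\<alpha> \<in> roots H. \<forall>x\<in>weight_space \<alpha>. (0, x) \<in> W}"

lemma root_weight_space_line:
  assumes "\<alpha> \<in> roots H"
  obtains e where "e \<noteq> 0" "weight_space \<alpha> = span {e}"
proof -
  obtain e where e: "e \<noteq> 0" "e \<in> root_space H \<alpha>" using root_vector_exists[OF roots_weights[OF assms]] .
  then have "weight_space \<alpha> = span {e}"
    using weight_space_line[OF roots_weights[OF assms] roots_nonzero[OF assms]] root_space_eq[OF assms] by simp
  then show thesis using that e(1) by blast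
qed

text \<open>
  Pairs \<open>(h1, h2) \<in> W\<close> with \<open>h1 - h2\<close> arbitrary act on \<open>(u, v) \<in> W\<close> from the root spaces with the
  eigenvalues \<open>\<alpha> h1\<close> and \<open>\<alpha> h2\<close>; if these differ, \<open>W\<close> contains \<open>(u, 0)\<close> and \<open>(0, v)\<close>.
\<close>

lemma root_left_or_right:
  assumes \<alpha>: "\<alpha> \<in> roots H"
  shows "\<alpha> \<in> left_roots \<or> \<alpha> \<in> right_roots"
proof -
  have \<alpha>i: "\<alpha> \<in> root_index" "\<alpha> \<in> weights" using \<alpha> roots_weights by (simp_all add: root_index_def)
  obtain e where e: "e \<noteq> 0" "weight_space \<alpha> = span {e}" using root_weight_space_line[OF \<alpha>] .
  have "e \<in> weight_space \<alpha>" using e(2) span_base by simp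
  then obtain u v where uv: "(u, v) \<in> W" "u \<in> weight_space \<alpha>" "v \<in> weight_space \<alpha>" "u - v = e"
    using W_difference[OF \<alpha>i(1)] by metis
  obtain h0 where h0: "h0 \<in> H" "\<alpha> h0 \<noteq> 0"
  proof -
    have "\<exists>h\<in>H. \<alpha> h \<noteq> (\<lambda>_. 0) h"
      by (rule root_index_separated[OF \<alpha>i(1)]) (use roots_nonzero[OF \<alpha>] in \<open>auto simp: root_index_def\<close>)
    then show thesis using that by blast
  qed
  obtain h1 h2 where h: "(h1, h2) \<in> W" "h1 \<in> H" "h2 \<in> H" "h1 - h2 = h0"
    using W_H_difference[OF h0(1)] .
  have "\<alpha> h1 = \<alpha> (h0 + h2)" unfolding h(4)[symmetric] by simp
  then have ne: "\<alpha> h1 - \<alpha> h2 \<noteq> 0" using weight_linear(1)[OF \<alpha>i(2) h0(1) h(3)] h0(2) by simp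
  have act: "(scale (\<alpha> h1) u, scale (\<alpha> h2) v) \<in> W"
    using W_bracket[OF h(1) uv(1)] bracket_root_index[OF \<alpha>i(1) h(2) uv(2)] bracket_root_index[OF \<alpha>i(1) h(3) uv(3)]
    by simp
  have "(scale (\<alpha> h1 - \<alpha> h2) u, 0) \<in> W"
    using W_diff[OF act W_scale[OF uv(1), of "\<alpha> h2"]] by (simp add: scale_left_diff_distrib)
  from W_scale[OF this, of "inverse (\<alpha> h1 - \<alpha> h2)"] have u: "(u, 0) \<in> W" using ne by simp
  have v: "(0, v) \<in> W" using W_diff[OF uv(1) u] by simp
  \<comment> \<open>Since \<open>u - v = e\<close> is nonzero, at least one of \<open>u\<close> and
    \<open>v\<close> spans the line.\<close>
  show ?thesis
  proof (cases "u = 0")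
    case False
    then have "weight_space \<alpha> = span {u}"
      using weight_space_line[OF \<alpha>i(2) roots_nonzero[OF \<alpha>] uv(2)] by simp
    then have "\<alpha> \<in> left_roots"
      using \<alpha> W_scale[OF u] by (auto simp: left_roots_def span_singleton)
    then show ?thesis ..
  next
    case True
    then have "v \<noteq> 0" using uv(4) e(1) by auto
    then have "weight_space \<alpha> = span {v}"
      using weight_space_line[OF \<alpha>i(2) roots_nonzero[OF \<alpha>] uv(3)] by simp
    then have "\<alpha> \<in> right_roots"
      using \<alpha> W_scale[OF v] by (auto simp: right_roots_def span_singleton)
    then show ?thesis ..
  qed
qed

lemma left_right_disjoint: "left_roots \<inter> right_roots = {}"
proof -
  have False if \<alpha>: "\<alpha> \<in> left_roots" "\<alpha> \<in> right_roots" for \<alpha>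
  proof -
    have "\<alpha> \<in> roots H" using \<alpha>(1) by (simp add: left_roots_def)
    then obtain e where e: "e \<noteq> 0" "weight_space \<alpha> = span {e}" using root_weight_space_line by metis
    have "e \<in> weight_space \<alpha>" using e(2) span_base by simp
    then have "(e, 0) \<in> W" "(0, e) \<in> W" using \<alpha> by (auto simp: left_roots_def right_roots_def)
    then have "(e, e) \<in> W" using W_add by fastforce
    then show False using W_diagonal e(1) by blast
  qed
  then show ?thesis by blast
qed

lemma root_sum_generator:
  assumes "\<alpha> \<in> roots H" "\<beta> \<in> roots H" "(\<lambda>h. \<alpha> h + \<beta> h) \<in> roots H"
  obtains x z where "x \<in> weight_space \<alpha>" "z \<in> weight_space \<beta>"
    "weight_space (\<lambda>h. \<alpha> h + \<beta> h) = span {bracket x z}"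
proof -
  obtain x z where xz: "x \<in> weight_space \<alpha>" "z \<in> weight_space \<beta>" "bracket x z \<noteq> 0"
    using bracket_root_spaces_nonzero[OF roots_weights[OF assms(1)] roots_nonzero[OF assms(1)]
        roots_weights[OF assms(2)] roots_weights[OF assms(3)]] by blast
  have "weight_space (\<lambda>h. \<alpha> h + \<beta> h) = span {bracket x z}"
    by (rule weight_space_line[OF roots_weights[OF assms(3)] roots_nonzero[OF assms(3)]
          bracket_weight_space[OF xz(1,2)] xz(3)])
  then show thesis using that xz(1,2) by blast
qed

text \<open>\<open>f\<close> stands for either embedding of the algebra into its square. A nonzero
  bracket generates the line of the sum of two roots, so one bracket in \<open>W\<close> brings in
  that whole line.\<close>

lemma closed_roots_embedded:
  assumes br: "\<And>x z. f x \<in> W \<Longrightarrow> f z \<in> W \<Longrightarrow> f (bracket x z) \<in> W"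
    and sc: "\<And>c x. f x \<in> W \<Longrightarrow> f (scale c x) \<in> W"
  shows "closed_roots H {\<alpha> \<in> roots H. \<forall>x\<in>weight_space \<alpha>. f x \<in> W}" (is "closed_roots H ?S")
  unfolding closed_roots_def
proof (intro conjI ballI impI)
  fix \<alpha> \<beta> assume \<alpha>: "\<alpha> \<in> ?S" and \<beta>: "\<beta> \<in> ?S" and s: "(\<lambda>h. \<alpha> h + \<beta> h) \<in> roots H"
  have "\<alpha> \<in> roots H" "\<beta> \<in> roots H" using \<alpha> \<beta> by auto
  then obtain x z where xz: "x \<in> weight_space \<alpha>" "z \<in> weight_space \<beta>"
    "weight_space (\<lambda>h. \<alpha> h + \<beta> h) = span {bracket x z}" by (rule root_sum_generator[OF _ _ s])
  have "f (bracket x z) \<in> W" using xz \<alpha> \<beta> by (intro br) auto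
  then show "(\<lambda>h. \<alpha> h + \<beta> h) \<in> ?S" using s sc by (auto simp: xz(3) span_singleton)
qed auto

lemma closed_left_roots: "closed_roots H left_roots"
  unfolding left_roots_def
  by (rule closed_roots_embedded) (use W_bracket[of _ 0 _ 0] W_scale[of _ 0] in auto)

lemma closed_right_roots: "closed_roots H right_roots"
  unfolding right_roots_def
  by (rule closed_roots_embedded) (use W_bracket[of 0 _ 0] W_scale[of 0] in auto)

lemma regular_left_right: "regular_partition H left_roots right_roots"
  unfolding regular_partition_def
  using root_left_or_right left_right_disjoint closed_left_roots closed_right_roots
  by (auto simp: closed_roots_def)

text \<open>Goursat data of the intersection of \<open>W\<close> with \<open>H \<times> H\<close>:
  \<open>sL\<close> and \<open>sR\<close> are its projections, \<open>tL\<close> and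
  \<open>tR\<close> the fibres over 0.\<close>

definition "sL = {h \<in> H. \<exists>k\<in>H. (h, k) \<in> W}"
definition "sR = {k \<in> H. \<exists>h\<in>H. (h, k) \<in> W}"
definition "tL = {h \<in> H. (h, 0) \<in> W}"
definition "tR = {k \<in> H. (0, k) \<in> W}"

lemma Cartan_subspaces: "subspace sL" "subspace sR" "subspace tL" "subspace tR"
proof -
  note H = subspace_0[OF subspace_H] subspace_add[OF subspace_H] subspace_scale[OF subspace_H]
  show "subspace sL"
    by (rule subspaceI) (unfold sL_def, (blast intro: H W_zero W_add W_scale)+)
  show "subspace sR"
    by (rule subspaceI) (unfold sR_def, (blast intro: H W_zero W_add W_scale)+)
  show "subspace tL"
    using H W_zero W_add[of _ 0 _ 0] W_scale[of _ 0] by (intro subspaceI) (auto simp: tL_def)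
  show "subspace tR"
    using H W_zero W_add[of 0 _ 0] W_scale[of 0] by (intro subspaceI) (auto simp: tR_def)
qed

text \<open>Between complements \<open>rL\<close> of \<open>tL\<close> and \<open>rR\<close> of
  \<open>tR\<close>, membership in \<open>W\<close> is a one-to-one relation: two partners of the
  same vector differ by an element of a fibre, which meets the complement only in 0. A fixed point
  of the resulting map would give a diagonal element of \<open>W\<close>.\<close>

lemma gluing_exists:
  obtains rL rR \<phi> where "gluing_datum H sL sR tL tR rL rR \<phi>" "\<And>h. h \<in> rL \<Longrightarrow> (h, \<phi> h) \<in> W"
proof -
  have HW: "(0, 0) \<in> W" "0 \<in> H" using W_zero subspace_0[OF subspace_H] by auto
  have "tL \<subseteq> sL" "tR \<subseteq> sR" using HW by (auto simp: tL_def tR_def sL_def sR_def)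
  obtain rL where rL: "subspace rL" "sL = tL + rL" "tL \<inter> rL = {0}"
    using complement_exists[OF Cartan_subspaces(3,1) \<open>tL \<subseteq> sL\<close>] .
  obtain rR where rR: "subspace rR" "sR = tR + rR" "tR \<inter> rR = {0}"
    using complement_exists[OF Cartan_subspaces(4,2) \<open>tR \<subseteq> sR\<close>] .
  have rLs: "rL \<subseteq> sL" unfolding rL(2) by (rule set_zero_plus2[OF subspace_0[OF Cartan_subspaces(3)]])
  have rRs: "rR \<subseteq> sR" unfolding rR(2) by (rule set_zero_plus2[OF subspace_0[OF Cartan_subspaces(4)]])
  have sH: "sL \<subseteq> H" "sR \<subseteq> H" by (auto simp: sL_def sR_def)
  have ex: "\<exists>k\<in>rR. (h, k) \<in> W" if h: "h \<in> rL" for h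
  proof -
    obtain k where k: "k \<in> H" "(h, k) \<in> W" using h rLs by (auto simp: sL_def)
    have "h \<in> H" using h rLs sH by blast
    then have "k \<in> tR + rR" using k rR(2) by (auto simp: sR_def)
    then obtain t r where tr: "k = t + r" "t \<in> tR" "r \<in> rR" by (rule set_plus_elim)
    have "(0, t) \<in> W" using tr(2) by (simp add: tR_def)
    \<comment> \<open>Subtracting the fibre part moves the partner into the chosen complement
      without leaving \<open>W\<close>.\<close>
    from W_diff[OF k(2) this] have "(h, r) \<in> W" by (simp add: tr(1))
    then show ?thesis using tr(3) by blast
  qed
  have uniq: "k = k'" if "(h, k) \<in> W" "(h, k') \<in> W" "k \<in> rR" "k' \<in> rR" for h k k'
  proof -
    have "k - k' \<in> rR" using that subspace_diff[OF rR(1)] by blast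
    moreover have "(0, k - k') \<in> W" using W_diff[OF that(1,2)] by simp
    moreover have "k - k' \<in> H" using \<open>k - k' \<in> rR\<close> rRs sH by blast
    ultimately have "k - k' \<in> tR \<inter> rR" by (simp add: tR_def)
    then show ?thesis using rR(3) by simp
  qed
  have uniqL: "h = h'" if "(h, k) \<in> W" "(h', k) \<in> W" "h \<in> rL" "h' \<in> rL" for h h' k
  proof -
    have "h - h' \<in> rL" using that subspace_diff[OF rL(1)] by blast
    moreover have "(h - h', 0) \<in> W" using W_diff[OF that(1,2)] by simp
    moreover have "h - h' \<in> H" using \<open>h - h' \<in> rL\<close> rLs sH by blast
    ultimately have "h - h' \<in> tL \<inter> rL" by (simp add: tL_def)
    then show ?thesis using rL(3) by simp
  qed
  obtain \<phi> where \<phi>: "\<And>h. h \<in> rL \<Longrightarrow> \<phi> h \<in> rR" "\<And>h. h \<in> rL \<Longrightarrow> (h, \<phi> h) \<in> W"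
    using ex by metis
  have "linear_iso_on rL rR \<phi>"
    unfolding linear_iso_on_def
  proof (intro conjI ballI allI)
    show "bij_betw \<phi> rL rR"
      unfolding bij_betw_def
    proof
      show "inj_on \<phi> rL"
        using uniqL \<phi>(2) by (intro inj_onI) metis
      show "\<phi> ` rL = rR"
      proof (intro equalityI subsetI)
        fix k assume "k \<in> \<phi> ` rL"
        then show "k \<in> rR" using \<phi>(1) by blast
      next
        fix k assume k: "k \<in> rR"
        then obtain h where h: "h \<in> H" "(h, k) \<in> W" using rRs by (auto simp: sR_def)
        have "k \<in> H" using k rRs sH by blast
        then have "h \<in> tL + rL" using h rL(2) by (auto simp: sL_def)
        then obtain t r where tr: "h = t + r" "t \<in> tL" "r \<in> rL" by (rule set_plus_elim)
        have "(t, 0) \<in> W" using tr(2) by (simp add: tL_def)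
        from W_diff[OF h(2) this] have "(r, k) \<in> W" by (simp add: tr(1))
        then have "\<phi> r = k" using uniq[OF \<phi>(2)[OF tr(3)] _ \<phi>(1)[OF tr(3)] k] by blast
        then show "k \<in> \<phi> ` rL" using tr(3) by blast
      qed
    qed
    \<comment> \<open>Both sides are partners in \<open>rR\<close> of one vector, so linearity
      follows from uniqueness.\<close>
    show "\<phi> (x + y) = \<phi> x + \<phi> y" if x: "x \<in> rL" and y: "y \<in> rL" for x y
    proof (rule uniq)
      have xy: "x + y \<in> rL" by (rule subspace_add[OF rL(1) x y])
      show "(x + y, \<phi> (x + y)) \<in> W" "\<phi> (x + y) \<in> rR" using \<phi> xy by blast+
      show "(x + y, \<phi> x + \<phi> y) \<in> W" by (rule W_add[OF \<phi>(2)[OF x] \<phi>(2)[OF y]])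
      show "\<phi> x + \<phi> y \<in> rR" by (rule subspace_add[OF rR(1) \<phi>(1)[OF x] \<phi>(1)[OF y]])
    qed
    show "\<phi> (scale c x) = scale c (\<phi> x)" if x: "x \<in> rL" for c x
    proof (rule uniq)
      have cx: "scale c x \<in> rL" by (rule subspace_scale[OF rL(1) x])
      show "(scale c x, \<phi> (scale c x)) \<in> W" "\<phi> (scale c x) \<in> rR" using \<phi> cx by blast+
      show "(scale c x, scale c (\<phi> x)) \<in> W" by (rule W_scale[OF \<phi>(2)[OF x]])
      show "scale c (\<phi> x) \<in> rR" by (rule subspace_scale[OF rR(1) \<phi>(1)[OF x]])
    qed
  qed
  moreover have "H = sL + sR"
  proof (intro equalityI subsetI)
    fix h assume "h \<in> H"
    then obtain h1 h2 where h: "(h1, h2) \<in> W" "h1 \<in> H" "h2 \<in> H" "h1 - h2 = h"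
      by (rule W_H_difference)
    have "h1 \<in> sL" "h2 \<in> sR" using h by (auto simp: sL_def sR_def)
    then have "h1 + - h2 \<in> sL + sR" using subspace_neg[OF Cartan_subspaces(2)] by (intro set_plus_intro)
    then show "h \<in> sL + sR" using h(4) by simp
  next
    fix h assume "h \<in> sL + sR"
    then show "h \<in> H" using sH subspace_add[OF subspace_H] by (auto elim!: set_plus_elim)
  qed
  moreover have "tL \<inter> tR = {0}"
  proof (intro equalityI subsetI)
    fix h assume "h \<in> tL \<inter> tR"
    then have "(h, 0) \<in> W" "(0, h) \<in> W" by (auto simp: tL_def tR_def)
    then have "(h, h) \<in> W" using W_add by fastforce
    then show "h \<in> {0}" using W_diagonal by simp
  qed (use HW in \<open>auto simp: tL_def tR_def\<close>)
  moreover have "h = 0" if "h \<in> rL" "\<phi> h = h" for h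
    using \<phi>(2)[OF that(1)] that(2) W_diagonal by simp
  ultimately have "gluing_datum H sL sR tL tR rL rR \<phi>"
    unfolding gluing_datum_def is_direct_sum_def
    using Cartan_subspaces(3,4) rL rR sH by blast
  then show thesis using that \<phi>(2) by blast
qed

text \<open>The glued subspace lies in \<open>W\<close> because its generators do. Conversely,
  \<open>W\<close> is recovered component by component: the zero component by the gluing, each root
  component by the side to which the root belongs.\<close>

lemma classification:
  "\<exists>SP SM sP sM tP tM rP rM \<phi>. regular_partition H SP SM \<and>
     gluing_datum H sP sM tP tM rP rM \<phi> \<and> W = glued_subspace H SP SM tP tM rP \<phi>"
proof -
  obtain rL rR \<phi> where datum: "gluing_datum H sL sR tL tR rL rR \<phi>" and graph: "\<And>h. h \<in> rL \<Longrightarrow> (h, \<phi> h) \<in> W"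
    by (rule gluing_exists) blast
  interpret g: glued_datum scale bracket Basis H left_roots right_roots sL sR tL tR rL rR \<phi>
    by unfold_locales (rule regular_left_right, rule datum)
  have "g.W \<subseteq> W"
  proof
    fix w assume "w \<in> g.W"
    then obtain t p t' q r where m: "t \<in> tL" "p \<in> g.P" "t' \<in> tR" "q \<in> g.Q" "r \<in> rL"
      and w: "w = (t + p + r, t' + q + \<phi> r)" by (rule g.gluedE)
    have "(p, 0) \<in> W" if "p \<in> g.P" for p
      using that unfolding root_sum_def
    proof (induction p rule: span_induct_alt)
      case (step c x y)
      then obtain \<alpha> where "\<alpha> \<in> left_roots" "x \<in> root_space H \<alpha>" by blast
      then have "(x, 0) \<in> W" using root_space_eq[of \<alpha>] by (auto simp: left_roots_def)
      then show ?case using W_add[OF W_scale step(2)] by fastforce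
    qed (rule W_zero)
    moreover have "(0, q) \<in> W" if "q \<in> g.Q" for q
      using that unfolding root_sum_def
    proof (induction q rule: span_induct_alt)
      case (step c x y)
      then obtain \<alpha> where "\<alpha> \<in> right_roots" "x \<in> root_space H \<alpha>" by blast
      then have "(0, x) \<in> W" using root_space_eq[of \<alpha>] by (auto simp: right_roots_def)
      then show ?case using W_add[OF W_scale step(2)] by fastforce
    qed (rule W_zero)
    moreover have "(t, 0) \<in> W" "(0, t') \<in> W" using m by (auto simp: tL_def tR_def)
    ultimately have "((t + 0) + (p + 0) + r, (0 + t') + (0 + q) + \<phi> r) \<in> W"
      using m graph by (intro W_add)
    then show "w \<in> W" by (simp add: w)
  qed
  moreover have "W \<subseteq> g.W"
  proof
    fix w assume "w \<in> W"
    obtain a b where w: "w = (a, b)" by (cases w)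
    obtain x where x: "\<And>\<gamma>. \<gamma> \<in> root_index \<Longrightarrow> x \<gamma> \<in> weight_space \<gamma>" "a = (\<Sum>\<gamma>\<in>root_index. x \<gamma>)"
      using root_index_sum by blast
    obtain y where y: "\<And>\<gamma>. \<gamma> \<in> root_index \<Longrightarrow> y \<gamma> \<in> weight_space \<gamma>" "b = (\<Sum>\<gamma>\<in>root_index. y \<gamma>)"
      using root_index_sum by blast
    have comp: "(x \<gamma>, y \<gamma>) \<in> W" if "\<gamma> \<in> root_index" for \<gamma>
      using W_components[of x y, OF x(1) y(1) _ that] \<open>w \<in> W\<close> w x(2) y(2) by simp
    have comp_g: "(x \<gamma>, y \<gamma>) \<in> g.W" if \<gamma>: "\<gamma> \<in> root_index" for \<gamma>
    proof (cases "\<gamma> = (\<lambda>_. 0)")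
      case True
      then have h: "x \<gamma> \<in> H" "y \<gamma> \<in> H" using x(1)[OF \<gamma>] y(1)[OF \<gamma>] by (simp_all add: weight_space_zero)
      then have "x \<gamma> \<in> tL + rL" using comp[OF \<gamma>] g.sums(1) by (auto simp: sL_def)
      then obtain t r where tr: "x \<gamma> = t + r" "t \<in> tL" "r \<in> rL" by (rule set_plus_elim)
      have "(t + r, \<phi> r) \<in> W" using W_add[OF _ graph[OF tr(3)], of t 0] tr(2) by (simp add: tL_def)
      \<comment> \<open>Removing the glued pair leaves an element of the fibre over 0, which is
        \<open>tR\<close>.\<close>
      from W_diff[OF comp[OF \<gamma>] this] have "(0, y \<gamma> - \<phi> r) \<in> W" by (simp add: tr(1))
      moreover have "y \<gamma> - \<phi> r \<in> H" using h(2) g.\<phi>_mem[OF tr(3)] g.subset_H subspace_diff[OF subspace_H] by blast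
      ultimately have "y \<gamma> - \<phi> r \<in> tR" by (simp add: tR_def)
      from g.gluedI[OF tr(2) g.zero_mem(4) this g.zero_mem(5) tr(3)]
      show ?thesis by (simp add: tr(1))
    next
      case False
      then have \<gamma>r: "\<gamma> \<in> roots H" using \<gamma> by (simp add: root_index_def)
      have xy: "x \<gamma> \<in> root_space H \<gamma>" "y \<gamma> \<in> root_space H \<gamma>"
        using x(1)[OF \<gamma>] y(1)[OF \<gamma>] root_space_eq[OF \<gamma>r] by simp_all
      from root_left_or_right[OF \<gamma>r] show ?thesis
      proof
        assume l: "\<gamma> \<in> left_roots"
        then have "(x \<gamma>, 0) \<in> W" using x(1)[OF \<gamma>] by (simp add: left_roots_def)
        from W_diff[OF comp[OF \<gamma>] this] have yW: "(0, y \<gamma>) \<in> W" by simp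
        have "(y \<gamma>, 0) \<in> W" using l y(1)[OF \<gamma>] by (simp add: left_roots_def)
        \<comment> \<open>A component on the wrong side would put a diagonal pair into
          \<open>W\<close>.\<close>
        from W_add[OF this yW] have "y \<gamma> = 0" using W_diagonal by simp
        moreover have "x \<gamma> \<in> tL + g.P" using l xy(1) root_space_subset_root_sum g.P_subset by blast
        moreover have "0 \<in> tR + g.Q" using g.zero_mem(5) g.Q_subset by blast
        ultimately show ?thesis using g.gluedI_graph_zero by simp
      next
        assume l: "\<gamma> \<in> right_roots"
        then have "(0, y \<gamma>) \<in> W" using y(1)[OF \<gamma>] by (simp add: right_roots_def)
        from W_diff[OF comp[OF \<gamma>] this] have xW: "(x \<gamma>, 0) \<in> W" by simp
        have "(0, x \<gamma>) \<in> W" using l x(1)[OF \<gamma>] by (simp add: right_roots_def)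
        from W_add[OF this xW] have "x \<gamma> = 0" using W_diagonal by simp
        moreover have "y \<gamma> \<in> tR + g.Q" using l xy(2) root_space_subset_root_sum g.Q_subset by blast
        moreover have "0 \<in> tL + g.P" using g.zero_mem(4) g.P_subset by blast
        ultimately show ?thesis using g.gluedI_graph_zero by simp
      qed
    qed
    have "(\<Sum>\<gamma>\<in>root_index. (x \<gamma>, y \<gamma>)) \<in> g.W"
      by (rule pair.subspace_sum[OF g.subspace_glued comp_g])
    then show "w \<in> g.W" by (simp add: w x(2) y(2) sum_prod)
  qed
  ultimately have "W = g.W" by blast
  then show ?thesis using regular_left_right datum by blast
qed

end

theorem theoremC:
  fixes scale :: "'f::{alg_closed_field, field_char_0} \<Rightarrow> 'g::ab_group_add \<Rightarrow> 'g"
    and bracket :: "'g \<Rightarrow> 'g \<Rightarrow> 'g"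
    and H :: "'g set"
  assumes "simple_lie_algebra scale bracket"
    and "lie_algebra.cartan_subalgebra scale bracket H"
  shows
    "(\<forall>W. lie_algebra.lie_subalgebra (prod_scale scale) (prod_bracket bracket) W \<and>
          lie_algebra.diagonally_stable bracket H W \<and>
          is_direct_sum UNIV diagonal W \<longrightarrow>
        (\<exists>SP SM sP sM tP tM rP rM \<phi>.
          lie_algebra.regular_partition scale bracket H SP SM \<and>
          lie_algebra.gluing_datum scale H sP sM tP tM rP rM \<phi> \<and>
          W = lie_algebra.glued_subspace scale bracket H SP SM tP tM rP \<phi>)) \<and>
     (\<forall>SP SM sP sM tP tM rP rM \<phi> W.
          lie_algebra.regular_partition scale bracket H SP SM \<and>
          lie_algebra.gluing_datum scale H sP sM tP tM rP rM \<phi> \<and>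
          W = lie_algebra.glued_subspace scale bracket H SP SM tP tM rP \<phi> \<longrightarrow>
        lie_algebra.diagonally_stable bracket H W \<and>
        (lie_algebra.lie_subalgebra (prod_scale scale) (prod_bracket bracket) W \<longleftrightarrow>
          lie_algebra.contains_coroot_lines scale bracket H SP tP \<and>
          lie_algebra.contains_coroot_lines scale bracket H SM tM) \<and>
        (is_direct_sum UNIV diagonal W \<longleftrightarrow>
          lie_algebra.cartan_transversal scale H tP tM rP \<phi>))"
proof -
  interpret simple_lie_algebra scale bracket by (rule assms(1))
  obtain B0 where B0: "finite B0" "span B0 = UNIV" using finite_dim by blast
  obtain B where B: "B \<subseteq> B0" "independent B" "B0 \<subseteq> span B" by (rule maximal_independent_subset)
  have "finite B" using B(1) B0(1) finite_subset by blast
  moreover have "span B = UNIV" using span_mono[OF B(3)] B0(2) span_span by auto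
  ultimately interpret cartan_pair scale bracket B H
    by unfold_locales (use B(2) assms(2) in auto)
  show ?thesis
  proof (intro conjI allI impI)
    fix W assume W: "lie_algebra.lie_subalgebra (prod_scale scale) (prod_bracket bracket) W \<and>
        diagonally_stable H W \<and> is_direct_sum UNIV diagonal W"
    interpret diagonal_complement scale bracket B H W
      by unfold_locales (use W in auto)
    show "\<exists>SP SM sP sM tP tM rP rM \<phi>. regular_partition H SP SM \<and>
        gluing_datum H sP sM tP tM rP rM \<phi> \<and> W = glued_subspace H SP SM tP tM rP \<phi>"
      by (rule classification)
  next
    fix SP SM sP sM tP tM rP rM \<phi> W
    assume W: "regular_partition H SP SM \<and> gluing_datum H sP sM tP tM rP rM \<phi> \<and>
        W = glued_subspace H SP SM tP tM rP \<phi>"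
    interpret g: glued_datum scale bracket B H SP SM sP sM tP tM rP rM \<phi>
      by unfold_locales (use W in auto)
    have eq: "W = g.W" using W by blast
    show "diagonally_stable H W" unfolding eq by (rule g.glued_diagonally_stable)
    show "lie_algebra.lie_subalgebra (prod_scale scale) (prod_bracket bracket) W \<longleftrightarrow>
        contains_coroot_lines H SP tP \<and> contains_coroot_lines H SM tM"
      unfolding eq by (rule g.glued_subalgebra_iff)
    show "is_direct_sum UNIV diagonal W \<longleftrightarrow> cartan_transversal H tP tM rP \<phi>"
      unfolding eq by (rule g.glued_direct_sum_iff)
  qed
qed

end
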